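(* Let $k\ge 2$ and $i\in\mathcal I$. Assume that each of $r_1,\dots,r_k$ is Lipschitz on $[0,1]$ and that $N^{-2/3}\ll\varepsilon_N\ll 1$ as $N\to\infty$. Let $v$ be an eigenvector of $A_N$, with $L^2$-norm (Euclidean norm) $1$, corresponding to $\lambda_i(A_N)$, such that $e_i^\prime v\ge 0$. Then, for all $j\in\{1,\ldots,k\}\setminus\{i\}$, $$e_j^\prime v=\frac{1}{\theta_i-\theta_j}\left[\theta_i\frac{1}{\lambda_i(A_N)}e_i^\prime W_N e_j+(N\varepsilon_N)^{-2}\frac{1}{\theta_i}\mathrm{E}\left(e_i^\prime W_N^2 e_j\right)\right]+o_p\left(\frac{1}{N\sqrt{\varepsilon_N}}\right).$$
   Context: Setting. Let $\theta_1\ge\dots\ge\theta_k>0$, and let $r_1,\dots,r_k:[0,1]\to\mathbb{R}$ be an orthonormal set in $L^2[0,1]$ such that $f(x,y):=\sum_{i=1}^k\theta_i r_i(x)r_i(y)\ge 0$ for all $(x,y)\in[0,1]^2$. Let $(\varepsilon_N)_{N\ge1}$ be a real sequence with $0<\varepsilon_N\le\left[\sup_{0\le x,y\le 1}f(x,y)\right]^{-1}$. For each $N\ge 1$, $A_N$ is the $N\times N$ random symmetric matrix whose entries $\{A_N(i,j):1\le i\le j\le N\}$ are independent with $A_N(i,j)\sim\mathrm{Bernoulli}(\varepsilon_N f(i/N,j/N))$ (self-loops allowed). $W_N:=A_N-\mathrm{E}(A_N)$, with entrywise expectation. For a real symmetric matrix $M$, $\lambda_1(M)\ge\lambda_2(M)\ge\cdots$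 denote its eigenvalues. With $\theta_0=\infty$ and $\theta_{k+1}=-\infty$, $\mathcal I:=\{1\le i\le k:\theta_{i-1}>\theta_i>\theta_{i+1}\}$. For $1\le i\le k$, $e_i$ (depending on $N$) is the $N\times1$ vector with entries $e_i(m)=N^{-1/2}r_i(m/N)$, $1\le m\le N$; a prime denotes transpose. Notation. $a_N\ll b_N$ means $a_N/b_N\to0$. For random variables $Y_N,Z_N$, $Y_N=o_p(Z_N)$ means $\lim_{N\to\infty}P(|Y_N|>\delta|Z_N|)=0$ for all $\delta>0$. Under the assumptions, $\lambda_i(A_N)$ is non-zero with probability tending to $1$, so the division makes sense on events of probability tending to $1$. *)

theory Defs
  imports
    "HOL-Probability.Probability"
    "HOL-Computational_Algebra.Computational_Algebra"
    "Jordan_Normal_Form.Char_Poly"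
begin

unbundle no inner_syntax
unbundle no vec_syntax

definition much_less :: "(nat \<Rightarrow> real) \<Rightarrow> (nat \<Rightarrow> real) \<Rightarrow> bool" (infix \<open>\<lless>\<close> 50) where
  "a \<lless> b \<longleftrightarrow> (\<lambda>N. a N / b N) \<longlonglongrightarrow> 0"

text \<open>The random variables with index \<open>N\<close> live on the probability space \<open>M N\<close>; taking \<open>M\<close>
  constant gives the case of one common space. The predicate is meaningful only for measurable
  \<open>Y N\<close> and \<open>Z N\<close>.\<close>

definition small_o_p ::
    "(nat \<Rightarrow> 'a measure) \<Rightarrow> (nat \<Rightarrow> 'a \<Rightarrow> real) \<Rightarrow> (nat \<Rightarrow> 'a \<Rightarrow> real) \<Rightarrow> bool" where
  "small_o_p M Y Z \<longleftrightarrow>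
     (\<forall>\<delta>>0. (\<lambda>N. measure (M N) {\<omega> \<in> space (M N). \<bar>Y N \<omega>\<bar> > \<delta> * \<bar>Z N \<omega>\<bar>}) \<longlonglongrightarrow> 0)"

definition orthonormal_L2 :: "'i set \<Rightarrow> ('i \<Rightarrow> real \<Rightarrow> real) \<Rightarrow> bool" where
  "orthonormal_L2 I r \<longleftrightarrow>
     (\<forall>i\<in>I. r i \<in> borel_measurable (lebesgue_on {0..1}) \<and>
            integrable (lebesgue_on {0..1}) (\<lambda>x. (r i x)\<^sup>2)) \<and>
     (\<forall>i\<in>I. \<forall>j\<in>I. (\<integral>x. r i x * r j x \<partial>lebesgue_on {0..1}) = (if i = j then 1 else 0))"

definition conn_kernel :: "nat \<Rightarrow> (nat \<Rightarrow> real) \<Rightarrow> (nat \<Rightarrow> real \<Rightarrow> real) \<Rightarrow> real \<Rightarrow> real \<Rightarrow> real" where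
  "conn_kernel k \<theta> r x y = (\<Sum>i=1..k. \<theta> i * r i x * r i y)"

definition theta_ext :: "nat \<Rightarrow> (nat \<Rightarrow> real) \<Rightarrow> nat \<Rightarrow> ereal" where
  "theta_ext k \<theta> i = (if i = 0 then \<infinity> else if i \<le> k then ereal (\<theta> i) else -\<infinity>)"

definition simple_indices :: "nat \<Rightarrow> (nat \<Rightarrow> real) \<Rightarrow> nat set" where
  "simple_indices k \<theta> = {i \<in> {1..k}.
     theta_ext k \<theta> (i - 1) > theta_ext k \<theta> i \<and> theta_ext k \<theta> i > theta_ext k \<theta> (i + 1)}"

text \<open>Vector and matrix positions are counted from 0, so position \<open>m\<close> belongs to the
  grid point \<open>(m + 1) / N\<close>.\<close>

definition grid :: "nat \<Rightarrow> nat \<Rightarrow> real" where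
  "grid N m = real (m + 1) / real N"

definition grid_vec :: "(real \<Rightarrow> real) \<Rightarrow> nat \<Rightarrow> real vec" where
  "grid_vec g N = vec N (\<lambda>m. real N powr (-1/2) * g (grid N m))"

definition bernoulli_symmetric ::
    "'a measure \<Rightarrow> nat \<Rightarrow> (nat \<Rightarrow> nat \<Rightarrow> real) \<Rightarrow> ('a \<Rightarrow> real mat) \<Rightarrow> bool" where
  "bernoulli_symmetric M N p X \<longleftrightarrow>
     (\<forall>\<omega>\<in>space M. X \<omega> \<in> carrier_mat N N \<and> transpose_mat (X \<omega>) = X \<omega>) \<and>
     prob_space.indep_vars M (\<lambda>_. borel) (\<lambda>ab \<omega>. X \<omega> $$ ab) {(a, b). a \<le> b \<and> b < N} \<and>
     (\<forall>a b. a \<le> b \<and> b < N \<longrightarrow>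
        distr M borel (\<lambda>\<omega>. X \<omega> $$ (a, b)) =
        distr (measure_pmf (bernoulli_pmf (p a b))) borel of_bool)"

definition mat_expectation :: "'a measure \<Rightarrow> nat \<Rightarrow> ('a \<Rightarrow> real mat) \<Rightarrow> real mat" where
  "mat_expectation M N X = mat N N (\<lambda>ab. \<integral>\<omega>. X \<omega> $$ ab \<partial>M)"

definition centred :: "'a measure \<Rightarrow> nat \<Rightarrow> ('a \<Rightarrow> real mat) \<Rightarrow> 'a \<Rightarrow> real mat" where
  "centred M N X \<omega> = X \<omega> - mat_expectation M N X"

text \<open>The \<open>i\<close>-th largest eigenvalue, \<open>i = 1, 2, \<dots>\<close>, counted with multiplicity. A real symmetric
  \<open>N \<times> N\<close> matrix has exactly \<open>N\<close> real eigenvalues, so for such a matrix the value is meaningful when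
  \<open>1 \<le> i \<le> N\<close>.\<close>

definition eigval :: "nat \<Rightarrow> real mat \<Rightarrow> real" where
  "eigval i B = rev (sorted_list_of_multiset (proots (char_poly B))) ! (i - 1)"

definition euclid_norm :: "real vec \<Rightarrow> real" where
  "euclid_norm v = sqrt (v \<bullet> v)"

end

theory Submission
  imports Defs
begin

text \<open>
  Write \<open>s = N \<epsilon>\<^sub>N\<close>, \<open>\<lambda> = \<lambda>\<^sub>i(A)\<close>, and let \<open>v\<close> be the unit eigenvector, so that
  \<open>\<lambda> v = s \<Sum>\<^sub>l \<theta>\<^sub>l (e\<^sub>l' v) e\<^sub>l + W v\<close>. Iterating this equation four times gives
  \<open>\<lambda>\<^sup>4 e\<^sub>j' v = s \<Sum>\<^sub>l \<theta>\<^sub>l (e\<^sub>l' v) (\<lambda>\<^sup>3 e\<^sub>j' e\<^sub>l + \<lambda>\<^sup>2 e\<^sub>j' W e\<^sub>l + \<lambda> e\<^sub>j' W\<^sup>2 e\<^sub>l + e\<^sub>j' W\<^sup>3 e\<^sub>l) + e\<^sub>j' W\<^sup>4 v\<close>,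
  and the remainder is at most \<open>(e\<^sub>j' W\<^sup>8 e\<^sub>j)\<^bsup>1/2\<^esup>\<close>, so no resolvent is needed. All the quadratic
  forms are controlled by two walk counts: a product of independent centred entries along a walk has
  mean zero unless every edge is repeated, and a connected union of walks with \<open>q\<close> edges has at most
  \<open>q + 1\<close> vertices. Hence \<open>e\<^sub>j' W\<^sup>n e\<^sub>l\<close> has mean of order at most \<open>s\<^bsup>\<lfloor>n/2\<rfloor>\<^esup>\<close> and variance of
  order at most \<open>s\<^sup>n / N\<close>. The same count bounds the trace of \<open>W\<^sup>6\<close> by order \<open>N s\<^sup>3\<close>, which is
  \<open>o(s\<^sup>6)\<close> exactly because \<open>N\<^bsup>-2/3\<^esup> \<lless> \<epsilon>\<^sub>N\<close>; so \<open>W\<close> has operator norm \<open>o(s)\<close>, and the min-max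
  principle yields \<open>\<lambda> = s (\<theta>\<^sub>i + o(1))\<close>. Feeding this into the expansion gives first
  \<open>e\<^sub>j' v = O(1/s)\<close> for \<open>j \<noteq> i\<close>, then \<open>\<lambda> - s \<theta>\<^sub>i = O(1)\<close> and \<open>e\<^sub>i' v = 1 + O(1/s)\<close>, and finally the
  claimed expression.
\<close>

section \<open>Moments of products of independent centred edges\<close>

text \<open>The target precision 1/(N sqrt \<epsilon>) equals (sqrt \<epsilon>)/s, and for j other
  than i the gap \<lambda> - s \<theta>_j has order s. So (\<lambda> - s \<theta>_j) e_j' v must be
  known up to o(sqrt \<epsilon>); knowing e_j' v = O(1/s) is not enough. Four iterations are the
  least that reach this. The remainder of order s^2 is divided by \<lambda>^3 and by the gap, which
  leaves s^(-2); its ratio to the target is (N^(-2/3)/\<epsilon>)^(3/2), so the lower bound on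
  \<epsilon> enters here a second time. Three iterations would leave s^(-3/2) and require \<epsilon>
  to dominate N^(-1/2). The operator norm bound only yields |W v|^2 = o(s^2), too weak for \<lambda>
  - s \<theta>_i = O(1). The sharper O(s) comes from applying W to the eigenvector equation and
  absorbing W^2 v. Probability enters through a single event of probability at least 1 - C/K, with C
  independent of N. On it everything is deterministic, with constants depending on K, and K is
  chosen only at the very end. The eigenvector therefore never has to be handled
  probabilistically.\<close>

lemma prod_list_map_eq_prod_count:
  fixes Y :: "'e \<Rightarrow> 'b :: comm_monoid_mult"
  shows "prod_list (map Y es) = (\<Prod>e\<in>set es. Y e ^ count_list es e)"
proof -
  have "prod_list (map Y es) = prod_mset (image_mset Y (mset es))"
    by (metis mset_map prod_mset_prod_list)
  then show ?thesis
    by (simp add: image_prod_mset_multiplicity count_mset_0_iff count_list_eq_length_filter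
      count_mset)
qed

lemma sum_count_list: "(\<Sum>e\<in>set es. count_list es e) = length es"
  using sum_list_map_eq_sum_count[of "\<lambda>_. 1::nat" es] by (simp add: sum_list_triv)

text \<open>\<open>Y e\<close> models a centred edge indicator, and \<open>p\<close> is a common
  upper bound for the variances, not the success probability of any particular edge. The bound by 1
  holds only almost surely because the entries are specified through their distributions.\<close>

locale indep_edges = prob_space M for M :: "'a measure" +
  fixes Y :: "'e \<Rightarrow> 'a \<Rightarrow> real" and I :: "'e set" and p :: real
  assumes indep: "indep_vars (\<lambda>_. borel) Y I"
    and bounded: "\<And>e \<omega>. e \<in> I \<Longrightarrow> AE \<omega> in M. \<bar>Y e \<omega>\<bar> \<le> 1"
    and mean_zero: "\<And>e. e \<in> I \<Longrightarrow> expectation (Y e) = 0"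
    and second_moment: "\<And>e. e \<in> I \<Longrightarrow> expectation (\<lambda>\<omega>. (Y e \<omega>)\<^sup>2) \<le> p"
    and p_bounds: "0 \<le> p" "p \<le> 1"
begin

lemma measurable_edge [measurable]: "e \<in> I \<Longrightarrow> Y e \<in> borel_measurable M"
  using indep unfolding indep_vars_def by auto

definition moment :: "'e list \<Rightarrow> real" where
  "moment es = expectation (\<lambda>\<omega>. prod_list (map (\<lambda>e. Y e \<omega>) es))"

lemma measurable_prod_list:
  "set es \<subseteq> I \<Longrightarrow> (\<lambda>\<omega>. prod_list (map (\<lambda>e. Y e \<omega>) es)) \<in> borel_measurable M"
  by (induction es) auto

lemma AE_prod_list_le_1:
  "set es \<subseteq> I \<Longrightarrow> AE \<omega> in M. \<bar>prod_list (map (\<lambda>e. Y e \<omega>) es)\<bar> \<le> 1"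
proof (induction es)
  case (Cons e es)
  have "AE \<omega> in M. \<bar>Y e \<omega>\<bar> \<le> 1" "AE \<omega> in M. \<bar>prod_list (map (\<lambda>e. Y e \<omega>) es)\<bar> \<le> 1"
    using Cons bounded by auto
  then show ?case
    by eventually_elim (simp add: abs_mult mult_le_one)
qed simp

lemma integrable_prod_list:
  "set es \<subseteq> I \<Longrightarrow> integrable M (\<lambda>\<omega>. prod_list (map (\<lambda>e. Y e \<omega>) es))"
  using AE_prod_list_le_1 measurable_prod_list by (intro integrable_const_bound[where B = 1]) auto

lemma integrable_power: "e \<in> I \<Longrightarrow> integrable M (\<lambda>\<omega>. Y e \<omega> ^ n)"
  using integrable_prod_list[of "replicate n e"] by (cases "n = 0") (auto simp: set_replicate_conv_if)

lemma moment_eq_prod: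
  assumes "set es \<subseteq> I"
  shows "moment es = (\<Prod>e\<in>set es. expectation (\<lambda>\<omega>. Y e \<omega> ^ count_list es e))"
proof -
  have "indep_vars (\<lambda>_. borel) (\<lambda>e \<omega>. Y e \<omega> ^ count_list es e) (set es)"
    using indep_vars_subset[OF indep assms]
    by (rule indep_vars_compose2[where Y = "\<lambda>e y. y ^ count_list es e"]) auto
  then show ?thesis
    unfolding moment_def prod_list_map_eq_prod_count
    using assms by (subst indep_vars_lebesgue_integral) (auto intro!: integrable_power)
qed

text \<open>Since |Y| is at most 1, every higher power is dominated by the square. A repeated edge
  thus costs exactly one factor \<open>p\<close>, whatever its multiplicity.\<close>

lemma abs_expectation_power_le:
  assumes "e \<in> I" "2 \<le> n"
  shows "\<bar>expectation (\<lambda>\<omega>. Y e \<omega> ^ n)\<bar> \<le> p"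
proof -
  have "\<bar>expectation (\<lambda>\<omega>. Y e \<omega> ^ n)\<bar> \<le> expectation (\<lambda>\<omega>. \<bar>Y e \<omega> ^ n\<bar>)"
    by (rule integral_abs_bound)
  also have "\<dots> \<le> expectation (\<lambda>\<omega>. (Y e \<omega>)\<^sup>2)"
  proof (rule integral_mono_AE)
    show "AE \<omega> in M. \<bar>Y e \<omega> ^ n\<bar> \<le> (Y e \<omega>)\<^sup>2"
      using bounded[OF assms(1)]
    proof eventually_elim
      case (elim \<omega>)
      then have "\<bar>Y e \<omega>\<bar> ^ n \<le> \<bar>Y e \<omega>\<bar>\<^sup>2"
        using assms(2) by (intro power_decreasing) auto
      then show ?case by (simp add: power_abs)
    qed
  qed (use assms integrable_power in \<open>auto intro!: integrable_abs\<close>)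
  also have "\<dots> \<le> p" by (rule second_moment[OF assms(1)])
  finally show ?thesis .
qed

text \<open>An edge that occurs once splits off by independence and has mean zero. If every edge is
  repeated, there are at most half as many edges as factors; only this consequence is kept, since it
  is all that the counting needs.\<close>

lemma moment_bound:
  assumes "set es \<subseteq> I"
  shows "\<bar>moment es\<bar> \<le> (if 2 * card (set es) \<le> length es then p ^ card (set es) else 0)"
proof (cases "\<forall>e\<in>set es. 2 \<le> count_list es e")
  case True
  then have "2 * card (set es) \<le> (\<Sum>e\<in>set es. count_list es e)"
    using sum_bounded_below[of "set es" 2 "count_list es"] by (simp add: mult.commute)
  then have "2 * card (set es) \<le> length es" by (simp add: sum_count_list)
  moreover have "\<bar>moment es\<bar> \<le> (\<Prod>e\<in>set es. p)"
    unfolding moment_eq_prod[OF assms] abs_prod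
    using True assms by (intro prod_mono) (auto intro!: abs_expectation_power_le)
  ultimately show ?thesis by simp
next
  case False
  then obtain e where e: "e \<in> set es" "count_list es e < 2" by force
  then have "count_list es e = 1"
    using count_list_0_iff[of es e] by linarith
  then have "expectation (\<lambda>\<omega>. Y e \<omega> ^ count_list es e) = 0"
    using mean_zero[of e] e assms by auto
  then have "moment es = 0"
    unfolding moment_eq_prod[OF assms] using e by (intro prod_zero) auto
  then show ?thesis using p_bounds by auto
qed

lemma moment_append_disjoint:
  assumes "set es \<subseteq> I" "set fs \<subseteq> I" "set es \<inter> set fs = {}"
  shows "moment (es @ fs) = moment es * moment fs"
proof -
  have *: "set (es @ fs) \<subseteq> I" using assms by auto
  have "(\<Prod>e\<in>set fs. expectation (\<lambda>\<omega>. Y e \<omega> ^ (count_list es e + count_list fs e))) =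
    (\<Prod>e\<in>set fs. expectation (\<lambda>\<omega>. Y e \<omega> ^ count_list fs e))"
    using assms(3) by (intro prod.cong refl, subst count_notin) (auto simp: disjoint_iff)
  moreover have "(\<Prod>e\<in>set es. expectation (\<lambda>\<omega>. Y e \<omega> ^ (count_list es e + count_list fs e))) =
    (\<Prod>e\<in>set es. expectation (\<lambda>\<omega>. Y e \<omega> ^ count_list es e))"
    using assms(3) by (intro prod.cong) (auto simp: count_notin disjoint_iff)
  ultimately show ?thesis
    unfolding moment_eq_prod[OF *] moment_eq_prod[OF assms(1)] moment_eq_prod[OF assms(2)]
    by (simp add: prod.union_disjoint assms(3))
qed

text \<open>Disjoint edge sets give independent products and hence covariance zero. Otherwise the
  joint moment and the product of moments are each bounded by \<open>p ^ card\<close>, which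
  explains the factor 2.\<close>

lemma covariance_bound:
  assumes "set es \<subseteq> I" "set fs \<subseteq> I"
  shows "\<bar>moment (es @ fs) - moment es * moment fs\<bar> \<le>
    (if set es \<inter> set fs \<noteq> {} \<and> 2 * card (set es \<union> set fs) \<le> length es + length fs
     then 2 * p ^ card (set es \<union> set fs) else 0)"
proof (cases "set es \<inter> set fs = {}")
  case True
  then show ?thesis using moment_append_disjoint[OF assms] by simp
next
  case False
  let ?q = "card (set es \<union> set fs)"
  have 1: "\<bar>moment (es @ fs)\<bar> \<le> (if 2 * ?q \<le> length es + length fs then p ^ ?q else 0)"
    using moment_bound[of "es @ fs"] assms unfolding set_append length_append by simp
  have le: "?q \<le> card (set es) + card (set fs)" by (rule card_Un_le)
  have "\<bar>moment es\<bar> * \<bar>moment fs\<bar> \<le>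
    (if 2 * card (set es) \<le> length es then p ^ card (set es) else 0) *
    (if 2 * card (set fs) \<le> length fs then p ^ card (set fs) else 0)"
    using moment_bound[OF assms(1)] moment_bound[OF assms(2)] by (intro mult_mono) auto
  \<comment> \<open>If both lists meet their own condition, adding the two gives the condition on
    the union, because \<open>?q\<close> is at most the sum of the two cardinalities.\<close>
  also have "\<dots> \<le> (if 2 * ?q \<le> length es + length fs then p ^ (card (set es) + card (set fs)) else 0)"
    using le p_bounds by (auto simp: power_add)
  also have "\<dots> \<le> (if 2 * ?q \<le> length es + length fs then p ^ ?q else 0)"
    using le p_bounds by (auto intro!: power_decreasing)
  finally have "\<bar>moment es * moment fs\<bar> \<le> (if 2 * ?q \<le> length es + length fs then p ^ ?q else 0)"
    by (simp add: abs_mult)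
  with 1 show ?thesis using False by (auto split: if_splits)
qed

end

section \<open>Counting walks\<close>

text \<open>An undirected edge is stored as (min, max), which matches the upper-triangular index set
  on which the entries are independent. A step from a vertex to itself is an edge as well, since
  self-loops are allowed.\<close>

fun walk_edges :: "nat list \<Rightarrow> (nat \<times> nat) list" where
  "walk_edges (a # b # xs) = (min a b, max a b) # walk_edges (b # xs)"
| "walk_edges _ = []"

lemma length_walk_edges [simp]: "length (walk_edges xs) = length xs - 1"
  by (induction xs rule: walk_edges.induct) auto

lemma walk_edges_append:
  "walk_edges (xs @ a # ys) = walk_edges (xs @ [a]) @ walk_edges (a # ys)"
  by (induction xs rule: walk_edges.induct) auto

lemma walk_edges_subset: "e \<in> set (walk_edges xs) \<Longrightarrow> fst e \<in> set xs \<and> snd e \<in> set xs"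
  by (induction xs rule: walk_edges.induct) (auto simp: min_def max_def split: if_splits)

lemma walk_edges_le: "e \<in> set (walk_edges xs) \<Longrightarrow> fst e \<le> snd e"
  by (induction xs rule: walk_edges.induct) (auto simp: min_def max_def)

lemma set_walk_edges_rev: "set (walk_edges (rev xs)) = set (walk_edges xs)"
proof (induction xs rule: walk_edges.induct)
  case (1 a b xs)
  have "walk_edges (rev (a # b # xs)) = walk_edges (rev (b # xs)) @ walk_edges [b, a]"
    using walk_edges_append[of "rev xs" b "[a]"] by simp
  then show ?case using 1 by (auto simp: min.commute max.commute)
qed auto

lemma walk_edges_split:
  assumes "e \<in> set (walk_edges ys)"
  obtains us a b vs where "ys = us @ a # b # vs" "e = (min a b, max a b)"
proof -
  have "\<exists>us a b vs. ys = us @ a # b # vs \<and> e = (min a b, max a b)"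
    using assms
  proof (induction ys rule: walk_edges.induct)
    case (1 a b xs)
    show ?case
    proof (cases "e = (min a b, max a b)")
      case True
      then show ?thesis by (intro exI[of _ "[]"]) auto
    next
      case False
      then obtain us c d vs where "b # xs = us @ c # d # vs" "e = (min c d, max c d)"
        using 1 by auto
      then show ?thesis by (metis append_Cons)
    qed
  qed auto
  then show ?thesis using that by blast
qed

text \<open>A step to a vertex outside \<open>S\<close> uses an edge outside \<open>E\<close>, since
  edges in \<open>E\<close> have both ends in \<open>S\<close>; so each new vertex is paid for by a
  new edge. Starting from an arbitrary \<open>S\<close> and \<open>E\<close> instead of a single
  point makes it possible to glue several walks together.\<close>

lemma card_walk_vertices:
  assumes "finite S" "finite E" "card S \<le> card E + 1" "fst ` E \<subseteq> S" "snd ` E \<subseteq> S"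
    "xs \<noteq> []" "hd xs \<in> S"
  shows "card (S \<union> set xs) \<le> card (E \<union> set (walk_edges xs)) + 1"
  using assms
proof (induction xs arbitrary: S E rule: walk_edges.induct)
  case (1 a b xs)
  let ?e = "(min a b, max a b)"
  let ?S = "insert b S" and ?E = "insert ?e E"
  have new: "?e \<notin> E" if "b \<notin> S"
  proof
    assume "?e \<in> E"
    then have "min a b \<in> S" "max a b \<in> S" using 1(5,6) by force+
    then show False using that by (auto simp: min_def max_def split: if_splits)
  qed
  have card: "card ?S \<le> card ?E + 1"
    using 1(2,3,4) new by (cases "b \<in> S") (auto simp: card_insert_if)
  have "card (?S \<union> set (b # xs)) \<le> card (?E \<union> set (walk_edges (b # xs))) + 1"
    using 1(2-8) card by (intro 1(1)) (auto simp: min_def max_def)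
  moreover have "?S \<union> set (b # xs) = S \<union> set (a # b # xs)"
    using 1(8) by auto
  moreover have "?E \<union> set (walk_edges (b # xs)) = E \<union> set (walk_edges (a # b # xs))"
    by auto
  ultimately show ?case by simp
next
  case ("2_2" a)
  then show ?case by (simp add: insert_absorb)
qed auto

lemma card_set_walk_le: "card (set xs) \<le> card (set (walk_edges xs)) + 1"
  using card_walk_vertices[of "{hd xs}" "{}" xs] by (cases xs) auto

text \<open>The shared edge makes the union of both walks connected, so the surplus of vertices over
  edges is 1 and not 2. This saved vertex is the origin of the factor 1/N in the variances.\<close>

lemma card_two_walks_le:
  assumes "set (walk_edges xs) \<inter> set (walk_edges ys) \<noteq> {}"
  shows "card (set xs \<union> set ys) \<le> card (set (walk_edges xs) \<union> set (walk_edges ys)) + 1"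
proof -
  obtain e where e: "e \<in> set (walk_edges xs)" "e \<in> set (walk_edges ys)" using assms by auto
  obtain us a b vs where ys: "ys = us @ a # b # vs" and eab: "e = (min a b, max a b)"
    using walk_edges_split[OF e(2)] by metis
  have ab: "a \<in> set xs" "b \<in> set xs"
    using walk_edges_subset[OF e(1)] eab by (auto simp: min_def max_def split: if_splits)
  \<comment> \<open>The second walk is cut at the shared edge and explored in both directions,
    backwards from \<open>a\<close> and forwards from \<open>b\<close>. Both pieces then start at a
    vertex of the first walk.\<close>
  let ?us = "rev (us @ [a])"
  let ?S = "set xs \<union> set ?us" and ?E = "set (walk_edges xs) \<union> set (walk_edges ?us)"
  have 1: "card ?S \<le> card ?E + 1"
  proof (rule card_walk_vertices)
    show "card (set xs) \<le> card (set (walk_edges xs)) + 1" by (rule card_set_walk_le)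
  qed (use ab walk_edges_subset[of _ xs] in auto)
  have "card (?S \<union> set (b # vs)) \<le> card (?E \<union> set (walk_edges (b # vs))) + 1"
    by (rule card_walk_vertices[OF _ _ 1])
      (use ab walk_edges_subset[of _ xs] walk_edges_subset[of _ ?us] in auto)
  moreover have "?S \<union> set (b # vs) = set xs \<union> set ys" using ys by auto
  moreover have "?E \<union> set (walk_edges (b # vs)) = set (walk_edges xs) \<union> set (walk_edges ys)"
    using e eab unfolding ys walk_edges_append[of us a "b # vs"]
      set_walk_edges_rev[of "us @ [a]"] by auto
  ultimately show ?thesis by simp
qed

definition words :: "nat \<Rightarrow> nat \<Rightarrow> nat list set" where
  "words N m = {xs. set xs \<subseteq> {..<N} \<and> length xs = m}"

lemma finite_words [simp]: "finite (words N m)"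
  unfolding words_def by (simp add: finite_lists_length_eq)

lemma card_words [simp]: "card (words N m) = N ^ m"
  unfolding words_def by (simp add: card_lists_length_eq)

lemma append_words: "xs \<in> words N m \<Longrightarrow> ys \<in> words N n \<Longrightarrow> xs @ ys \<in> words N (m + n)"
  by (auto simp: words_def)

text \<open>Such a word is encoded by a list of \<open>p\<close> letters together with positions in that list.\<close>

lemma card_few_letters_le:
  assumes "0 < m"
  shows "card {xs \<in> words N m. card (set xs) \<le> p} \<le> p ^ m * N ^ p"
proof -
  have "{xs \<in> words N m. card (set xs) \<le> p} \<subseteq>
    (\<lambda>(is, vs). map ((!) vs) is) ` (words p m \<times> words N p)"
  proof
    fix xs assume "xs \<in> {xs \<in> words N m. card (set xs) \<le> p}"
    then have xs: "set xs \<subseteq> {..<N}" "length xs = m" "card (set xs) \<le> p"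
      by (auto simp: words_def)
    obtain us where us: "set us = set xs" "length us = card (set xs)"
      using finite_distinct_list[of "set xs"] by (metis distinct_card List.finite_set)
    \<comment> \<open>The alphabet is padded to exactly \<open>p\<close> letters with a letter
      already present, so its set is unchanged; \<open>0 < m\<close> guarantees that
      \<open>hd xs\<close> is a letter of the word.\<close>
    define vs where "vs = us @ replicate (p - length us) (hd xs)"
    have vs: "set vs = set xs" "length vs = p"
      using us xs assms by (auto simp: vs_def set_replicate_conv_if)
    have "\<forall>x\<in>set xs. \<exists>i<p. vs ! i = x"
      using vs by (metis in_set_conv_nth)
    then obtain pos where pos: "\<And>x. x \<in> set xs \<Longrightarrow> pos x < p \<and> vs ! pos x = x" by metis
    have "xs = map ((!) vs) (map pos xs)"
      using pos by (simp add: map_idI)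
    moreover have "(map pos xs, vs) \<in> words p m \<times> words N p"
      using pos vs xs by (auto simp: words_def)
    ultimately show "xs \<in> (\<lambda>(is, vs). map ((!) vs) is) ` (words p m \<times> words N p)"
      by (metis (no_types, lifting) case_prod_conv image_eqI)
  qed
  then have "card {xs \<in> words N m. card (set xs) \<le> p} \<le>
      card ((\<lambda>(is, vs). map ((!) vs) is) ` (words p m \<times> words N p))"
    by (intro card_mono) auto
  also have "\<dots> \<le> card (words p m \<times> words N p)"
    by (intro card_image_le) auto
  finally show ?thesis by (simp add: card_cartesian_product)
qed

text \<open>Grouping by the number j of edges, there are at most (j+1)^m N^(j+1) words of weight
  p^j. As N p is at least 1, the top value j = h dominates, and the h + 1 groups raise the exponent
  to m + 1. The injection \<open>w\<close> lets the same count serve single walks and pairs of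
  walks.\<close>

lemma sum_power_few_letters_le:
  fixes p :: real
  assumes "finite T" "0 \<le> p" "1 \<le> real N * p" "0 < m"
    and inj: "inj_on w T"
    and w: "\<And>t. t \<in> T \<Longrightarrow> w t \<in> words N m"
    and le: "\<And>t. t \<in> T \<Longrightarrow> card (set (w t)) \<le> q t + 1"
    and q: "\<And>t. t \<in> T \<Longrightarrow> q t \<le> h"
  shows "(\<Sum>t\<in>T. p ^ q t) \<le> real ((h + 1) ^ (m + 1)) * real N * (real N * p) ^ h"
proof -
  have "(\<Sum>t\<in>T. p ^ q t) = (\<Sum>j\<le>h. \<Sum>t\<in>{t \<in> T. q t = j}. p ^ q t)"
    using assms by (intro sum.group[symmetric]) auto
  also have "\<dots> = (\<Sum>j\<le>h. real (card {t \<in> T. q t = j}) * p ^ j)"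
    by (intro sum.cong) auto
  also have "\<dots> \<le> (\<Sum>j\<le>h. real ((h + 1) ^ m) * real N * (real N * p) ^ h)"
  proof (intro sum_mono)
    fix j assume "j \<in> {..h}"
    then have j: "j \<le> h" by simp
    have "card {t \<in> T. q t = j} = card (w ` {t \<in> T. q t = j})"
      using inj by (intro card_image[symmetric]) (auto simp: inj_on_def)
    also have "\<dots> \<le> card {xs \<in> words N m. card (set xs) \<le> j + 1}"
      using w le by (intro card_mono) force+
    also have "\<dots> \<le> (j + 1) ^ m * N ^ (j + 1)"
      by (rule card_few_letters_le[OF \<open>0 < m\<close>])
    also have "\<dots> \<le> (h + 1) ^ m * N ^ (j + 1)"
      using j by (intro mult_right_mono power_mono) auto
    finally have "real (card {t \<in> T. q t = j}) * p ^ j \<le> real ((h + 1) ^ m * N ^ (j + 1)) * p ^ j"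
      using \<open>0 \<le> p\<close> by (intro mult_right_mono) (simp_all only: of_nat_le_iff zero_le_power)
    also have "\<dots> = real ((h + 1) ^ m) * real N * (real N * p) ^ j"
      by (simp add: power_mult_distrib)
    also have "\<dots> \<le> real ((h + 1) ^ m) * real N * (real N * p) ^ h"
      using j assms by (intro mult_left_mono power_increasing) auto
    finally show "real (card {t \<in> T. q t = j}) * p ^ j \<le>
      real ((h + 1) ^ m) * real N * (real N * p) ^ h" .
  qed
  also have "\<dots> = real ((h + 1) ^ (m + 1)) * real N * (real N * p) ^ h"
    by (simp add: algebra_simps)
  finally show ?thesis .
qed

section \<open>Moments and covariances summed over all walks\<close>

locale random_symmetric = indep_edges M Y "{(a, b). a \<le> b \<and> b < N}" p
  for M :: "'a measure" and Y :: "nat \<times> nat \<Rightarrow> 'a \<Rightarrow> real" and N :: nat and p :: real +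
  assumes Np: "1 \<le> real N * p"
begin

lemma walk_edges_in: "xs \<in> words N m \<Longrightarrow> set (walk_edges xs) \<subseteq> {(a, b). a \<le> b \<and> b < N}"
  using walk_edges_subset walk_edges_le unfolding words_def by fastforce

lemma sum_abs_moment_le:
  "(\<Sum>xs\<in>words N (n + 1). \<bar>moment (walk_edges xs)\<bar>) \<le>
    real ((n div 2 + 1) ^ (n + 2)) * real N * (real N * p) ^ (n div 2)"
proof -
  let ?q = "\<lambda>xs. card (set (walk_edges xs))"
  let ?T = "{xs \<in> words N (n + 1). 2 * ?q xs \<le> n}"
  have "(\<Sum>xs\<in>words N (n + 1). \<bar>moment (walk_edges xs)\<bar>) \<le>
    (\<Sum>xs\<in>words N (n + 1). if 2 * ?q xs \<le> n then p ^ ?q xs else 0)"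
  proof (intro sum_mono)
    fix xs assume xs: "xs \<in> words N (n + 1)"
    then have "length (walk_edges xs) = n" by (simp add: words_def)
    with moment_bound[OF walk_edges_in[OF xs]]
    show "\<bar>moment (walk_edges xs)\<bar> \<le> (if 2 * ?q xs \<le> n then p ^ ?q xs else 0)" by simp
  qed
  also have "\<dots> = (\<Sum>xs\<in>?T. p ^ ?q xs)"
    by (intro sum.inter_filter[symmetric]) simp
  also have "\<dots> \<le> real ((n div 2 + 1) ^ (n + 1 + 1)) * real N * (real N * p) ^ (n div 2)"
    using Np p_bounds card_set_walk_le
    by (intro sum_power_few_letters_le[where w = "\<lambda>xs. xs"]) auto
  finally show ?thesis by simp
qed

text \<open>A pair of n-step walks is read as one word of length 2n + 2. Contributing pairs share an
  edge and have at most n distinct edges, hence at most n + 1 vertices: one free factor N instead of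
  the two that a product of means would carry.\<close>

lemma sum_abs_covariance_le:
  "(\<Sum>xs\<in>words N (n + 1). \<Sum>ys\<in>words N (n + 1).
      \<bar>moment (walk_edges xs @ walk_edges ys) - moment (walk_edges xs) * moment (walk_edges ys)\<bar>) \<le>
    2 * real ((n + 1) ^ (2 * n + 3)) * real N * (real N * p) ^ n"
proof -
  let ?E = "\<lambda>t. set (walk_edges (fst t)) \<union> set (walk_edges (snd t))"
  let ?P = "\<lambda>t. set (walk_edges (fst t)) \<inter> set (walk_edges (snd t)) \<noteq> {} \<and> card (?E t) \<le> n"
  let ?W = "words N (n + 1) \<times> words N (n + 1)"
  have "(\<Sum>xs\<in>words N (n + 1). \<Sum>ys\<in>words N (n + 1).
      \<bar>moment (walk_edges xs @ walk_edges ys) - moment (walk_edges xs) * moment (walk_edges ys)\<bar>)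
    = (\<Sum>t\<in>?W. \<bar>moment (walk_edges (fst t) @ walk_edges (snd t)) -
          moment (walk_edges (fst t)) * moment (walk_edges (snd t))\<bar>)"
    by (simp add: sum.cartesian_product case_prod_unfold)
  also have "\<dots> \<le> (\<Sum>t\<in>?W. if ?P t then 2 * p ^ card (?E t) else 0)"
  proof (intro sum_mono)
    fix t assume t: "t \<in> ?W"
    have nonneg: "0 \<le> p ^ card (?E t)" using p_bounds by simp
    from t have *: "fst t \<in> words N (n + 1)" "snd t \<in> words N (n + 1)" by auto
    then have "length (walk_edges (fst t)) = n" "length (walk_edges (snd t)) = n"
      by (simp_all add: words_def)
    with covariance_bound[OF walk_edges_in[OF *(1)] walk_edges_in[OF *(2)]]
    show "\<bar>moment (walk_edges (fst t) @ walk_edges (snd t)) -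
          moment (walk_edges (fst t)) * moment (walk_edges (snd t))\<bar> \<le>
        (if ?P t then 2 * p ^ card (?E t) else 0)"
      using nonneg by (simp split: if_splits)
  qed
  also have "\<dots> = (\<Sum>t\<in>{t \<in> ?W. ?P t}. 2 * p ^ card (?E t))"
    by (intro sum.inter_filter[symmetric]) simp
  also have "\<dots> = 2 * (\<Sum>t\<in>{t \<in> ?W. ?P t}. p ^ card (?E t))"
    by (simp add: sum_distrib_left)
  also have "(\<Sum>t\<in>{t \<in> ?W. ?P t}. p ^ card (?E t)) \<le>
      real ((n + 1) ^ ((2 * n + 2) + 1)) * real N * (real N * p) ^ n"
  proof (intro sum_power_few_letters_le[where w = "\<lambda>t. fst t @ snd t"])
    show "inj_on (\<lambda>t. fst t @ snd t) {t \<in> ?W. ?P t}"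
      by (auto simp: inj_on_def words_def)
    show "fst t @ snd t \<in> words N (2 * n + 2)" if "t \<in> {t \<in> ?W. ?P t}" for t
      using that append_words[of "fst t" N "n + 1" "snd t" "n + 1"] by (auto simp: mult_2)
    show "card (set (fst t @ snd t)) \<le> card (?E t) + 1" if "t \<in> {t \<in> ?W. ?P t}" for t
      using that card_two_walks_le[of "fst t" "snd t"] by simp
  qed (use Np p_bounds in auto)
  finally show ?thesis by (simp add: algebra_simps numeral_3_eq_3)
qed

end

section \<open>Moments of quadratic forms in matrix powers\<close>

text \<open>Vectors are plain functions of which only the values below \<open>N\<close> matter.
  Matrix powers then become iterates of \<open>mv\<close>, with no dimension side
  conditions.\<close>

definition ip :: "nat \<Rightarrow> (nat \<Rightarrow> real) \<Rightarrow> (nat \<Rightarrow> real) \<Rightarrow> real" where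
  "ip N u w = (\<Sum>a<N. u a * w a)"

definition mv :: "nat \<Rightarrow> (nat \<Rightarrow> nat \<Rightarrow> real) \<Rightarrow> (nat \<Rightarrow> real) \<Rightarrow> nat \<Rightarrow> real" where
  "mv N B u = (\<lambda>a. \<Sum>b<N. B a b * u b)"

lemma sum_words_Suc:
  "(\<Sum>xs\<in>words N (Suc n). F xs) = (\<Sum>b<N. \<Sum>xs\<in>words N n. F (b # xs))"
proof -
  have "(\<Sum>xs\<in>words N (Suc n). F xs) = (\<Sum>t\<in>{..<N} \<times> words N n. F (fst t # snd t))"
    by (rule sum.reindex_bij_witness[of _ "\<lambda>t. fst t # snd t" "\<lambda>xs. (hd xs, tl xs)"])
      (auto simp: words_def length_Suc_conv)
  then show ?thesis by (simp add: sum.cartesian_product case_prod_unfold)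
qed

definition walk_prod :: "(nat \<times> nat \<Rightarrow> real) \<Rightarrow> nat list \<Rightarrow> real" where
  "walk_prod y xs = prod_list (map y (walk_edges xs))"

abbreviation sym_entries :: "(nat \<times> nat \<Rightarrow> real) \<Rightarrow> nat \<Rightarrow> nat \<Rightarrow> real" where
  "sym_entries y a b \<equiv> y (min a b, max a b)"

lemma mv_power_walks:
  "a < N \<Longrightarrow> (mv N (sym_entries y) ^^ n) w a =
    (\<Sum>xs\<in>words N n. walk_prod y (a # xs) * w (last (a # xs)))"
proof (induction n arbitrary: a)
  case 0
  have "words N 0 = {[]}" by (auto simp: words_def)
  then show ?case by (simp add: walk_prod_def)
next
  case (Suc n)
  have "(mv N (sym_entries y) ^^ Suc n) w a =
    (\<Sum>b<N. sym_entries y a b * (mv N (sym_entries y) ^^ n) w b)"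
    by (simp add: mv_def)
  also have "\<dots> = (\<Sum>b<N. \<Sum>xs\<in>words N n. walk_prod y (a # b # xs) * w (last (a # b # xs)))"
    using Suc by (intro sum.cong) (auto simp: walk_prod_def sum_distrib_left mult.assoc)
  also have "\<dots> = (\<Sum>xs\<in>words N (Suc n). walk_prod y (a # xs) * w (last (a # xs)))"
    by (simp add: sum_words_Suc)
  finally show ?case .
qed

lemma ip_mv_power_walks:
  "ip N u ((mv N (sym_entries y) ^^ n) w) =
    (\<Sum>xs\<in>words N (n + 1). u (hd xs) * w (last xs) * walk_prod y xs)"
proof -
  have "ip N u ((mv N (sym_entries y) ^^ n) w) =
    (\<Sum>a<N. \<Sum>xs\<in>words N n. u a * w (last (a # xs)) * walk_prod y (a # xs))"
    unfolding ip_def by (intro sum.cong) (auto simp: mv_power_walks sum_distrib_left algebra_simps)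
  then show ?thesis by (simp add: sum_words_Suc)
qed

lemma words_hd_last: "xs \<in> words N (n + 1) \<Longrightarrow> hd xs < N \<and> last xs < N"
  using subsetD[of "set xs" "{..<N}" "hd xs"] subsetD[of "set xs" "{..<N}" "last xs"]
  by (cases "xs = []") (auto simp: words_def)

lemma abs_ends_le:
  assumes "\<And>a. a < N \<Longrightarrow> \<bar>u a\<bar> \<le> U / sqrt N" "\<And>a. a < N \<Longrightarrow> \<bar>w a\<bar> \<le> U / sqrt N"
    and "xs \<in> words N (n + 1)"
  shows "\<bar>u (hd xs) * w (last xs)\<bar> \<le> U\<^sup>2 / real N"
proof -
  have "\<bar>u (hd xs)\<bar> * \<bar>w (last xs)\<bar> \<le> (U / sqrt N) * (U / sqrt N)"
    using words_hd_last[OF assms(3)] by (intro mult_mono' assms(1,2)) auto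
  then show ?thesis by (simp add: abs_mult power2_eq_square)
qed

context random_symmetric
begin

definition quad :: "nat \<Rightarrow> (nat \<Rightarrow> real) \<Rightarrow> (nat \<Rightarrow> real) \<Rightarrow> 'a \<Rightarrow> real" where
  "quad n u w \<omega> = ip N u ((mv N (sym_entries (\<lambda>e. Y e \<omega>)) ^^ n) w)"

lemma quad_walks:
  "quad n u w \<omega> = (\<Sum>xs\<in>words N (n + 1). u (hd xs) * w (last xs) * walk_prod (\<lambda>e. Y e \<omega>) xs)"
  unfolding quad_def by (rule ip_mv_power_walks)

lemma expectation_walk_prod:
  "expectation (\<lambda>\<omega>. walk_prod (\<lambda>e. Y e \<omega>) xs) = moment (walk_edges xs)"
  unfolding walk_prod_def moment_def ..

lemma expectation_walk_prod2:
  "expectation (\<lambda>\<omega>. walk_prod (\<lambda>e. Y e \<omega>) xs * walk_prod (\<lambda>e. Y e \<omega>) ys) =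
    moment (walk_edges xs @ walk_edges ys)"
  unfolding walk_prod_def moment_def by simp

lemma integrable_walk_prod:
  "xs \<in> words N m \<Longrightarrow> integrable M (\<lambda>\<omega>. walk_prod (\<lambda>e. Y e \<omega>) xs)"
  unfolding walk_prod_def by (intro integrable_prod_list walk_edges_in)

lemma integrable_walk_prod2:
  assumes "xs \<in> words N m" "ys \<in> words N l"
  shows "integrable M (\<lambda>\<omega>. walk_prod (\<lambda>e. Y e \<omega>) xs * walk_prod (\<lambda>e. Y e \<omega>) ys)"
  using integrable_prod_list[of "walk_edges xs @ walk_edges ys"]
    walk_edges_in[OF assms(1)] walk_edges_in[OF assms(2)]
  unfolding walk_prod_def by simp

lemma integrable_quad: "integrable M (quad n u w)"
  unfolding quad_walks by (intro Bochner_Integration.integrable_sum integrable_mult_right integrable_walk_prod)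

lemma expectation_quad:
  "expectation (quad n u w) =
    (\<Sum>xs\<in>words N (n + 1). u (hd xs) * w (last xs) * moment (walk_edges xs))"
  unfolding quad_walks
  by (subst Bochner_Integration.integral_sum) (auto intro!: integrable_walk_prod simp: expectation_walk_prod)

lemma quad_squared_walks:
  "(quad n u w \<omega>)\<^sup>2 = (\<Sum>xs\<in>words N (n + 1). \<Sum>ys\<in>words N (n + 1).
     (u (hd xs) * w (last xs) * (u (hd ys) * w (last ys))) *
     (walk_prod (\<lambda>e. Y e \<omega>) xs * walk_prod (\<lambda>e. Y e \<omega>) ys))"
  unfolding quad_walks power2_eq_square sum_product by (simp add: algebra_simps)

lemma integrable_quad_squared: "integrable M (\<lambda>\<omega>. (quad n u w \<omega>)\<^sup>2)"
  unfolding quad_squared_walks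
  by (intro Bochner_Integration.integrable_sum integrable_mult_right integrable_walk_prod2)

lemma variance_quad:
  "variance (quad n u w) = (\<Sum>xs\<in>words N (n + 1). \<Sum>ys\<in>words N (n + 1).
     (u (hd xs) * w (last xs) * (u (hd ys) * w (last ys))) *
     (moment (walk_edges xs @ walk_edges ys) - moment (walk_edges xs) * moment (walk_edges ys)))"
proof -
  have "expectation (\<lambda>\<omega>. (quad n u w \<omega>)\<^sup>2) = (\<Sum>xs\<in>words N (n + 1). \<Sum>ys\<in>words N (n + 1).
     (u (hd xs) * w (last xs) * (u (hd ys) * w (last ys))) *
     moment (walk_edges xs @ walk_edges ys))"
    unfolding quad_squared_walks
    by (subst Bochner_Integration.integral_sum,
        (intro Bochner_Integration.integrable_sum integrable_mult_right integrable_walk_prod2; assumption),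
        intro sum.cong refl, subst Bochner_Integration.integral_sum,
        (intro integrable_mult_right integrable_walk_prod2; assumption),
        simp add: expectation_walk_prod2)
  moreover have "(expectation (quad n u w))\<^sup>2 = (\<Sum>xs\<in>words N (n + 1). \<Sum>ys\<in>words N (n + 1).
     (u (hd xs) * w (last xs) * (u (hd ys) * w (last ys))) *
     (moment (walk_edges xs) * moment (walk_edges ys)))"
    unfolding expectation_quad power2_eq_square sum_product by (simp add: algebra_simps)
  ultimately show ?thesis
    unfolding variance_eq[OF integrable_quad integrable_quad_squared]
    by (simp add: right_diff_distrib sum_subtractf)
qed

lemma abs_expectation_quad_le:
  assumes u: "\<And>a. a < N \<Longrightarrow> \<bar>u a\<bar> \<le> U / sqrt N" and w: "\<And>a. a < N \<Longrightarrow> \<bar>w a\<bar> \<le> U / sqrt N"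
  shows "\<bar>expectation (quad n u w)\<bar> \<le> U\<^sup>2 * real ((n div 2 + 1) ^ (n + 2)) * (real N * p) ^ (n div 2)"
proof -
  have "N > 0" using Np by (cases N) auto
  note coeff = abs_ends_le[OF u w]
  have "\<bar>expectation (quad n u w)\<bar> \<le> (\<Sum>xs\<in>words N (n + 1). \<bar>u (hd xs) * w (last xs) * moment (walk_edges xs)\<bar>)"
    unfolding expectation_quad by (rule sum_abs)
  also have "\<dots> \<le> (\<Sum>xs\<in>words N (n + 1). U\<^sup>2 / real N * \<bar>moment (walk_edges xs)\<bar>)"
    unfolding abs_mult[of _ "moment _"] by (intro sum_mono mult_right_mono coeff) auto
  also have "\<dots> = U\<^sup>2 / real N * (\<Sum>xs\<in>words N (n + 1). \<bar>moment (walk_edges xs)\<bar>)"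
    by (simp add: sum_distrib_left)
  also have "\<dots> \<le> U\<^sup>2 / real N * (real ((n div 2 + 1) ^ (n + 2)) * real N * (real N * p) ^ (n div 2))"
    by (intro mult_left_mono sum_abs_moment_le) auto
  also have "\<dots> = U\<^sup>2 * real ((n div 2 + 1) ^ (n + 2)) * (real N * p) ^ (n div 2)"
    using \<open>N > 0\<close> by simp
  finally show ?thesis .
qed

text \<open>The end weights contribute at most U^4/N^2, against the single factor N in the
  covariance count, which leaves 1/N. In the bound for the mean, U^2/N against N leaves no power of
  N.\<close>

lemma variance_quad_le:
  assumes u: "\<And>a. a < N \<Longrightarrow> \<bar>u a\<bar> \<le> U / sqrt N" and w: "\<And>a. a < N \<Longrightarrow> \<bar>w a\<bar> \<le> U / sqrt N"
  shows "variance (quad n u w) \<le> 2 * U ^ 4 * real ((n + 1) ^ (2 * n + 3)) * (real N * p) ^ n / real N"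
proof -
  have "N > 0" using Np by (cases N) auto
  note coeff = abs_ends_le[OF u w]
  let ?cov = "\<lambda>xs ys. moment (walk_edges xs @ walk_edges ys) - moment (walk_edges xs) * moment (walk_edges ys)"
  have "variance (quad n u w) \<le> (\<Sum>xs\<in>words N (n + 1). \<Sum>ys\<in>words N (n + 1). (U\<^sup>2 / N * (U\<^sup>2 / N)) * \<bar>?cov xs ys\<bar>)"
    unfolding variance_quad
  proof (intro sum_mono)
    fix xs ys assume *: "xs \<in> words N (n + 1)" "ys \<in> words N (n + 1)"
    have "u (hd xs) * w (last xs) * (u (hd ys) * w (last ys)) * ?cov xs ys \<le>
      \<bar>u (hd xs) * w (last xs)\<bar> * \<bar>u (hd ys) * w (last ys)\<bar> * \<bar>?cov xs ys\<bar>"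
      by (metis abs_ge_self abs_mult)
    also have "\<dots> \<le> (U\<^sup>2 / N * (U\<^sup>2 / N)) * \<bar>?cov xs ys\<bar>"
      using * by (intro mult_right_mono mult_mono coeff) auto
    finally show "u (hd xs) * w (last xs) * (u (hd ys) * w (last ys)) * ?cov xs ys \<le> \<dots>" .
  qed
  also have "\<dots> = (U\<^sup>2 / N * (U\<^sup>2 / N)) * (\<Sum>xs\<in>words N (n + 1). \<Sum>ys\<in>words N (n + 1). \<bar>?cov xs ys\<bar>)"
    by (simp add: sum_distrib_left)
  also have "\<dots> \<le> (U\<^sup>2 / N * (U\<^sup>2 / N)) * (2 * real ((n + 1) ^ (2 * n + 3)) * real N * (real N * p) ^ n)"
    by (intro mult_left_mono sum_abs_covariance_le) auto
  also have "\<dots> = 2 * U ^ 4 * real ((n + 1) ^ (2 * n + 3)) * (real N * p) ^ n / real N"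
    using \<open>N > 0\<close> by (simp add: field_simps power4_eq_xxxx power2_eq_square)
  finally show ?thesis .
qed

text \<open>The trace is the sum over closed walks, bounded here by the absolute sum over all walks.
  The ends carry no weight 1/N this time, so the factor N survives.\<close>

lemma expectation_trace_le:
  "(\<Sum>a<N. expectation (quad n (\<lambda>b. of_bool (b = a)) (\<lambda>b. of_bool (b = a)))) \<le>
    real ((n div 2 + 1) ^ (n + 2)) * real N * (real N * p) ^ (n div 2)"
proof -
  have "(\<Sum>a<N. expectation (quad n (\<lambda>b. of_bool (b = a)) (\<lambda>b. of_bool (b = a)))) =
    (\<Sum>xs\<in>words N (n + 1). (\<Sum>a<N. of_bool (hd xs = a) * of_bool (last xs = a)) * moment (walk_edges xs))"
    unfolding expectation_quad sum_distrib_right by (rule sum.swap)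
  also have "\<dots> = (\<Sum>xs\<in>words N (n + 1). of_bool (hd xs = last xs) * moment (walk_edges xs))"
  proof (intro sum.cong refl, goal_cases)
    case (1 xs)
    have "(\<Sum>a<N. of_bool (hd xs = a) * of_bool (last xs = a) :: real) =
      (\<Sum>a<N. if a = hd xs then of_bool (last xs = a) else 0)"
      by (intro sum.cong) auto
    also have "\<dots> = of_bool (hd xs = last xs)" using words_hd_last[OF 1] by auto
    finally show ?case by simp
  qed
  also have "\<dots> \<le> (\<Sum>xs\<in>words N (n + 1). \<bar>moment (walk_edges xs)\<bar>)"
    by (intro sum_mono) auto
  also note sum_abs_moment_le
  finally show ?thesis .
qed

end

section \<open>Real symmetric matrices\<close>

text \<open>The characteristic polynomial has a complex root z with eigenvector w. By symmetry the
  form w* B w is its own conjugate, and it equals z |w|^2; hence z is real.\<close>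

lemma real_symmetric_eigenvalue_exists:
  fixes B :: "real mat"
  assumes B: "B \<in> carrier_mat n n" "transpose_mat B = B" and "n > 0"
  shows "\<exists>x. eigenvalue B x"
proof -
  let ?C = "map_mat complex_of_real B"
  have C: "?C \<in> carrier_mat n n" using B by simp
  have "degree (char_poly ?C) > 0"
    using degree_monic_char_poly[OF C] \<open>n > 0\<close> by simp
  then have "\<not> constant (poly (char_poly ?C))" by (simp add: constant_degree)
  then obtain z where z: "poly (char_poly ?C) z = 0"
    using fundamental_theorem_of_algebra by blast
  then have "eigenvalue ?C z" using eigenvalue_root_char_poly[OF C] by simp
  then obtain w where w: "w \<in> carrier_vec n" "w \<noteq> 0\<^sub>v n" "?C *\<^sub>v w = z \<cdot>\<^sub>v w"
    using C unfolding eigenvalue_def eigenvector_def by auto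
  have sym: "B $$ (i, j) = B $$ (j, i)" if "i < n" "j < n" for i j
    using B that by (metis carrier_matD index_transpose_mat(1))
  have Cw: "(\<Sum>j<n. complex_of_real (B $$ (i, j)) * w $ j) = z * w $ i" if "i < n" for i
  proof -
    have "(?C *\<^sub>v w) $ i = (\<Sum>j<n. complex_of_real (B $$ (i, j)) * w $ j)"
      using that w(1) B by (simp add: scalar_prod_def lessThan_atLeast0)
    then show ?thesis using w that by simp
  qed
  define S where "S = (\<Sum>i<n. \<Sum>j<n. cnj (w $ i) * complex_of_real (B $$ (i, j)) * w $ j)"
  define T where "T = (\<Sum>i<n. (cmod (w $ i))\<^sup>2)"
  have "S = (\<Sum>i<n. cnj (w $ i) * (z * w $ i))"
    unfolding S_def by (intro sum.cong refl) (simp add: Cw[symmetric] sum_distrib_left mult.assoc)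
  also have "\<dots> = z * of_real T"
    unfolding T_def of_real_sum sum_distrib_left
    by (intro sum.cong refl, simp only: complex_norm_square) (simp add: algebra_simps)
  finally have S: "S = z * of_real T" .
  have "cnj S = (\<Sum>i<n. \<Sum>j<n. cnj (w $ j) * complex_of_real (B $$ (j, i)) * w $ i)"
    unfolding S_def cnj_sum by (intro sum.cong refl) (auto simp: sym algebra_simps)
  also have "\<dots> = S" unfolding S_def by (rule sum.swap)
  finally have "cnj S = S" .
  have "T > 0"
  proof -
    obtain i where "i < n" "w $ i \<noteq> 0" using w by (metis carrier_vecD eq_vecI index_zero_vec)
    then show ?thesis unfolding T_def by (intro sum_pos2[of _ i]) auto
  qed
  then have "cnj z = z" using \<open>cnj S = S\<close> unfolding S by simp
  then obtain x where "z = of_real x" by (metis Reals_cases Reals_cnj_iff)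
  then have "poly (char_poly B) x = 0"
    using z unfolding of_real_hom.char_poly_hom[OF B(1)] by (simp add: of_real_hom.poly_map_poly)
  then show ?thesis using eigenvalue_root_char_poly[OF B(1)] by blast
qed

lemma symmetric_mult_conjugate:
  fixes B H :: "real mat"
  assumes "B \<in> carrier_mat n n" "transpose_mat B = B" "H \<in> carrier_mat n n"
  shows "transpose_mat (transpose_mat H * B * H) = transpose_mat H * B * H"
proof -
  have "transpose_mat (transpose_mat H * B * H) = transpose_mat H * transpose_mat (transpose_mat H * B)"
    using assms by (intro transpose_mult[of _ n n _ n]) auto
  also have "transpose_mat (transpose_mat H * B) = B * H"
    using assms by (subst transpose_mult[of _ n n _ n]) auto
  also have "transpose_mat H * (B * H) = transpose_mat H * B * H"
    using assms by (intro assoc_mult_mat[symmetric, of _ n n _ n _ n]) auto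
  finally show ?thesis .
qed

text \<open>A Householder reflection.\<close>

lemma orthogonal_matrix_first_column:
  fixes v :: "real vec"
  assumes v: "v \<in> carrier_vec n" "v \<bullet> v = 1" and n: "n > 0"
  obtains H where "H \<in> carrier_mat n n" "transpose_mat H * H = 1\<^sub>m n" "col H 0 = v"
\<comment> \<open>For a unit vector this means that \<open>v\<close> is the first basis vector,
  where the vector defining the reflection would vanish.\<close>
proof (cases "v $ 0 = 1")
  case True
  have "(\<Sum>i<n. (v $ i)\<^sup>2) = 1"
    using v by (simp add: scalar_prod_def lessThan_atLeast0 power2_eq_square)
  then have "(v $ 0)\<^sup>2 + (\<Sum>i\<in>{..<n} - {0}. (v $ i)\<^sup>2) = 1"
    using n by (subst (asm) sum.remove[of _ 0]) auto
  then have "(\<Sum>i\<in>{..<n} - {0}. (v $ i)\<^sup>2) = 0" using True by simp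
  then have "\<forall>i\<in>{..<n} - {0}. (v $ i)\<^sup>2 = 0" by (subst (asm) sum_nonneg_eq_0_iff) auto
  then have "col (1\<^sub>m n) 0 = v" using True v n by (intro eq_vecI) auto
  then show ?thesis using that[of "1\<^sub>m n"] by simp
next
  case False
  \<comment> \<open>Here u = v - e_0 and |u|^2 = 2c, so I - u u'/c is the reflection I - 2 u
    u'/|u|^2, which exchanges e_0 and \<open>v\<close>.\<close>
  define u where "u = (\<lambda>i. v $ i - of_bool (i = 0))"
  define c where "c = 1 - v $ 0"
  have c0: "c \<noteq> 0" using False by (simp add: c_def)
  have vv: "(\<Sum>i<n. v $ i * v $ i) = 1"
    using v by (simp add: scalar_prod_def lessThan_atLeast0)
  have delta: "(\<Sum>i<n. g i * of_bool (i = j)) = g j" "(\<Sum>i<n. of_bool (i = j) * g i) = g j"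
    if "j < n" for j and g :: "nat \<Rightarrow> real"
  proof -
    have "(\<Sum>i<n. g i * of_bool (i = j)) = (\<Sum>i<n. if i = j then g i else 0)"
      by (intro sum.cong) auto
    then show "(\<Sum>i<n. g i * of_bool (i = j)) = g j" using that by simp
    then show "(\<Sum>i<n. of_bool (i = j) * g i) = g j" by (simp add: mult.commute)
  qed
  have "(\<Sum>i<n. u i * u i) = (\<Sum>i<n. v $ i * v $ i) - 2 * (\<Sum>i<n. v $ i * of_bool (i = 0)) +
      (\<Sum>i<n. of_bool (i = 0) * of_bool (i = 0))"
    unfolding u_def sum_subtractf[symmetric] sum.distrib[symmetric] sum_distrib_left
    by (intro sum.cong) (auto simp: algebra_simps)
  then have uu: "(\<Sum>i<n. u i * u i) = 2 * c"
    using n by (simp add: vv delta c_def del: of_bool_eq)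
  define H where "H = mat n n (\<lambda>(i, j). of_bool (i = j) - u i * u j / c)"
  have H: "H \<in> carrier_mat n n" by (simp add: H_def)
  have "transpose_mat H * H = 1\<^sub>m n"
  proof (rule eq_matI)
    fix i j assume "i < dim_row (1\<^sub>m n :: real mat)" "j < dim_col (1\<^sub>m n :: real mat)"
    then have ij: "i < n" "j < n" by auto
    have "(transpose_mat H * H) $$ (i, j) =
      (\<Sum>l<n. (of_bool (l = i) - u l * u i / c) * (of_bool (l = j) - u l * u j / c))"
      using ij by (simp add: H_def scalar_prod_def lessThan_atLeast0)
    also have "\<dots> = (\<Sum>l<n. of_bool (l = i) * of_bool (l = j)) - u j / c * (\<Sum>l<n. of_bool (l = i) * u l)
        - u i / c * (\<Sum>l<n. of_bool (l = j) * u l) + u i * u j / c\<^sup>2 * (\<Sum>l<n. u l * u l)"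
      unfolding sum_subtractf[symmetric] sum.distrib[symmetric] sum_distrib_left
      using c0 by (intro sum.cong refl) (auto simp: field_simps power2_eq_square)
    also have "\<dots> = of_bool (i = j)"
      unfolding delta(2)[OF ij(1)] delta(2)[OF ij(2)] uu
      using c0 by (simp add: field_simps power2_eq_square)
    finally show "(transpose_mat H * H) $$ (i, j) = 1\<^sub>m n $$ (i, j)" using ij by simp
  qed (auto simp: H_def)
  moreover have "col H 0 = v"
    using n v c0 by (intro eq_vecI) (auto simp: H_def u_def c_def field_simps)
  ultimately show ?thesis using that H by blast
qed

text \<open>Induction by deflation: conjugating with an orthogonal matrix whose first column is a
  unit eigenvector splits off a 1 by 1 block, and the remaining symmetric block has one dimension
  less.\<close>

theorem real_symmetric_diagonalizable:
  fixes B :: "real mat"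
  assumes "B \<in> carrier_mat n n" "transpose_mat B = B"
  shows "\<exists>P D. P \<in> carrier_mat n n \<and> D \<in> carrier_mat n n \<and> diagonal_mat D \<and>
    transpose_mat P * P = 1\<^sub>m n \<and> B = P * D * transpose_mat P"
  using assms
proof (induction n arbitrary: B)
  case 0
  then show ?case
    by (intro exI[of _ "1\<^sub>m 0"] exI[of _ "1\<^sub>m 0"]) (auto simp: diagonal_mat_def)
next
  case (Suc n)
  note B = Suc.prems
  have assoc: "X * Y * Z = X * (Y * Z)" if "X \<in> carrier_mat (Suc n) (Suc n)"
    "Y \<in> carrier_mat (Suc n) (Suc n)" "Z \<in> carrier_mat (Suc n) (Suc n)" for X Y Z :: "real mat"
    using that by (rule assoc_mult_mat)
  obtain x where "eigenvalue B x" using real_symmetric_eigenvalue_exists[OF B] by auto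
  then obtain w where w: "w \<in> carrier_vec (Suc n)" "w \<noteq> 0\<^sub>v (Suc n)" "B *\<^sub>v w = x \<cdot>\<^sub>v w"
    using B unfolding eigenvalue_def eigenvector_def by auto
  have ww: "w \<bullet> w > 0"
  proof -
    obtain i where "i < Suc n" "w $ i \<noteq> 0" using w by (metis carrier_vecD eq_vecI index_zero_vec)
    then show ?thesis
      using w(1) unfolding scalar_prod_def by (intro sum_pos2[of _ i]) (auto simp: zero_less_mult_iff)
  qed
  define v where "v = (1 / sqrt (w \<bullet> w)) \<cdot>\<^sub>v w"
  have v: "v \<in> carrier_vec (Suc n)" "v \<bullet> v = 1" "B *\<^sub>v v = x \<cdot>\<^sub>v v"
    using w ww B unfolding v_def
    by (auto simp: mult_mat_vec smult_smult_assoc mult.commute)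
  obtain H where H: "H \<in> carrier_mat (Suc n) (Suc n)" "transpose_mat H * H = 1\<^sub>m (Suc n)" "col H 0 = v"
    using orthogonal_matrix_first_column[OF v(1,2)] by auto
  let ?H' = "transpose_mat H"
  have H': "?H' \<in> carrier_mat (Suc n) (Suc n)" using H by simp
  have HH': "H * ?H' = 1\<^sub>m (Suc n)" by (rule mat_mult_left_right_inverse[OF H' H(1,2)])
  define G where "G = ?H' * B * H"
  have G: "G \<in> carrier_mat (Suc n) (Suc n)" using H B by (simp add: G_def)
  have Gsym: "transpose_mat G = G" unfolding G_def by (rule symmetric_mult_conjugate[OF B H(1)])
  have BG: "B = H * G * ?H'"
  proof -
    have "H * G * ?H' = H * (?H' * (B * H)) * ?H'"
      unfolding G_def using H B by (subst assoc[of ?H' B H]) auto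
    also have "\<dots> = (H * ?H') * (B * H) * ?H'"
      using H B by (subst assoc[of H ?H' "B * H"]) auto
    also have "\<dots> = B * H * ?H'" unfolding HH' using H B by simp
    also have "\<dots> = B * (H * ?H')" using H B by (intro assoc[of B H ?H']) auto
    also have "\<dots> = B" unfolding HH' using B by simp
    finally show ?thesis by simp
  qed
  \<comment> \<open>B v = x v reduces the column to x H' v, and H' v is the first column of H' H =
    I. Symmetry of \<open>G\<close> then clears the first row as well.\<close>
  have colG: "col G 0 = x \<cdot>\<^sub>v unit_vec (Suc n) 0"
  proof -
    have "col G 0 = (?H' * B) *\<^sub>v v"
      unfolding G_def using H B by (subst col_mult2[of _ "Suc n" "Suc n" _ "Suc n"]) auto
    also have "\<dots> = ?H' *\<^sub>v (B *\<^sub>v v)"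
      using H B v by (intro assoc_mult_mat_vec[of _ "Suc n" "Suc n" _ "Suc n"]) auto
    also have "\<dots> = x \<cdot>\<^sub>v (?H' *\<^sub>v v)" unfolding v(3) using H v by (intro mult_mat_vec) auto
    also have "?H' *\<^sub>v v = col (?H' * H) 0"
      using H by (subst col_mult2[of _ "Suc n" "Suc n" _ "Suc n"]) auto
    also have "\<dots> = unit_vec (Suc n) 0" unfolding H(2) by simp
    finally show ?thesis .
  qed
  define B3 where "B3 = mat n n (\<lambda>(i, j). G $$ (Suc i, Suc j))"
  have B3: "B3 \<in> carrier_mat n n" by (simp add: B3_def)
  have G0: "G $$ (i, 0) = (if i = 0 then x else 0)" if "i < Suc n" for i
  proof -
    have "G $$ (i, 0) = col G 0 $ i" using that G by simp
    then show ?thesis unfolding colG using that by simp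
  qed
  have Gs: "G $$ (i, j) = G $$ (j, i)" if "i < Suc n" "j < Suc n" for i j
    using G Gsym that by (metis carrier_matD index_transpose_mat(1))
  have B3sym: "transpose_mat B3 = B3"
    using Gs by (intro eq_matI) (auto simp: B3_def)
  let ?X = "mat 1 1 (\<lambda>_. x)" and ?O = "1\<^sub>m 1 :: real mat"
  let ?Z = "0\<^sub>m 1 n :: real mat" and ?Z' = "0\<^sub>m n 1 :: real mat"
  have Gblock: "G = four_block_mat ?X ?Z ?Z' B3"
  proof (rule eq_matI)
    fix i j assume "i < dim_row (four_block_mat ?X ?Z ?Z' B3)" "j < dim_col (four_block_mat ?X ?Z ?Z' B3)"
    then have "i < Suc n" "j < Suc n" using B3 by auto
    then show "G $$ (i, j) = four_block_mat ?X ?Z ?Z' B3 $$ (i, j)"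
      using G0 Gs[of 0 j] G0[of j] B3 by (cases i; cases j) (auto simp: B3_def)
  qed (use G B3 in auto)
  obtain P D where PD: "P \<in> carrier_mat n n" "D \<in> carrier_mat n n" "diagonal_mat D"
      "transpose_mat P * P = 1\<^sub>m n" "B3 = P * D * transpose_mat P"
    using Suc.IH[OF B3 B3sym] by auto
  let ?P' = "transpose_mat P"
  let ?Q = "four_block_mat ?O ?Z ?Z' P" and ?E = "four_block_mat ?X ?Z ?Z' D"
  have Q: "?Q \<in> carrier_mat (Suc n) (Suc n)" and E: "?E \<in> carrier_mat (Suc n) (Suc n)"
    using PD by (auto simp: four_block_carrier_mat[of _ 1 1 _ n n, simplified])
  have Q': "transpose_mat ?Q = four_block_mat ?O ?Z ?Z' ?P'"
    using PD by (subst transpose_four_block_mat[of _ 1 1 _ n _ n]) auto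
  have QQ: "transpose_mat ?Q * ?Q = 1\<^sub>m (Suc n)"
    unfolding Q' using PD
    by (subst mult_four_block_mat[of _ 1 1 _ n _ n _ _ 1 _ n]) (auto simp: four_block_one_mat[of 1 n, simplified])
  have QEQ: "?Q * ?E * transpose_mat ?Q = G"
    unfolding Q' Gblock using PD
    by (subst mult_four_block_mat[of _ 1 1 _ n _ n _ _ 1 _ n], auto,
        subst mult_four_block_mat[of _ 1 1 _ n _ n _ _ 1 _ n], auto)
  let ?R = "H * ?Q"
  have R: "?R \<in> carrier_mat (Suc n) (Suc n)" using H Q by auto
  have R': "transpose_mat ?R = transpose_mat ?Q * ?H'" using H Q by (intro transpose_mult) auto
  have "transpose_mat ?R * ?R = transpose_mat ?Q * (?H' * (H * ?Q))"
    unfolding R' using H Q by (intro assoc) auto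
  also have "?H' * (H * ?Q) = ?H' * H * ?Q"
    using H Q by (intro assoc[symmetric]) auto
  also have "\<dots> = ?Q" unfolding H(2) by (rule left_mult_one_mat[OF Q])
  also have "transpose_mat ?Q * ?Q = 1\<^sub>m (Suc n)" by (rule QQ)
  finally have RR: "transpose_mat ?R * ?R = 1\<^sub>m (Suc n)" .
  have "?R * ?E * transpose_mat ?R = H * (?Q * ?E) * (transpose_mat ?Q * ?H')"
    unfolding R' using H Q E by (subst assoc) auto
  also have "\<dots> = H * (?Q * ?E * (transpose_mat ?Q * ?H'))"
    using H Q E by (intro assoc) auto
  also have "?Q * ?E * (transpose_mat ?Q * ?H') = ?Q * ?E * transpose_mat ?Q * ?H'"
    using H Q E by (intro assoc[symmetric]) auto
  also have "\<dots> = G * ?H'" unfolding QEQ ..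
  also have "H * (G * ?H') = H * G * ?H'"
    using H G by (intro assoc[symmetric]) auto
  also have "\<dots> = B" using BG by simp
  finally have "B = ?R * ?E * transpose_mat ?R" by simp
  moreover have "diagonal_mat ?E"
    unfolding diagonal_mat_def
  proof (intro allI impI)
    fix i j assume "i < dim_row ?E" "j < dim_col ?E" "i \<noteq> j"
    then show "?E $$ (i, j) = 0"
      using PD(2,3) by (cases i; cases j) (auto simp: diagonal_mat_def)
  qed
  ultimately show ?case using R E RR by blast
qed

lemma proots_prod_linear_factors:
  fixes es :: "real list"
  shows "proots (\<Prod>a\<leftarrow>es. [:- a, 1:]) = mset es"
proof (induction es)
  case (Cons e es)
  have "(\<Prod>a\<leftarrow>es. [:- a, 1:]) \<noteq> 0" by (subst prod_list_zero_iff) auto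
  moreover have "proots [:- e, 1:] = {#e#}" by simp
  ultimately show ?case using Cons by (simp add: proots_mult del: mult_pCons_left)
qed simp

text \<open>\<open>eigval\<close> reads the sorted roots of the characteristic polynomial.
  Similarity identifies these, with multiplicity, with the diagonal of \<open>D\<close>, so a
  permutation of the diagonal realises the decreasing order.\<close>

lemma sorted_eigenvalues:
  assumes D: "D \<in> carrier_mat n n" "diagonal_mat D" and P: "P \<in> carrier_mat n n"
    and PP: "transpose_mat P * P = 1\<^sub>m n" and B: "B = P * D * transpose_mat P"
  shows "\<exists>\<pi>. \<pi> permutes {..<n} \<and> (\<forall>a<n. eigval (a + 1) B = D $$ (\<pi> a, \<pi> a)) \<and>
    (\<forall>a b. a \<le> b \<longrightarrow> b < n \<longrightarrow> D $$ (\<pi> b, \<pi> b) \<le> D $$ (\<pi> a, \<pi> a))"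
proof -
  have P': "transpose_mat P \<in> carrier_mat n n" using P by simp
  have PP': "P * transpose_mat P = 1\<^sub>m n" by (rule mat_mult_left_right_inverse[OF P' P PP])
  have "similar_mat B D"
    using D P P' PP PP' B by (intro similar_matI[of _ _ P "transpose_mat P" n]) auto
  then have "char_poly B = char_poly D" by (rule char_poly_similar)
  also have "\<dots> = (\<Prod>a\<leftarrow>diag_mat D. [:- a, 1:])"
    using D by (intro char_poly_upper_triangular[of _ n]) (auto simp: diagonal_mat_def)
  finally have cp: "char_poly B = (\<Prod>a\<leftarrow>diag_mat D. [:- a, 1:])" .
  have "proots (char_poly B) = mset (diag_mat D)"
    unfolding cp by (rule proots_prod_linear_factors)
  then have srt: "mset (rev (sorted_list_of_multiset (proots (char_poly B)))) = mset (diag_mat D)"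
    by simp
  then obtain \<pi> where \<pi>: "\<pi> permutes {..<length (diag_mat D)}"
    "permute_list \<pi> (diag_mat D) = rev (sorted_list_of_multiset (proots (char_poly B)))"
    using mset_eq_permutation by metis
  have len: "length (diag_mat D) = n" using D by (simp add: diag_mat_def)
  have nth: "rev (sorted_list_of_multiset (proots (char_poly B))) ! a = D $$ (\<pi> a, \<pi> a)" if "a < n" for a
  proof -
    have "\<pi> a < n" using \<pi>(1) that permutes_in_image[OF \<pi>(1)] by (simp add: len)
    then show ?thesis
      using that \<pi> D by (simp flip: \<pi>(2) add: permute_list_nth len) (simp add: diag_mat_def)
  qed
  have "sorted_wrt (\<ge>) (rev (sorted_list_of_multiset (proots (char_poly B))))"
    by (simp add: sorted_wrt_rev)
  moreover have "length (rev (sorted_list_of_multiset (proots (char_poly B)))) = n"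
    using srt len by (metis size_mset)
  ultimately have le: "rev (sorted_list_of_multiset (proots (char_poly B))) ! b \<le>
      rev (sorted_list_of_multiset (proots (char_poly B))) ! a" if "a < b" "b < n" for a b
    using that unfolding sorted_wrt_iff_nth_less by blast
  have "D $$ (\<pi> b, \<pi> b) \<le> D $$ (\<pi> a, \<pi> a)" if "a \<le> b" "b < n" for a b
  proof (cases "a = b")
    case False
    then have "a < b" "a < n" using that by auto
    show ?thesis
      using le[OF \<open>a < b\<close> that(2)] unfolding nth[OF \<open>a < n\<close>] nth[OF that(2)] .
  qed simp
  then show ?thesis using \<pi>(1) nth unfolding eigval_def len by auto
qed

definition matfun :: "real mat \<Rightarrow> nat \<Rightarrow> nat \<Rightarrow> real" where
  "matfun B = (\<lambda>a b. B $$ (a, b))"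

text \<open>Both relations P' P = I and P P' = I are recorded: the first is orthonormality, the
  second is the completeness needed to expand arbitrary vectors. Positions count from 0, eigenvalues
  from 1.\<close>

theorem symmetric_eigenbasis:
  assumes "B \<in> carrier_mat n n" "transpose_mat B = B"
  shows "\<exists>(q :: nat \<Rightarrow> nat \<Rightarrow> real) d.
    (\<forall>a<n. \<forall>b<n. ip n (q a) (q b) = of_bool (a = b)) \<and>
    (\<forall>i<n. \<forall>j<n. (\<Sum>a<n. q a i * q a j) = of_bool (i = j)) \<and>
    (\<forall>a<n. \<forall>i<n. mv n (matfun B) (q a) i = d a * q a i) \<and>
    (\<forall>a b. a \<le> b \<longrightarrow> b < n \<longrightarrow> d b \<le> d a) \<and>
    (\<forall>a<n. eigval (a + 1) B = d a)"
proof -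
  obtain P D where PD: "P \<in> carrier_mat n n" "D \<in> carrier_mat n n" "diagonal_mat D"
    "transpose_mat P * P = 1\<^sub>m n" "B = P * D * transpose_mat P"
    using real_symmetric_diagonalizable[OF assms] by auto
  obtain \<pi> where \<pi>: "\<pi> permutes {..<n}" "\<And>a. a < n \<Longrightarrow> eigval (a + 1) B = D $$ (\<pi> a, \<pi> a)"
    "\<And>a b. a \<le> b \<Longrightarrow> b < n \<Longrightarrow> D $$ (\<pi> b, \<pi> b) \<le> D $$ (\<pi> a, \<pi> a)"
    using sorted_eigenvalues[OF PD(2,3,1,4,5)] by auto
  have in_n: "\<pi> a < n" if "a < n" for a using permutes_in_image[OF \<pi>(1), of a] that by simp
  let ?P' = "transpose_mat P"
  have P': "?P' \<in> carrier_mat n n" using PD by simp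
  have PP': "P * ?P' = 1\<^sub>m n" by (rule mat_mult_left_right_inverse[OF P' PD(1,4)])
  have orth: "(\<Sum>i<n. P $$ (i, a) * P $$ (i, b)) = of_bool (a = b)" if "a < n" "b < n" for a b
  proof -
    have "(\<Sum>i<n. P $$ (i, a) * P $$ (i, b)) = (?P' * P) $$ (a, b)"
      using PD(1) that by (simp add: scalar_prod_def lessThan_atLeast0)
    then show ?thesis unfolding PD(4) using that by simp
  qed
  have compl: "(\<Sum>a<n. P $$ (i, a) * P $$ (j, a)) = of_bool (i = j)" if "i < n" "j < n" for i j
  proof -
    have "(\<Sum>a<n. P $$ (i, a) * P $$ (j, a)) = (P * ?P') $$ (i, j)"
      using PD(1) that by (simp add: scalar_prod_def lessThan_atLeast0)
    then show ?thesis unfolding PP' using that by simp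
  qed
  have "B * P = P * D * (?P' * P)"
    unfolding PD(5) using PD P' by (intro assoc_mult_mat[of _ n n _ n _ n]) auto
  also have "\<dots> = P * D" unfolding PD(4) using PD by (intro right_mult_one_mat) auto
  finally have BP: "B * P = P * D" .
  have eig: "(\<Sum>j<n. B $$ (i, j) * P $$ (j, a)) = D $$ (a, a) * P $$ (i, a)" if "i < n" "a < n" for i a
  proof -
    have "(\<Sum>j<n. B $$ (i, j) * P $$ (j, a)) = (B * P) $$ (i, a)"
      using PD(1) assms that by (simp add: scalar_prod_def lessThan_atLeast0)
    also have "\<dots> = (\<Sum>j<n. P $$ (i, j) * D $$ (j, a))"
      unfolding BP using PD that by (simp add: scalar_prod_def lessThan_atLeast0)
    also have "\<dots> = (\<Sum>j<n. if j = a then P $$ (i, j) * D $$ (j, a) else 0)"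
      using PD that by (intro sum.cong) (auto simp: diagonal_mat_def)
    also have "\<dots> = D $$ (a, a) * P $$ (i, a)" using that by simp
    finally show ?thesis .
  qed
  show ?thesis
  proof (intro exI[of _ "\<lambda>a i. P $$ (i, \<pi> a)"] exI[of _ "\<lambda>a. D $$ (\<pi> a, \<pi> a)"] conjI allI impI)
    show "ip n (\<lambda>i. P $$ (i, \<pi> a)) (\<lambda>i. P $$ (i, \<pi> b)) = of_bool (a = b)" if "a < n" "b < n" for a b
      unfolding ip_def using orth in_n that permutes_inj[OF \<pi>(1)] by (auto simp: inj_eq)
    show "(\<Sum>a<n. P $$ (i, \<pi> a) * P $$ (j, \<pi> a)) = of_bool (i = j)" if "i < n" "j < n" for i j
      using sum.permute[OF \<pi>(1), of "\<lambda>a. P $$ (i, a) * P $$ (j, a)"] compl[OF that] by (simp add: o_def)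
    show "mv n (matfun B) (\<lambda>i. P $$ (i, \<pi> a)) i = D $$ (\<pi> a, \<pi> a) * P $$ (i, \<pi> a)" if "a < n" "i < n" for a i
      unfolding mv_def matfun_def using eig in_n that by simp
  qed (use \<pi> in auto)
qed

section \<open>Inner products, the trace bound and near-orthonormal systems\<close>

lemma ip_commute: "ip N u w = ip N w u"
  by (simp add: ip_def mult.commute)

lemma ip_self_nonneg [simp]: "0 \<le> ip N u u"
  by (simp add: ip_def sum_nonneg)

lemma ip_cauchy_schwarz: "(ip N u w)\<^sup>2 \<le> ip N u u * ip N w w"
  using Cauchy_Schwarz_ineq_sum[of u w "{..<N}"] by (simp add: ip_def power2_eq_square)

lemma ip_sum_right: "ip N u (\<lambda>a. \<Sum>l\<in>L. c l * e l a) = (\<Sum>l\<in>L. c l * ip N u (e l))"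
  unfolding ip_def sum_distrib_left by (subst sum.swap) (simp add: mult.left_commute)

lemma ip_sum_left: "ip N (\<lambda>a. \<Sum>l\<in>L. c l * e l a) u = (\<Sum>l\<in>L. c l * ip N (e l) u)"
  by (simp add: ip_commute[of N _ u] ip_sum_right)

lemma ip_cong: "(\<And>a. a < N \<Longrightarrow> u a = u' a) \<Longrightarrow> (\<And>a. a < N \<Longrightarrow> w a = w' a) \<Longrightarrow> ip N u w = ip N u' w'"
  by (simp add: ip_def)

lemma mv_sum: "mv N B (\<lambda>a. \<Sum>l\<in>L. c l * e l a) = (\<lambda>a. \<Sum>l\<in>L. c l * mv N B (e l) a)"
proof
  fix a
  show "mv N B (\<lambda>a. \<Sum>l\<in>L. c l * e l a) a = (\<Sum>l\<in>L. c l * mv N B (e l) a)"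
    unfolding mv_def sum_distrib_left by (subst sum.swap) (simp add: mult.left_commute)
qed

lemma mv_cong: "(\<And>a. a < N \<Longrightarrow> u a = u' a) \<Longrightarrow> mv N B u = mv N B u'"
  by (simp add: mv_def)

definition symfun :: "nat \<Rightarrow> (nat \<Rightarrow> nat \<Rightarrow> real) \<Rightarrow> bool" where
  "symfun N B \<longleftrightarrow> (\<forall>a<N. \<forall>b<N. B a b = B b a)"

lemma ip_mv_sym: "symfun N B \<Longrightarrow> ip N u (mv N B w) = ip N (mv N B u) w"
  unfolding ip_def mv_def sum_distrib_left sum_distrib_right symfun_def
  by (subst sum.swap) (auto intro!: sum.cong simp: algebra_simps)

lemma ip_mv_power:
  "symfun N B \<Longrightarrow> ip N u ((mv N B ^^ (m + n)) w) = ip N ((mv N B ^^ m) u) ((mv N B ^^ n) w)"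
proof (induction m arbitrary: u)
  case (Suc m)
  have "ip N u ((mv N B ^^ (Suc m + n)) w) = ip N (mv N B u) ((mv N B ^^ (m + n)) w)"
    using ip_mv_sym[OF Suc.prems] by simp
  also have "\<dots> = ip N ((mv N B ^^ m) (mv N B u)) ((mv N B ^^ n) w)"
    using Suc by simp
  finally show ?case by (simp add: funpow_swap1)
qed simp

definition trace_power :: "nat \<Rightarrow> (nat \<Rightarrow> nat \<Rightarrow> real) \<Rightarrow> nat \<Rightarrow> real" where
  "trace_power N B n = (\<Sum>a<N. ip N (\<lambda>b. of_bool (b = a)) ((mv N B ^^ n) (\<lambda>b. of_bool (b = a))))"

lemma mv_power_sum:
  "(mv N B ^^ n) (\<lambda>a. \<Sum>l\<in>L. c l * e l a) = (\<lambda>a. \<Sum>l\<in>L. c l * (mv N B ^^ n) (e l) a)"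
  by (induction n) (simp_all add: mv_sum)

lemma mv_power_cong:
  "n > 0 \<Longrightarrow> (\<And>a. a < N \<Longrightarrow> u a = u' a) \<Longrightarrow> (mv N B ^^ n) u = (mv N B ^^ n) u'"
  by (cases n) (simp_all add: funpow_swap1 mv_cong[of N u u'] del: funpow.simps(2) add: funpow_Suc_right)

text \<open>The trace of B^(2n) is the squared Hilbert-Schmidt norm of B^n, which dominates its
  squared operator norm.\<close>

lemma norm_power_mv_le_trace:
  assumes "symfun N B" "n > 0"
  shows "ip N ((mv N B ^^ n) u) ((mv N B ^^ n) u) \<le> trace_power N B (n + n) * ip N u u"
proof -
  let ?\<delta> = "\<lambda>b a. of_bool (a = b) :: real"
  let ?C = "\<lambda>b. (mv N B ^^ n) (?\<delta> b)"
  have u: "(\<Sum>b<N. u b * ?\<delta> b a) = u a" if "a < N" for a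
  proof -
    have "(\<Sum>b<N. u b * ?\<delta> b a) = (\<Sum>b<N. if b = a then u b else 0)" by (intro sum.cong) auto
    then show ?thesis using that by simp
  qed
  have "(mv N B ^^ n) u = (mv N B ^^ n) (\<lambda>a. \<Sum>b<N. u b * ?\<delta> b a)"
    using assms u by (intro mv_power_cong) auto
  also have "\<dots> = (\<lambda>a. \<Sum>b<N. u b * ?C b a)" by (rule mv_power_sum)
  finally have eq: "(mv N B ^^ n) u = (\<lambda>a. \<Sum>b<N. u b * ?C b a)" .
  have "ip N ((mv N B ^^ n) u) ((mv N B ^^ n) u) = (\<Sum>a<N. (\<Sum>b<N. u b * ?C b a)\<^sup>2)"
    unfolding eq by (simp add: ip_def power2_eq_square)
  also have "\<dots> \<le> (\<Sum>a<N. (\<Sum>b<N. (u b)\<^sup>2) * (\<Sum>b<N. (?C b a)\<^sup>2))"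
    by (intro sum_mono Cauchy_Schwarz_ineq_sum)
  also have "\<dots> = ip N u u * (\<Sum>b<N. ip N (?C b) (?C b))"
    unfolding ip_def sum_distrib_left[symmetric] power2_eq_square by (subst sum.swap) simp
  also have "(\<Sum>b<N. ip N (?C b) (?C b)) = trace_power N B (n + n)"
    unfolding trace_power_def using ip_mv_power[OF assms(1)] by simp
  finally show ?thesis by (simp add: mult.commute)
qed

text \<open>Log-convexity of \<open>n \<mapsto> \<bar>B\<^sup>n u\<bar>\<close> turns the bound for the third power into one for the first.\<close>

lemma norm_mv_le_trace6:
  assumes "symfun N B"
  shows "(ip N (mv N B u) (mv N B u)) ^ 3 \<le> trace_power N B 6 * (ip N u u) ^ 3"
proof -
  define x where "x = ip N u u"
  define y where "y = ip N (mv N B u) (mv N B u)"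
  define z where "z = ip N ((mv N B ^^ 2) u) ((mv N B ^^ 2) u)"
  define w where "w = ip N ((mv N B ^^ 3) u) ((mv N B ^^ 3) u)"
  have "y = ip N u ((mv N B ^^ 2) u)"
    unfolding y_def using ip_mv_power[OF assms, of u 1 1 u] by (simp add: numeral_2_eq_2)
  then have yz: "y\<^sup>2 \<le> x * z" unfolding x_def z_def using ip_cauchy_schwarz by simp
  have "z = ip N (mv N B u) ((mv N B ^^ 3) u)"
    unfolding z_def using ip_mv_sym[OF assms, of "mv N B u" "(mv N B ^^ 2) u"]
    by (simp add: numeral_2_eq_2 numeral_3_eq_3)
  then have zw: "z\<^sup>2 \<le> y * w" unfolding y_def w_def using ip_cauchy_schwarz by simp
  have wx: "w \<le> trace_power N B 6 * x"
    unfolding w_def x_def using norm_power_mv_le_trace[OF assms, of 3 u] by simp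
  have nn: "0 \<le> x" "0 \<le> y" "0 \<le> z" "0 \<le> w" by (simp_all add: x_def y_def z_def w_def)
  \<comment> \<open>With x, y, z, w the squared norms of u, B u, B^2 u, B^3 u, the two
    Cauchy-Schwarz bounds give y^4 \<le> x^2 z^2 \<le> x^2 y w. Cancelling y is what forces the
    separate case y = 0.\<close>
  have "y ^ 3 \<le> trace_power N B 6 * x ^ 3"
  proof (cases "y = 0")
    case True
    have "0 \<le> trace_power N B 6 * x" using wx nn by linarith
    then have "0 \<le> (trace_power N B 6 * x) * x\<^sup>2" by (rule mult_nonneg_nonneg) simp
    then show ?thesis using True by (simp add: power3_eq_cube power2_eq_square mult.assoc)
  next
    case False
    have "y * y ^ 3 = (y\<^sup>2)\<^sup>2" by (simp add: power3_eq_cube power2_eq_square)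
    also have "\<dots> \<le> (x * z)\<^sup>2" using yz nn by (intro power_mono) auto
    also have "\<dots> = x\<^sup>2 * z\<^sup>2" by (rule power_mult_distrib)
    also have "\<dots> \<le> x\<^sup>2 * (y * w)" using zw by (intro mult_left_mono) auto
    also have "\<dots> = y * (x\<^sup>2 * w)" by simp
    also have "\<dots> \<le> y * (x\<^sup>2 * (trace_power N B 6 * x))"
      using wx nn by (intro mult_left_mono) auto
    finally have "y ^ 3 \<le> x\<^sup>2 * (trace_power N B 6 * x)"
      using False nn by (simp add: mult_le_cancel_left_pos)
    then show ?thesis by (simp add: power3_eq_cube power2_eq_square mult_ac)
  qed
  then show ?thesis by (simp add: x_def y_def)
qed

lemma norm_mv_le:
  assumes "symfun N B" "0 \<le> \<eta>" "trace_power N B 6 \<le> \<eta> ^ 6"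
  shows "ip N (mv N B u) (mv N B u) \<le> \<eta>\<^sup>2 * ip N u u" "\<bar>ip N u (mv N B u)\<bar> \<le> \<eta> * ip N u u"
proof -
  have "(ip N (mv N B u) (mv N B u)) ^ 3 \<le> \<eta> ^ 6 * (ip N u u) ^ 3"
    using norm_mv_le_trace6[OF assms(1), of u] mult_right_mono[OF assms(3), of "(ip N u u) ^ 3"]
    by simp
  also have "\<dots> = (\<eta>\<^sup>2 * ip N u u) ^ 3" by (simp add: power_mult_distrib flip: power_mult)
  finally show 1: "ip N (mv N B u) (mv N B u) \<le> \<eta>\<^sup>2 * ip N u u"
    by (rule power_le_imp_le_base[of _ 2, simplified]) simp
  have "(ip N u (mv N B u))\<^sup>2 \<le> ip N u u * (\<eta>\<^sup>2 * ip N u u)"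
    using ip_cauchy_schwarz[of N u "mv N B u"] mult_left_mono[OF 1, of "ip N u u"] by simp
  also have "\<dots> = (\<eta> * ip N u u)\<^sup>2" by (simp add: power2_eq_square)
  finally have "\<bar>ip N u (mv N B u)\<bar> \<le> \<bar>\<eta> * ip N u u\<bar>"
    by (simp only: abs_le_square_iff)
  then show "\<bar>ip N u (mv N B u)\<bar> \<le> \<eta> * ip N u u"
    using assms(2) by (simp add: abs_mult)
qed

text \<open>There are m unknowns but m - 1 equations. Filling up with a zero row gives a singular
  square matrix, whose kernel supplies the coefficients.\<close>

lemma underdetermined_system:
  fixes C :: "nat \<Rightarrow> nat \<Rightarrow> real"
  assumes "m > 0"
  obtains c where "\<exists>a<m. c a \<noteq> 0" "\<And>t. t < m - 1 \<Longrightarrow> (\<Sum>a<m. c a * C t a) = 0"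
proof -
  define K where "K = mat m m (\<lambda>(t, a). if t < m - 1 then C t a else 0)"
  have K: "K \<in> carrier_mat m m" by (simp add: K_def)
  have "K = mat\<^sub>r m m (\<lambda>t. if t = m - 1 then 0\<^sub>v m else row K t)"
    using assms by (intro eq_matI) (auto simp: K_def)
  then have "det K = 0"
    using det_row_0[of "m - 1" m "row K"] assms K by auto
  then obtain w where w: "w \<in> carrier_vec m" "w \<noteq> 0\<^sub>v m" "K *\<^sub>v w = 0\<^sub>v m"
    using det_0_iff_vec_prod_zero[OF K] by auto
  obtain a where a: "a < m" "w $ a \<noteq> 0" using w by (metis carrier_vecD eq_vecI index_zero_vec)
  show ?thesis
  proof (rule that[of "\<lambda>a. w $ a"])
    fix t assume t: "t < m - 1"
    have "(K *\<^sub>v w) $ t = (\<Sum>a<m. w $ a * C t a)"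
      using t w(1) by (simp add: K_def scalar_prod_def lessThan_atLeast0 mult.commute)
    then show "(\<Sum>a<m. w $ a * C t a) = 0" using w t by simp
  qed (use a in blast)
qed

text \<open>Sampling an orthonormal family of functions on the grid gives vectors that are
  orthonormal only up to a Riemann-sum error \<gamma>. The usual identities then hold up to factors
  1 + k \<gamma> and 1 - k \<gamma>.\<close>

definition nearly_orthonormal :: "nat \<Rightarrow> nat \<Rightarrow> (nat \<Rightarrow> nat \<Rightarrow> real) \<Rightarrow> real \<Rightarrow> bool" where
  "nearly_orthonormal N k e \<gamma> \<longleftrightarrow>
    (\<forall>a\<in>{1..k}. \<forall>b\<in>{1..k}. \<bar>ip N (e a) (e b) - of_bool (a = b)\<bar> \<le> \<gamma>)"

lemma norm_combination:
  assumes "nearly_orthonormal N k e \<gamma>" "L \<subseteq> {1..k}" "0 \<le> \<gamma>"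
  shows "\<bar>ip N (\<lambda>a. \<Sum>l\<in>L. c l * e l a) (\<lambda>a. \<Sum>l\<in>L. c l * e l a) - (\<Sum>l\<in>L. (c l)\<^sup>2)\<bar>
    \<le> k * \<gamma> * (\<Sum>l\<in>L. (c l)\<^sup>2)"
proof -
  have fin: "finite L" using assms(2) finite_subset by blast
  have "(\<Sum>l\<in>L. (c l)\<^sup>2) = (\<Sum>l\<in>L. \<Sum>m\<in>L. c l * c m * of_bool (l = m))"
  proof (intro sum.cong refl)
    fix l assume "l \<in> L"
    have "(\<Sum>m\<in>L. c l * c m * of_bool (l = m)) = (\<Sum>m\<in>L. if m = l then c l * c m else 0)"
      by (intro sum.cong) auto
    then show "(c l)\<^sup>2 = (\<Sum>m\<in>L. c l * c m * of_bool (l = m))"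
      using \<open>l \<in> L\<close> fin by (simp add: power2_eq_square)
  qed
  then have "ip N (\<lambda>a. \<Sum>l\<in>L. c l * e l a) (\<lambda>a. \<Sum>l\<in>L. c l * e l a) - (\<Sum>l\<in>L. (c l)\<^sup>2) =
      (\<Sum>l\<in>L. \<Sum>m\<in>L. c l * c m * (ip N (e l) (e m) - of_bool (l = m)))"
    unfolding ip_sum_left ip_sum_right
    by (simp add: sum_distrib_left right_diff_distrib sum_subtractf mult.assoc)
  also have "\<bar>\<dots>\<bar> \<le> (\<Sum>l\<in>L. \<Sum>m\<in>L. \<bar>c l * c m * (ip N (e l) (e m) - of_bool (l = m))\<bar>)"
    by (rule order_trans[OF sum_abs sum_mono]) (rule sum_abs)
  also have "\<dots> \<le> (\<Sum>l\<in>L. \<Sum>m\<in>L. \<bar>c l\<bar> * \<bar>c m\<bar> * \<gamma>)"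
  proof (intro sum_mono)
    fix l m assume "l \<in> L" "m \<in> L"
    then have "\<bar>ip N (e l) (e m) - of_bool (l = m)\<bar> \<le> \<gamma>"
      using assms(1,2) unfolding nearly_orthonormal_def by blast
    then show "\<bar>c l * c m * (ip N (e l) (e m) - of_bool (l = m))\<bar> \<le> \<bar>c l\<bar> * \<bar>c m\<bar> * \<gamma>"
      unfolding abs_mult by (intro mult_left_mono) auto
  qed
  also have "\<dots> = (\<Sum>l\<in>L. \<bar>c l\<bar> * 1)\<^sup>2 * \<gamma>"
    by (simp only: power2_eq_square mult_1_right sum_product) (simp only: sum_distrib_right)
  also have "\<dots> \<le> ((\<Sum>l\<in>L. \<bar>c l\<bar>\<^sup>2) * (\<Sum>l\<in>L. 1\<^sup>2)) * \<gamma>"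
    using assms by (intro mult_right_mono Cauchy_Schwarz_ineq_sum)
  also have "\<dots> = card L * (\<gamma> * (\<Sum>l\<in>L. (c l)\<^sup>2))" by simp
  also have "\<dots> \<le> k * (\<gamma> * (\<Sum>l\<in>L. (c l)\<^sup>2))"
    using assms card_mono[OF _ assms(2)] by (intro mult_right_mono) (auto intro!: mult_nonneg_nonneg sum_nonneg)
  finally show ?thesis by (simp add: mult.assoc)
qed

text \<open>For z = sum of (e_l' x) e_l, the sum S of squared coefficients equals x' z, while |z|^2
  is at most (1 + k \<gamma>) S. Cauchy-Schwarz and cancelling one factor S finish.\<close>

lemma bessel_nearly:
  assumes "nearly_orthonormal N k e \<gamma>" "0 \<le> \<gamma>"
  shows "(\<Sum>l=1..k. (ip N (e l) x)\<^sup>2) \<le> (1 + k * \<gamma>) * ip N x x"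
proof -
  define y where "y = (\<lambda>l. ip N (e l) x)"
  define S where "S = (\<Sum>l=1..k. (y l)\<^sup>2)"
  let ?z = "\<lambda>a. \<Sum>l=1..k. y l * e l a"
  have "S \<ge> 0" unfolding S_def by (simp add: sum_nonneg)
  have "ip N ?z ?z \<le> S + k * \<gamma> * S"
    using norm_combination[OF assms(1) order_refl assms(2), of y] unfolding S_def by linarith
  then have z: "ip N ?z ?z \<le> (1 + k * \<gamma>) * S" by (simp add: algebra_simps)
  have "S = ip N x ?z"
    unfolding ip_sum_right S_def y_def by (simp add: ip_commute[of N x] power2_eq_square)
  then have "S\<^sup>2 \<le> ip N x x * ip N ?z ?z" using ip_cauchy_schwarz by simp
  also have "\<dots> \<le> ip N x x * ((1 + k * \<gamma>) * S)" using z by (intro mult_left_mono) auto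
  finally have "S * S \<le> S * ((1 + k * \<gamma>) * ip N x x)" by (simp add: power2_eq_square mult_ac)
  then have "S \<le> (1 + k * \<gamma>) * ip N x x"
    using \<open>S \<ge> 0\<close> assms(2) by (cases "S = 0") (simp_all add: mult_le_cancel_left_pos)
  then show ?thesis by (simp add: S_def y_def)
qed

text \<open>For x in the span of the e_l, |x|^2 is the sum of c_l (e_l' x). Cauchy-Schwarz together
  with the comparison between |x|^2 and the sum of the c_l^2 reverses the Bessel inequality.\<close>

lemma reverse_bessel_nearly:
  fixes c :: "nat \<Rightarrow> real"
  assumes "nearly_orthonormal N k e \<gamma>" "0 \<le> \<gamma>" "k * \<gamma> < 1" "L \<subseteq> {1..k}"
  defines "x \<equiv> \<lambda>a. \<Sum>l\<in>L. c l * e l a"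
  shows "(1 - k * \<gamma>) * ip N x x \<le> (\<Sum>l\<in>L. (ip N (e l) x)\<^sup>2)"
    and "(1 - k * \<gamma>) * (\<Sum>l\<in>L. (c l)\<^sup>2) \<le> ip N x x"
proof -
  have 1: "(1 - k * \<gamma>) * (\<Sum>l\<in>L. (c l)\<^sup>2) \<le> ip N x x"
    using norm_combination[OF assms(1,4,2), of c] unfolding x_def by (simp add: algebra_simps)
  then show "(1 - k * \<gamma>) * (\<Sum>l\<in>L. (c l)\<^sup>2) \<le> ip N x x" .
  let ?Y = "\<Sum>l\<in>L. (ip N (e l) x)\<^sup>2"
  have Y: "0 \<le> ?Y" by (simp add: sum_nonneg)
  have "ip N x x = (\<Sum>l\<in>L. c l * ip N (e l) x)"
    unfolding x_def ip_sum_left ..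
  then have "(ip N x x)\<^sup>2 \<le> (\<Sum>l\<in>L. (c l)\<^sup>2) * ?Y" using Cauchy_Schwarz_ineq_sum by simp
  then have "(1 - k * \<gamma>) * (ip N x x)\<^sup>2 \<le> (1 - k * \<gamma>) * ((\<Sum>l\<in>L. (c l)\<^sup>2) * ?Y)"
    using assms(3) by (intro mult_left_mono) auto
  also have "\<dots> = ((1 - k * \<gamma>) * (\<Sum>l\<in>L. (c l)\<^sup>2)) * ?Y" by simp
  also have "\<dots> \<le> ip N x x * ?Y" using 1 Y by (rule mult_right_mono)
  finally have "ip N x x * ((1 - k * \<gamma>) * ip N x x) \<le> ip N x x * ?Y"
    by (simp add: power2_eq_square mult_ac)
  then show "(1 - k * \<gamma>) * ip N x x \<le> ?Y"
    using Y by (cases "ip N x x = 0") (simp_all add: mult_le_cancel_left_pos less_le)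
qed

section \<open>Locating the eigenvalues\<close>

text \<open>The min-max argument is carried out with explicit test vectors. For the upper bound, a
  combination of the first i eigenvectors is chosen orthogonal to e_1, ..., e_(i-1); for the lower
  bound, a combination of e_1, ..., e_i orthogonal to the first i - 1 eigenvectors. Both exist
  because i unknowns face i - 1 equations.\<close>

theorem eigval_near:
  assumes B: "B \<in> carrier_mat N N" "transpose_mat B = B"
    and e: "nearly_orthonormal N k e \<gamma>" "0 \<le> \<gamma>" "k * \<gamma> < 1"
    and \<theta>_mono: "\<And>a b. 1 \<le> a \<Longrightarrow> a \<le> b \<Longrightarrow> b \<le> k \<Longrightarrow> \<theta> b \<le> \<theta> a" and \<theta>_pos: "0 < \<theta> k"
    and s: "0 \<le> s"
    and quad: "\<And>x. \<bar>ip N x (mv N (matfun B) x) - s * (\<Sum>l=1..k. \<theta> l * (ip N (e l) x)\<^sup>2)\<bar> \<le> \<eta> * ip N x x"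
    and i: "1 \<le> i" "i \<le> k" "i \<le> N"
  shows "s * \<theta> i * (1 - k * \<gamma>) - \<eta> \<le> eigval i B" "eigval i B \<le> s * \<theta> i * (1 + k * \<gamma>) + \<eta>"
proof -
  obtain q :: "nat \<Rightarrow> nat \<Rightarrow> real" and d where
    orth: "\<forall>a<N. \<forall>b<N. ip N (q a) (q b) = of_bool (a = b)" and
    compl: "\<forall>i<N. \<forall>j<N. (\<Sum>a<N. q a i * q a j) = of_bool (i = j)" and
    eig: "\<forall>a<N. \<forall>i<N. mv N (matfun B) (q a) i = d a * q a i" and
    dec: "\<forall>a b. a \<le> b \<longrightarrow> b < N \<longrightarrow> d b \<le> d a" and
    ev: "\<forall>a<N. eigval (a + 1) B = d a"
    using symmetric_eigenbasis[OF B] by (elim exE conjE)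
  note dec = dec[rule_format] and ev = ev[rule_format]
  have d: "eigval i B = d (i - 1)" using ev[of "i - 1"] i by simp
  have \<theta>_nonneg: "0 \<le> \<theta> l" if "l \<in> {1..k}" for l
    using \<theta>_mono[of l k] \<theta>_pos that by auto
  have expand: "x j = (\<Sum>a<N. ip N (q a) x * q a j)" if "j < N" for x :: "nat \<Rightarrow> real" and j
  proof -
    have "(\<Sum>a<N. ip N (q a) x * q a j) = (\<Sum>l<N. x l * (\<Sum>a<N. q a l * q a j))"
      unfolding ip_def sum_distrib_left sum_distrib_right
      by (subst sum.swap) (simp add: mult_ac)
    also have "\<dots> = (\<Sum>l<N. if l = j then x l else 0)"
      using that by (intro sum.cong) (auto simp: compl)
    finally show ?thesis using that by simp
  qed
  have parseval: "ip N x y = (\<Sum>a<N. ip N (q a) x * ip N (q a) y)" for x y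
  proof -
    have "ip N x y = ip N (\<lambda>j. \<Sum>a<N. ip N (q a) x * q a j) y"
      using expand by (intro ip_cong) auto
    then show ?thesis by (simp add: ip_sum_left)
  qed
  have symB: "symfun N (matfun B)"
    using B unfolding symfun_def matfun_def by (metis carrier_matD index_transpose_mat(1))
  have quadB: "ip N x (mv N (matfun B) x) = (\<Sum>a<N. d a * (ip N (q a) x)\<^sup>2)" for x
  proof -
    have "ip N (q a) (mv N (matfun B) x) = d a * ip N (q a) x" if "a < N" for a
    proof -
      have "ip N (q a) (mv N (matfun B) x) = ip N (\<lambda>j. d a * q a j) x"
        unfolding ip_mv_sym[OF symB] using eig that by (intro ip_cong) auto
      then show ?thesis by (simp add: ip_def sum_distrib_left mult.assoc)
    qed
    then show ?thesis by (subst parseval) (simp add: power2_eq_square mult_ac)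
  qed
  show "eigval i B \<le> s * \<theta> i * (1 + k * \<gamma>) + \<eta>"
  proof -
    obtain c where c: "\<exists>a<i. c a \<noteq> 0"
      "\<And>t. t < i - 1 \<Longrightarrow> (\<Sum>a<i. c a * ip N (e (t + 1)) (q a)) = 0"
      using underdetermined_system[of i "\<lambda>t a. ip N (e (t + 1)) (q a)"] i by auto
    define x where "x = (\<lambda>j. \<Sum>a<i. c a * q a j)"
    have qx: "ip N (q b) x = (if b < i then c b else 0)" if "b < N" for b
    proof -
      have "ip N (q b) x = (\<Sum>a<i. c a * ip N (q b) (q a))" unfolding x_def ip_sum_right ..
      also have "\<dots> = (\<Sum>a<i. if a = b then c a else 0)"
        using that i by (intro sum.cong) (auto simp: orth)
      finally show ?thesis by simp
    qed
    have ex: "ip N (e l) x = 0" if "l \<in> {1..<i}" for l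
      using c(2)[of "l - 1"] that unfolding x_def ip_sum_right by auto
    obtain a where a: "a < i" "c a \<noteq> 0" using c by auto
    have xx: "0 < ip N x x"
      unfolding parseval[of x x] using a i qx
      by (intro sum_pos2[of _ a]) (auto simp: zero_less_mult_iff)
    have "d (i - 1) * ip N x x \<le> ip N x (mv N (matfun B) x)"
      unfolding quadB parseval[of x x] sum_distrib_left
    proof (intro sum_mono)
      fix b assume "b \<in> {..<N}"
      then show "d (i - 1) * (ip N (q b) x * ip N (q b) x) \<le> d b * (ip N (q b) x)\<^sup>2"
        using dec[of b "i - 1"] i qx[of b]
        by (auto simp: power2_eq_square intro!: mult_right_mono)
    qed
    also have "\<dots> \<le> s * (\<Sum>l=1..k. \<theta> l * (ip N (e l) x)\<^sup>2) + \<eta> * ip N x x"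
      using quad[of x] by linarith
    also have "s * (\<Sum>l=1..k. \<theta> l * (ip N (e l) x)\<^sup>2) \<le> s * (\<Sum>l=1..k. \<theta> i * (ip N (e l) x)\<^sup>2)"
    proof (intro mult_left_mono sum_mono s)
      fix l assume "l \<in> {1..k}"
      then show "\<theta> l * (ip N (e l) x)\<^sup>2 \<le> \<theta> i * (ip N (e l) x)\<^sup>2"
        using ex[of l] \<theta>_mono[of i l] i by (cases "l < i") (auto intro!: mult_right_mono)
    qed
    also have "\<dots> = s * \<theta> i * (\<Sum>l=1..k. (ip N (e l) x)\<^sup>2)" by (simp add: sum_distrib_left mult.assoc)
    also have "\<dots> \<le> s * \<theta> i * ((1 + k * \<gamma>) * ip N x x)"
      using s \<theta>_nonneg[of i] i by (intro mult_left_mono bessel_nearly e) auto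
    finally have "d (i - 1) * ip N x x \<le> (s * \<theta> i * (1 + k * \<gamma>) + \<eta>) * ip N x x"
      by (simp add: algebra_simps)
    then show ?thesis unfolding d using xx by simp
  qed
  show "s * \<theta> i * (1 - k * \<gamma>) - \<eta> \<le> eigval i B"
  proof -
    obtain c where c: "\<exists>a<i. c a \<noteq> 0"
      "\<And>t. t < i - 1 \<Longrightarrow> (\<Sum>a<i. c a * ip N (q t) (e (a + 1))) = 0"
      using underdetermined_system[of i "\<lambda>t a. ip N (q t) (e (a + 1))"] i by auto
    define x where "x = (\<lambda>j. \<Sum>l\<in>{1..i}. c (l - 1) * e l j)"
    have shift: "(\<Sum>l\<in>{1..i}. g (l - 1) l) = (\<Sum>a<i. g a (a + 1))" for g :: "nat \<Rightarrow> nat \<Rightarrow> real"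
      by (rule sum.reindex_bij_witness[of _ "\<lambda>a. a + 1" "\<lambda>l. l - 1"]) auto
    have qx: "ip N (q t) x = 0" if "t < i - 1" for t
      unfolding x_def ip_sum_right using c(2)[OF that] shift[of "\<lambda>a l. c a * ip N (q t) (e l)"] by simp
    obtain a where a: "a < i" "c a \<noteq> 0" using c by auto
    have sub: "{1..i} \<subseteq> {1..k}" using i by auto
    note rb = reverse_bessel_nearly[OF e sub, of "\<lambda>l. c (l - 1)", folded x_def]
    have "0 < (\<Sum>l\<in>{1..i}. (c (l - 1))\<^sup>2)"
      using a by (intro sum_pos2[of _ "a + 1"]) auto
    then have "0 < (1 - k * \<gamma>) * (\<Sum>l\<in>{1..i}. (c (l - 1))\<^sup>2)" using e by simp
    then have xx: "0 < ip N x x" using rb(2) by linarith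
    have "s * \<theta> i * ((1 - k * \<gamma>) * ip N x x) \<le> s * \<theta> i * (\<Sum>l\<in>{1..i}. (ip N (e l) x)\<^sup>2)"
      using s \<theta>_nonneg[of i] i by (intro mult_left_mono rb) auto
    also have "\<dots> = s * (\<Sum>l\<in>{1..i}. \<theta> i * (ip N (e l) x)\<^sup>2)" by (simp add: sum_distrib_left mult.assoc)
    also have "\<dots> \<le> s * (\<Sum>l\<in>{1..i}. \<theta> l * (ip N (e l) x)\<^sup>2)"
      using \<theta>_mono i s by (intro mult_left_mono sum_mono mult_right_mono) auto
    also have "\<dots> \<le> s * (\<Sum>l\<in>{1..k}. \<theta> l * (ip N (e l) x)\<^sup>2)"
      using \<theta>_nonneg sub s by (intro mult_left_mono sum_mono2) auto
    also have "\<dots> \<le> ip N x (mv N (matfun B) x) + \<eta> * ip N x x"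
      using quad[of x] by linarith
    also have "ip N x (mv N (matfun B) x) \<le> d (i - 1) * ip N x x"
      unfolding quadB parseval[of x x] sum_distrib_left
    proof (intro sum_mono)
      fix b assume "b \<in> {..<N}"
      then show "d b * (ip N (q b) x)\<^sup>2 \<le> d (i - 1) * (ip N (q b) x * ip N (q b) x)"
        using dec[of "i - 1" b] i qx[of b]
        by (cases "b < i - 1") (auto simp: power2_eq_square intro!: mult_right_mono)
    qed
    finally have "(s * \<theta> i * (1 - k * \<gamma>) - \<eta>) * ip N x x \<le> d (i - 1) * ip N x x"
      by (simp add: algebra_simps)
    then show ?thesis unfolding d using xx by simp
  qed
qed

section \<open>Asymptotic expansion of an eigenvector\<close>

lemma bigo_ev_eq:
  "f' \<in> O[F](g) \<Longrightarrow> eventually (\<lambda>x. f x = f' x) F \<Longrightarrow> f \<in> O[F](g)"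
  by (subst landau_o.big.in_cong) 

lemma bigo_mult_to:
  fixes f1 f2 g1 g2 g :: "'b \<Rightarrow> real"
  assumes "f1 \<in> O[F](g1)" "f2 \<in> O[F](g2)" "eventually (\<lambda>x. g1 x * g2 x = g x) F"
  shows "(\<lambda>x. f1 x * f2 x) \<in> O[F](g)"
proof -
  have "(\<lambda>x. f1 x * f2 x) \<in> O[F](\<lambda>x. g1 x * g2 x)" by (rule landau_o.big.mult) fact+
  also have "O[F](\<lambda>x. g1 x * g2 x) = O[F](g)" by (rule landau_o.big.cong) fact
  finally show ?thesis .
qed

lemma bigo_mult_const: "f \<in> O[F](\<lambda>_. 1) \<Longrightarrow> f' \<in> O[F](g) \<Longrightarrow> (\<lambda>x. f x * f' x) \<in> O[F](g)"
  for f f' g :: "'b \<Rightarrow> real"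
  by (rule bigo_mult_to) auto

lemma bigo_tendsto_zero:
  fixes f g :: "'b \<Rightarrow> real"
  assumes "f \<in> O[F](g)" "(g \<longlongrightarrow> 0) F"
  shows "(f \<longlongrightarrow> 0) F"
proof -
  have "g \<in> o[F](\<lambda>_. 1)" using assms(2) by (intro smalloI_tendsto) auto
  then have "f \<in> o[F](\<lambda>_. 1)" by (rule landau_o.big_small_trans[OF assms(1)])
  from smalloD_tendsto[OF this] show ?thesis by simp
qed

text \<open>The deterministic core. Intended reading: \<open>x l\<close> is e_l' v, \<open>g\<close>
  the Gram matrix of the e_l, \<open>B1\<close>, \<open>B2\<close>, \<open>B3\<close> the forms e_j'
  W^n e_l for n = 1, 2, 3, \<open>m2 j\<close> the mean of \<open>B2 j i\<close>, and
  \<open>R\<close> the remainder with W^4 v. The filter is abstract so that it can range over pairs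
  of a size and an outcome.\<close>

locale eigen_expansion =
  fixes F :: "'b filter" and k i :: nat and \<theta> :: "nat \<Rightarrow> real"
    and n \<epsilon> s lam z :: "'b \<Rightarrow> real"
    and x R m2 :: "nat \<Rightarrow> 'b \<Rightarrow> real"
    and g B1 B2 B3 :: "nat \<Rightarrow> nat \<Rightarrow> 'b \<Rightarrow> real"
  assumes i: "i \<in> {1..k}"
    and \<theta>_pos: "\<And>l. l \<in> {1..k} \<Longrightarrow> 0 < \<theta> l"
    and \<theta>_simple: "\<And>l. l \<in> {1..k} \<Longrightarrow> l \<noteq> i \<Longrightarrow> \<theta> l \<noteq> \<theta> i"
    and pos: "eventually (\<lambda>t. 0 < n t \<and> 0 < \<epsilon> t \<and> \<epsilon> t \<le> 1 \<and> s t = n t * \<epsilon> t) F"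
    and s_large: "((\<lambda>t. 1 / s t) \<longlongrightarrow> 0) F"
    and eps_small: "(\<epsilon> \<longlongrightarrow> 0) F"
    and eps_large: "((\<lambda>t. n t powr (-2/3) / \<epsilon> t) \<longlongrightarrow> 0) F"
    and lam: "((\<lambda>t. lam t / s t) \<longlongrightarrow> \<theta> i) F"
    and x_bdd: "\<And>l. l \<in> {1..k} \<Longrightarrow> x l \<in> O[F](\<lambda>_. 1)"
    and x_nonneg: "eventually (\<lambda>t. 0 \<le> x i t) F"
    and g: "\<And>j l. j \<in> {1..k} \<Longrightarrow> l \<in> {1..k} \<Longrightarrow> (\<lambda>t. g j l t - of_bool (j = l)) \<in> O[F](\<lambda>t. 1 / n t)"
    and B1: "\<And>j l. j \<in> {1..k} \<Longrightarrow> l \<in> {1..k} \<Longrightarrow> B1 j l \<in> O[F](\<lambda>t. sqrt (\<epsilon> t))"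
    and B2: "\<And>j l. j \<in> {1..k} \<Longrightarrow> l \<in> {1..k} \<Longrightarrow> B2 j l \<in> O[F](s)"
    and B2_m2: "\<And>j. j \<in> {1..k} \<Longrightarrow> (\<lambda>t. B2 j i t - m2 j t) \<in> O[F](\<lambda>t. s t / sqrt (n t))"
    and m2: "\<And>j. j \<in> {1..k} \<Longrightarrow> m2 j \<in> O[F](s)"
    and B3: "\<And>j l. j \<in> {1..k} \<Longrightarrow> l \<in> {1..k} \<Longrightarrow> B3 j l \<in> O[F](s)"
    and R: "\<And>j. j \<in> {1..k} \<Longrightarrow> R j \<in> O[F](\<lambda>t. (s t)\<^sup>2)"
    and expansion: "\<And>j. j \<in> {1..k} \<Longrightarrow> eventually (\<lambda>t. lam t ^ 4 * x j t =
        s t * (\<Sum>l=1..k. \<theta> l * x l t * (lam t ^ 3 * g j l t + (lam t)\<^sup>2 * B1 j l t + lam t * B2 j l t + B3 j l t))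
          + R j t) F"
    \<comment> \<open>\<open>z\<close> stands for \<open>\<bar>W v\<bar>\<^sup>2\<close>; the identity is \<open>\<lambda> = v' A v\<close> with \<open>v' W v\<close> multiplied by \<open>\<lambda>\<close> and expanded once more\<close>
    and z: "z \<in> O[F](s)"
    and energy: "eventually (\<lambda>t. lam t * (lam t - s t * (\<Sum>l=1..k. \<theta> l * (x l t)\<^sup>2)) =
        s t * (\<Sum>l=1..k. \<theta> l * x l t * (lam t * x l t - s t * (\<Sum>m=1..k. \<theta> m * x m t * g l m t))) + z t) F"
begin

lemma s_pos: "eventually (\<lambda>t. 0 < s t) F"
  using pos by eventually_elim auto

lemma lam_pos: "eventually (\<lambda>t. 0 < lam t) F"
proof -
  have "eventually (\<lambda>t. 0 < lam t / s t) F"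
    using lam \<theta>_pos[OF i] by (rule order_tendstoD)
  then show ?thesis using s_pos by eventually_elim (simp add: zero_less_divide_iff)
qed

lemma inverse_bigo:
  assumes "((\<lambda>t. f t / s t) \<longlongrightarrow> c) F" "c \<noteq> 0"
  shows "(\<lambda>t. 1 / f t) \<in> O[F](\<lambda>t. 1 / s t)"
proof -
  have "((\<lambda>t. (1 / f t) / (1 / s t)) \<longlongrightarrow> 1 / c) F"
    using tendsto_divide[OF tendsto_const assms(1) assms(2), of 1] by simp
  then show ?thesis using s_pos by (intro bigoI_tendsto[of _ _ "1 / c"]) (auto elim: eventually_mono)
qed

lemma inv_lam: "(\<lambda>t. 1 / lam t) \<in> O[F](\<lambda>t. 1 / s t)"
  using inverse_bigo[OF lam] \<theta>_pos[OF i] by simp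

lemma inv_lam_power: "(\<lambda>t. (1 / lam t) ^ m) \<in> O[F](\<lambda>t. (1 / s t) ^ m)"
  using landau_o.big_power[OF inv_lam] .

lemma gap_tendsto: "((\<lambda>t. (lam t - s t * c) / s t) \<longlongrightarrow> \<theta> i - c) F"
proof (rule Lim_transform_eventually)
  show "((\<lambda>t. lam t / s t - c) \<longlongrightarrow> \<theta> i - c) F" using lam by (intro tendsto_intros)
  show "eventually (\<lambda>t. lam t / s t - c = (lam t - s t * c) / s t) F"
    using s_pos by eventually_elim (simp add: field_simps)
qed

lemma inv_gap: "l \<in> {1..k} \<Longrightarrow> l \<noteq> i \<Longrightarrow> (\<lambda>t. 1 / (lam t - s t * \<theta> l)) \<in> O[F](\<lambda>t. 1 / s t)"
  using inverse_bigo[OF gap_tendsto] \<theta>_simple by force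

lemma const_bigo_eps: "\<epsilon> \<in> O[F](\<lambda>_. 1)" "(\<lambda>t. sqrt (\<epsilon> t)) \<in> O[F](\<lambda>_. 1)" "(\<lambda>t. 1 / s t) \<in> O[F](\<lambda>_. 1)"
proof -
  show "\<epsilon> \<in> O[F](\<lambda>_. 1)" by (rule bigoI_tendsto[where c = 0]) (use eps_small in auto)
  show "(\<lambda>t. sqrt (\<epsilon> t)) \<in> O[F](\<lambda>_. 1)"
    by (rule bigoI_tendsto[where c = 0]) (use tendsto_real_sqrt[OF eps_small] in auto)
  show "(\<lambda>t. 1 / s t) \<in> O[F](\<lambda>_. 1)" by (rule bigoI_tendsto[where c = 0]) (use s_large in auto)
qed

lemma inv_n: "(\<lambda>t. 1 / n t) \<in> O[F](\<lambda>t. 1 / s t)"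
proof (rule bigo_ev_eq)
  show "(\<lambda>t. \<epsilon> t * (1 / s t)) \<in> O[F](\<lambda>t. 1 / s t)"
    by (rule bigo_mult_const) (use const_bigo_eps in auto)
  show "eventually (\<lambda>t. 1 / n t = \<epsilon> t * (1 / s t)) F"
    using pos by eventually_elim auto
qed

text \<open>The bracket of the expansion divided by \<lambda>^3, minus the identity matrix. The
  identity part moves to the left-hand side, where it turns \<lambda> into the gap \<lambda> - s
  \<theta>_j.\<close>

definition E :: "nat \<Rightarrow> nat \<Rightarrow> 'b \<Rightarrow> real" where
  "E j l t = (g j l t - of_bool (j = l)) + B1 j l t * (1 / lam t) + B2 j l t * (1 / lam t)\<^sup>2
     + B3 j l t * (1 / lam t) ^ 3"

lemma B1_lam: "j \<in> {1..k} \<Longrightarrow> l \<in> {1..k} \<Longrightarrow> (\<lambda>t. B1 j l t * (1 / lam t)) \<in> O[F](\<lambda>t. 1 / s t)"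
  by (rule bigo_mult_const[OF landau_o.big_trans[OF B1 const_bigo_eps(2)] inv_lam])

lemma B2_lam:
  assumes "f \<in> O[F](s)" shows "(\<lambda>t. f t * (1 / lam t)\<^sup>2) \<in> O[F](\<lambda>t. 1 / s t)"
  by (rule bigo_mult_to[OF assms inv_lam_power])
    (use s_pos in \<open>auto elim!: eventually_mono simp: power2_eq_square\<close>)

lemma B3_lam:
  assumes "j \<in> {1..k}" "l \<in> {1..k}" shows "(\<lambda>t. B3 j l t * (1 / lam t) ^ 3) \<in> O[F](\<lambda>t. (1 / s t)\<^sup>2)"
  by (rule bigo_mult_to[OF B3[OF assms] inv_lam_power])
    (use s_pos in \<open>auto elim!: eventually_mono simp: power2_eq_square power3_eq_cube\<close>)

lemma R_lam: "j \<in> {1..k} \<Longrightarrow> (\<lambda>t. R j t * (1 / lam t) ^ 3) \<in> O[F](\<lambda>t. 1 / s t)"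
  by (rule bigo_mult_to[OF R inv_lam_power])
    (use s_pos in \<open>auto elim!: eventually_mono simp: power2_eq_square power3_eq_cube\<close>)

lemma inv_s_sq: "(\<lambda>t. (1 / s t)\<^sup>2) \<in> O[F](\<lambda>t. 1 / s t)"
  unfolding power2_eq_square by (rule bigo_mult_const) (use const_bigo_eps in auto)

lemma E_bigo: "j \<in> {1..k} \<Longrightarrow> l \<in> {1..k} \<Longrightarrow> E j l \<in> O[F](\<lambda>t. 1 / s t)"
  unfolding E_def
  by (intro sum_in_bigo B1_lam B2_lam B2 landau_o.big_trans[OF g inv_n] landau_o.big_trans[OF B3_lam inv_s_sq])

lemma s_times: "f \<in> O[F](\<lambda>t. 1 / s t * h t) \<Longrightarrow> (\<lambda>t. s t * f t) \<in> O[F](h)"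
  by (rule bigo_mult_to[OF landau_o.big_refl]) (use s_pos in \<open>auto elim!: eventually_mono\<close>)

lemma s_times1: "f \<in> O[F](\<lambda>t. 1 / s t) \<Longrightarrow> (\<lambda>t. s t * f t) \<in> O[F](\<lambda>_. 1)"
  using s_times[of f "\<lambda>_. 1"] by simp

lemma sum_delta: "j \<in> {1..k} \<Longrightarrow> (\<Sum>l=1..k. h l * of_bool (j = l)) = (h j :: real)"
proof -
  assume j: "j \<in> {1..k}"
  have "(\<Sum>l=1..k. h l * of_bool (j = l)) = (\<Sum>l=1..k. if l = j then h l else 0)"
    by (intro sum.cong) auto
  then show ?thesis using j by simp
qed

lemma gap_equation:
  assumes j: "j \<in> {1..k}"
  shows "eventually (\<lambda>t. (lam t - s t * \<theta> j) * x j t =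
    s t * (\<Sum>l=1..k. \<theta> l * x l t * E j l t) + R j t * (1 / lam t) ^ 3) F"
  using expansion[OF j] lam_pos
proof eventually_elim
  case (elim t)
  have E: "lam t ^ 3 * (E j l t + of_bool (j = l)) =
    lam t ^ 3 * g j l t + (lam t)\<^sup>2 * B1 j l t + lam t * B2 j l t + B3 j l t" for l
    unfolding E_def using elim(2) by (simp add: field_simps power3_eq_cube power2_eq_square)
  have "lam t ^ 3 * (lam t * x j t) = lam t ^ 4 * x j t" by (simp add: power3_eq_cube power4_eq_xxxx)
  also have "\<dots> = s t * (\<Sum>l=1..k. \<theta> l * x l t * (lam t ^ 3 * (E j l t + of_bool (j = l)))) + R j t"
    unfolding elim(1) E ..
  also have "(\<Sum>l=1..k. \<theta> l * x l t * (lam t ^ 3 * (E j l t + of_bool (j = l)))) =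
      lam t ^ 3 * (\<Sum>l=1..k. \<theta> l * x l t * (E j l t + of_bool (j = l)))"
    by (simp only: sum_distrib_left mult_ac)
  also have "s t * (lam t ^ 3 * S) + R j t = lam t ^ 3 * (s t * S + R j t * (1 / lam t) ^ 3)" for S
    using elim(2) by (simp add: field_simps)
  finally have "lam t * x j t = s t * (\<Sum>l=1..k. \<theta> l * x l t * (E j l t + of_bool (j = l))) + R j t * (1 / lam t) ^ 3"
    using elim(2) by simp
  also have "(\<Sum>l=1..k. \<theta> l * x l t * (E j l t + of_bool (j = l))) =
      (\<Sum>l=1..k. \<theta> l * x l t * E j l t) + \<theta> j * x j t"
    unfolding distrib_left sum.distrib sum_delta[OF j] ..
  finally show ?case by (simp add: algebra_simps)
qed

text \<open>Used twice: for j other than i the gap has order s, so the coordinate is O(1/s); for j =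
  i, once the coordinate tends to 1, the same bound controls \<lambda> - s \<theta>_i.\<close>

lemma gap_bigo:
  assumes j: "j \<in> {1..k}"
  shows "(\<lambda>t. (lam t - s t * \<theta> j) * x j t) \<in> O[F](\<lambda>_. 1)"
proof (rule bigo_ev_eq[OF _ gap_equation[OF j]], intro sum_in_bigo s_times1 big_sum_in_bigo)
  fix l assume l: "l \<in> {1..k}"
  show "(\<lambda>t. \<theta> l * x l t * E j l t) \<in> O[F](\<lambda>t. 1 / s t)"
    by (rule bigo_mult_const) (use x_bdd[OF l] E_bigo[OF j l] in auto)
next
  show "(\<lambda>t. R j t * (1 / lam t) ^ 3) \<in> O[F](\<lambda>_. 1)"
    using landau_o.big_trans[OF R_lam[OF j] const_bigo_eps(3)] .
qed

lemma x_small: "j \<in> {1..k} \<Longrightarrow> j \<noteq> i \<Longrightarrow> x j \<in> O[F](\<lambda>t. 1 / s t)"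
proof -
  assume j: "j \<in> {1..k}" "j \<noteq> i"
  have "eventually (\<lambda>t. (lam t - s t * \<theta> j) / s t \<noteq> 0) F"
    using tendsto_imp_eventually_ne[OF gap_tendsto, of "\<theta> j" 0] \<theta>_simple[OF j] by auto
  then have "eventually (\<lambda>t. x j t = (lam t - s t * \<theta> j) * x j t * (1 / (lam t - s t * \<theta> j))) F"
    by eventually_elim auto
  then show ?thesis
    by (rule bigo_ev_eq[OF bigo_mult_const[OF gap_bigo[OF j(1)] inv_gap[OF j]]])
qed

text \<open>\<open>y l\<close> is e_l' W v, rewritten through the eigenvector equation and therefore
  O(1) by \<open>gap_bigo\<close>. This makes the right side of the energy identity O(s), and
  dividing by \<lambda> gives O(1). The indices other than i drop out since their coordinates are
  O(1/s).\<close>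

lemma lam_minus_energy: "(\<lambda>t. lam t - s t * \<theta> i * (x i t)\<^sup>2) \<in> O[F](\<lambda>_. 1)"
proof -
  define y where "y = (\<lambda>l t. lam t * x l t - s t * (\<Sum>m=1..k. \<theta> m * x m t * g l m t))"
  have y: "y l \<in> O[F](\<lambda>_. 1)" if l: "l \<in> {1..k}" for l
  proof -
    have "y l = (\<lambda>t. (lam t - s t * \<theta> l) * x l t - s t * (\<Sum>m=1..k. \<theta> m * x m t * (g l m t - of_bool (l = m))))"
      unfolding y_def right_diff_distrib sum_subtractf sum_delta[OF l] by (auto simp: algebra_simps)
    also have "\<dots> \<in> O[F](\<lambda>_. 1)"
    proof (intro sum_in_bigo gap_bigo[OF l] s_times1 big_sum_in_bigo)
      fix m assume m: "m \<in> {1..k}"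
      show "(\<lambda>t. \<theta> m * x m t * (g l m t - of_bool (l = m))) \<in> O[F](\<lambda>t. 1 / s t)"
        by (rule bigo_mult_const) (use x_bdd[OF m] landau_o.big_trans[OF g[OF l m] inv_n] in auto)
    qed
    finally show ?thesis .
  qed
  let ?e = "\<lambda>t. lam t - s t * (\<Sum>l=1..k. \<theta> l * (x l t)\<^sup>2)"
  have "?e \<in> O[F](\<lambda>_. 1)"
  proof (rule bigo_ev_eq)
    show "eventually (\<lambda>t. ?e t = (s t * (\<Sum>l=1..k. \<theta> l * x l t * y l t) + z t) * (1 / lam t)) F"
      using energy lam_pos by eventually_elim (simp add: y_def field_simps)
    show "(\<lambda>t. (s t * (\<Sum>l=1..k. \<theta> l * x l t * y l t) + z t) * (1 / lam t)) \<in> O[F](\<lambda>_. 1)"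
    proof (rule bigo_mult_to[OF _ inv_lam])
      show "(\<lambda>t. s t * (\<Sum>l=1..k. \<theta> l * x l t * y l t) + z t) \<in> O[F](s)"
      proof (intro sum_in_bigo z)
        have "(\<lambda>t. \<Sum>l=1..k. \<theta> l * x l t * y l t) \<in> O[F](\<lambda>_. 1)"
        proof (intro big_sum_in_bigo)
          fix l assume l: "l \<in> {1..k}"
          show "(\<lambda>t. \<theta> l * x l t * y l t) \<in> O[F](\<lambda>_. 1)"
            by (rule bigo_mult_const) (use x_bdd[OF l] y[OF l] in auto)
        qed
        then show "(\<lambda>t. s t * (\<Sum>l=1..k. \<theta> l * x l t * y l t)) \<in> O[F](s)"
          by (rule bigo_mult_to[OF landau_o.big_refl]) auto
      qed
    qed (use s_pos in \<open>auto elim!: eventually_mono\<close>)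
  qed
  moreover have "(\<lambda>t. s t * (\<Sum>l\<in>{1..k} - {i}. \<theta> l * (x l t)\<^sup>2)) \<in> O[F](\<lambda>_. 1)"
  proof (intro s_times1 big_sum_in_bigo)
    fix l assume l: "l \<in> {1..k} - {i}"
    show "(\<lambda>t. \<theta> l * (x l t)\<^sup>2) \<in> O[F](\<lambda>t. 1 / s t)"
      unfolding power2_eq_square mult.assoc[symmetric]
      by (rule bigo_mult_const) (use x_bdd[of l] x_small[of l] l in auto)
  qed
  ultimately have "(\<lambda>t. ?e t + s t * (\<Sum>l\<in>{1..k} - {i}. \<theta> l * (x l t)\<^sup>2)) \<in> O[F](\<lambda>_. 1)"
    by (rule sum_in_bigo)
  also have "(\<lambda>t. ?e t + s t * (\<Sum>l\<in>{1..k} - {i}. \<theta> l * (x l t)\<^sup>2)) = (\<lambda>t. lam t - s t * \<theta> i * (x i t)\<^sup>2)"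
    using i by (subst sum.remove[of _ i]) (auto simp: algebra_simps)
  finally show ?thesis .
qed

lemma x_i_sq_tendsto: "((\<lambda>t. (x i t)\<^sup>2) \<longlongrightarrow> 1) F"
proof (rule Lim_transform_eventually)
  let ?e = "\<lambda>t. lam t - s t * \<theta> i * (x i t)\<^sup>2"
  have "(\<lambda>t. ?e t * (1 / s t)) \<in> O[F](\<lambda>t. 1 / s t)"
    by (rule bigo_mult_const[OF lam_minus_energy]) simp
  then have "((\<lambda>t. ?e t * (1 / s t)) \<longlongrightarrow> 0) F"
    using s_large by (rule bigo_tendsto_zero)
  then have "((\<lambda>t. (lam t / s t - ?e t * (1 / s t)) / \<theta> i) \<longlongrightarrow> (\<theta> i - 0) / \<theta> i) F"
    using \<theta>_pos[OF i] by (intro tendsto_intros lam) auto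
  then show "((\<lambda>t. (lam t / s t - ?e t * (1 / s t)) / \<theta> i) \<longlongrightarrow> 1) F"
    using \<theta>_pos[OF i] by simp
  show "eventually (\<lambda>t. (lam t / s t - ?e t * (1 / s t)) / \<theta> i = (x i t)\<^sup>2) F"
    using s_pos \<theta>_pos[OF i] by (auto elim!: eventually_mono simp: field_simps)
qed

text \<open>The square tends to 1, and the sign convention e_i' v \<ge> 0 selects the root
  +1.\<close>

lemma x_i_tendsto: "(x i \<longlongrightarrow> 1) F"
proof (rule Lim_transform_eventually)
  show "((\<lambda>t. sqrt ((x i t)\<^sup>2)) \<longlongrightarrow> 1) F"
    using tendsto_real_sqrt[OF x_i_sq_tendsto] by simp
  show "eventually (\<lambda>t. sqrt ((x i t)\<^sup>2) = x i t) F"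
    using x_nonneg by eventually_elim simp
qed

lemma lam_error: "(\<lambda>t. lam t - s t * \<theta> i) \<in> O[F](\<lambda>_. 1)"
proof (rule bigo_ev_eq)
  have "((\<lambda>t. 1 / x i t) \<longlongrightarrow> 1 / 1) F" by (intro tendsto_intros x_i_tendsto) simp
  then have "(\<lambda>t. 1 / x i t) \<in> O[F](\<lambda>_. 1)" by (intro bigoI_tendsto[where c = 1]) auto
  then show "(\<lambda>t. (lam t - s t * \<theta> i) * x i t * (1 / x i t)) \<in> O[F](\<lambda>_. 1)"
    by (rule bigo_mult_const[OF gap_bigo[OF i]])
  show "eventually (\<lambda>t. lam t - s t * \<theta> i = (lam t - s t * \<theta> i) * x i t * (1 / x i t)) F"
    using tendsto_imp_eventually_ne[OF x_i_tendsto, of 0] by (auto elim!: eventually_mono)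
qed

lemma neg_lam_error: "(\<lambda>t. - (lam t - s t * \<theta> i)) \<in> O[F](\<lambda>_. 1)"
  using lam_error by (simp only: landau_o.big.uminus_in_iff)

text \<open>Subtracting \<open>lam_minus_energy\<close> from \<open>lam_error\<close> isolates s
  \<theta>_i (x_i^2 - 1) up to sign. This is O(1), and x_i^2 - 1 has the factor 1 + x_i, which stays
  away from zero.\<close>

lemma x_i_error: "(\<lambda>t. x i t - 1) \<in> O[F](\<lambda>t. 1 / s t)"
proof (rule bigo_ev_eq)
  let ?d = "\<lambda>t. (lam t - s t * \<theta> i) - (lam t - s t * \<theta> i * (x i t)\<^sup>2)"
  have "((\<lambda>t. 1 / (1 + x i t) * (1 / \<theta> i)) \<longlongrightarrow> 1 / (1 + 1) * (1 / \<theta> i)) F"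
    using \<theta>_pos[OF i] by (intro tendsto_intros x_i_tendsto) auto
  then have "(\<lambda>t. 1 / (1 + x i t) * (1 / \<theta> i)) \<in> O[F](\<lambda>_. 1)"
    by (intro bigoI_tendsto[where c = "1 / (1 + 1) * (1 / \<theta> i)"]) auto
  then have "(\<lambda>t. 1 / (1 + x i t) * (1 / \<theta> i) * ?d t) \<in> O[F](\<lambda>_. 1)"
    by (rule bigo_mult_const) (intro sum_in_bigo lam_error lam_minus_energy)
  then show "(\<lambda>t. 1 / (1 + x i t) * (1 / \<theta> i) * ?d t * (1 / s t)) \<in> O[F](\<lambda>t. 1 / s t)"
    by (rule bigo_mult_const) simp
  show "eventually (\<lambda>t. x i t - 1 = 1 / (1 + x i t) * (1 / \<theta> i) * ?d t * (1 / s t)) F"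
    using s_pos x_nonneg
  proof eventually_elim
    case (elim t)
    then have *: "1 + x i t \<noteq> 0" "s t \<noteq> 0" "\<theta> i \<noteq> 0" using \<theta>_pos[OF i] by auto
    have "?d t = (1 + x i t) * \<theta> i * s t * (x i t - 1)" by (simp add: algebra_simps power2_eq_square)
    with * show ?case by simp
  qed
qed

definition main_term :: "nat \<Rightarrow> 'b \<Rightarrow> real" where
  "main_term j t = 1 / (\<theta> i - \<theta> j) * (\<theta> i * (1 / lam t) * B1 j i t + s t powi (-2) * (1 / \<theta> i) * m2 j t)"

text \<open>The error budget for the gap times the coordinate: \<epsilon> comes from the Gram
  matrix, whose error 1/n is multiplied by s; 1/s from the remainder, the cubic form and products of
  two small quantities; 1/sqrt n from the fluctuation of the quadratic form in W^2.\<close>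

definition err :: "'b \<Rightarrow> real" where
  "err t = \<epsilon> t + 1 / s t + 1 / sqrt (n t)"

text \<open>The leading part of the gap times the coordinate. Dividing it by s (\<theta>_i -
  \<theta>_j), the limiting form of the gap, gives exactly \<open>main_term\<close>.\<close>

definition Y :: "nat \<Rightarrow> 'b \<Rightarrow> real" where
  "Y j t = s t * \<theta> i * (B1 j i t * (1 / lam t) + m2 j t * (1 / (s t * \<theta> i))\<^sup>2)"

lemma err_bigo: "\<epsilon> \<in> O[F](err)" "(\<lambda>t. 1 / s t) \<in> O[F](err)" "(\<lambda>t. 1 / sqrt (n t)) \<in> O[F](err)"
  using pos by (auto intro!: bigoI[where c = 1] elim!: eventually_mono simp: err_def)

lemma inv_s_theta: "(\<lambda>t. 1 / (s t * \<theta> i)) \<in> O[F](\<lambda>t. 1 / s t)"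
  using \<theta>_pos[OF i] by (simp add: divide_inverse)

lemma Y_bigo: "j \<in> {1..k} \<Longrightarrow> Y j \<in> O[F](\<lambda>_. 1)"
proof -
  assume j: "j \<in> {1..k}"
  have "(\<lambda>t. m2 j t * (1 / (s t * \<theta> i))\<^sup>2) \<in> O[F](\<lambda>t. 1 / s t)"
    by (rule bigo_mult_to[OF m2[OF j] landau_o.big_power[OF inv_s_theta]])
      (use s_pos in \<open>auto elim!: eventually_mono simp: power2_eq_square\<close>)
  then have "(\<lambda>t. \<theta> i * (B1 j i t * (1 / lam t) + m2 j t * (1 / (s t * \<theta> i))\<^sup>2)) \<in> O[F](\<lambda>t. 1 / s t)"
    by (intro bigo_mult_const[of "\<lambda>_. \<theta> i"] sum_in_bigo B1_lam[OF j i]) auto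
  from s_times1[OF this] show ?thesis unfolding Y_def by (simp add: mult.assoc)
qed

text \<open>The second term of the claim carries s \<theta>_i where the expansion produces
  \<lambda>. The difference of squares contains the factor \<lambda> - s \<theta>_i = O(1), which
  gains one power of 1/s.\<close>

lemma inv_lam_sq_error: "(\<lambda>t. (1 / lam t)\<^sup>2 - (1 / (s t * \<theta> i))\<^sup>2) \<in> O[F](\<lambda>t. (1 / s t) ^ 3)"
proof (rule bigo_ev_eq)
  have "(\<lambda>t. 1 / lam t * (1 / (s t * \<theta> i))) \<in> O[F](\<lambda>t. (1 / s t)\<^sup>2)"
    by (rule bigo_mult_to[OF inv_lam inv_s_theta]) (simp add: power2_eq_square)
  moreover have "(\<lambda>t. 1 / lam t + 1 / (s t * \<theta> i)) \<in> O[F](\<lambda>t. 1 / s t)"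
    by (intro sum_in_bigo inv_lam inv_s_theta)
  ultimately have "(\<lambda>t. 1 / lam t * (1 / (s t * \<theta> i)) * (1 / lam t + 1 / (s t * \<theta> i))) \<in> O[F](\<lambda>t. (1 / s t) ^ 3)"
    by (rule bigo_mult_to) (simp add: power3_eq_cube power2_eq_square)
  then show "(\<lambda>t. (- (lam t - s t * \<theta> i)) * (1 / lam t * (1 / (s t * \<theta> i)) * (1 / lam t + 1 / (s t * \<theta> i)))) \<in> O[F](\<lambda>t. (1 / s t) ^ 3)"
    by (rule bigo_mult_const[OF neg_lam_error])
  show "eventually (\<lambda>t. (1 / lam t)\<^sup>2 - (1 / (s t * \<theta> i))\<^sup>2 =
      (- (lam t - s t * \<theta> i)) * (1 / lam t * (1 / (s t * \<theta> i)) * (1 / lam t + 1 / (s t * \<theta> i)))) F"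
    using s_pos lam_pos
  proof eventually_elim
    case (elim t)
    then have "lam t \<noteq> 0" "s t \<noteq> 0" "\<theta> i \<noteq> 0" using \<theta>_pos[OF i] by auto
    then show ?case by (simp add: field_simps power2_eq_square)
  qed
qed

lemma gap_Y:
  assumes j: "j \<in> {1..k}" "j \<noteq> i"
  shows "(\<lambda>t. (lam t - s t * \<theta> j) * x j t - Y j t) \<in> O[F](err)"
proof (rule bigo_ev_eq)
  \<comment> \<open>The six errors: \<open>?a\<close> the coordinates other than i,
    \<open>?b\<close> the Gram entry and the cubic form, \<open>?c\<close> replacing the coordinate
    i by 1, \<open>?d\<close> replacing the form in W^2 by its mean, \<open>?e\<close> replacing
    \<lambda> by s \<theta>_i, and \<open>?f\<close> the remainder.\<close>
  let ?a = "\<lambda>t. s t * (\<Sum>l\<in>{1..k} - {i}. \<theta> l * x l t * E j l t)"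
  let ?b = "\<lambda>t. s t * (\<theta> i * x i t * (g j i t + B3 j i t * (1 / lam t) ^ 3))"
  let ?c = "\<lambda>t. s t * (\<theta> i * ((x i t - 1) * (B1 j i t * (1 / lam t) + B2 j i t * (1 / lam t)\<^sup>2)))"
  let ?d = "\<lambda>t. s t * (\<theta> i * ((B2 j i t - m2 j t) * (1 / lam t)\<^sup>2))"
  let ?e = "\<lambda>t. s t * (\<theta> i * (m2 j t * ((1 / lam t)\<^sup>2 - (1 / (s t * \<theta> i))\<^sup>2)))"
  let ?f = "\<lambda>t. R j t * (1 / lam t) ^ 3"
  show "eventually (\<lambda>t. (lam t - s t * \<theta> j) * x j t - Y j t = ?a t + ?b t + ?c t + ?d t + ?e t + ?f t) F"
    using gap_equation[OF j(1)]
  proof eventually_elim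
    case (elim t)
    have "(\<Sum>l=1..k. \<theta> l * x l t * E j l t) = \<theta> i * x i t * E j i t + (\<Sum>l\<in>{1..k} - {i}. \<theta> l * x l t * E j l t)"
      using i by (intro sum.remove) auto
    moreover define u where "u = 1 / lam t"
    ultimately show ?case
      unfolding elim Y_def E_def[of j i] u_def[symmetric] using j
      by (simp add: algebra_simps power_divide flip: u_def)
  qed
  have a: "?a \<in> O[F](err)"
  proof (intro landau_o.big_trans[OF _ err_bigo(2)] s_times big_sum_in_bigo)
    fix l assume l: "l \<in> {1..k} - {i}"
    show "(\<lambda>t. \<theta> l * x l t * E j l t) \<in> O[F](\<lambda>t. 1 / s t * (1 / s t))"
      by (rule bigo_mult_to[OF _ E_bigo]) (use x_small[of l] l j in auto)
  qed
  have b: "?b \<in> O[F](err)"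
  proof (intro s_times)
    have "(\<lambda>t. 1 / n t) \<in> O[F](\<lambda>t. 1 / s t * err t)"
      by (rule bigo_ev_eq[OF bigo_mult_to[OF landau_o.big_refl[of "\<lambda>t. 1 / s t"] err_bigo(1)]])
        (use pos in \<open>auto elim!: eventually_mono\<close>)
    then have "g j i \<in> O[F](\<lambda>t. 1 / s t * err t)"
      using landau_o.big_trans[OF g[OF j(1) i]] j(2) by simp
    moreover have "(\<lambda>t. (1 / s t)\<^sup>2) \<in> O[F](\<lambda>t. 1 / s t * err t)"
      unfolding power2_eq_square by (intro bigo_mult_to[OF landau_o.big_refl err_bigo(2)]) auto
    ultimately have "(\<lambda>t. g j i t + B3 j i t * (1 / lam t) ^ 3) \<in> O[F](\<lambda>t. 1 / s t * err t)"
      by (intro sum_in_bigo landau_o.big_trans[OF B3_lam[OF j(1) i]])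
    then show "(\<lambda>t. \<theta> i * x i t * (g j i t + B3 j i t * (1 / lam t) ^ 3)) \<in> O[F](\<lambda>t. 1 / s t * err t)"
      by (rule bigo_mult_const[rotated]) (use x_bdd[OF i] in auto)
  qed
  have c: "?c \<in> O[F](err)"
  proof (intro landau_o.big_trans[OF _ err_bigo(2)] s_times)
    have "(\<lambda>t. (x i t - 1) * (B1 j i t * (1 / lam t) + B2 j i t * (1 / lam t)\<^sup>2)) \<in> O[F](\<lambda>t. 1 / s t * (1 / s t))"
      by (intro landau_o.big.mult x_i_error sum_in_bigo B1_lam B2_lam B2 j i)
    then show "(\<lambda>t. \<theta> i * ((x i t - 1) * (B1 j i t * (1 / lam t) + B2 j i t * (1 / lam t)\<^sup>2))) \<in> O[F](\<lambda>t. 1 / s t * (1 / s t))"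
      by (rule bigo_mult_const[rotated]) simp
  qed
  have d: "?d \<in> O[F](err)"
  proof (intro landau_o.big_trans[OF _ err_bigo(3)] s_times)
    have "(\<lambda>t. (B2 j i t - m2 j t) * (1 / lam t)\<^sup>2) \<in> O[F](\<lambda>t. 1 / s t * (1 / sqrt (n t)))"
      by (rule bigo_mult_to[OF B2_m2[OF j(1)] inv_lam_power])
        (use s_pos in \<open>auto elim!: eventually_mono simp: power2_eq_square\<close>)
    then show "(\<lambda>t. \<theta> i * ((B2 j i t - m2 j t) * (1 / lam t)\<^sup>2)) \<in> O[F](\<lambda>t. 1 / s t * (1 / sqrt (n t)))"
      by (rule bigo_mult_const[rotated]) simp
  qed
  have e: "?e \<in> O[F](err)"
  proof (intro landau_o.big_trans[OF _ err_bigo(2)] s_times)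
    have "(\<lambda>t. m2 j t * ((1 / lam t)\<^sup>2 - (1 / (s t * \<theta> i))\<^sup>2)) \<in> O[F](\<lambda>t. 1 / s t * (1 / s t))"
      by (rule bigo_mult_to[OF m2[OF j(1)] inv_lam_sq_error])
        (use s_pos in \<open>auto elim!: eventually_mono simp: power3_eq_cube\<close>)
    then show "(\<lambda>t. \<theta> i * (m2 j t * ((1 / lam t)\<^sup>2 - (1 / (s t * \<theta> i))\<^sup>2))) \<in> O[F](\<lambda>t. 1 / s t * (1 / s t))"
      by (rule bigo_mult_const[rotated]) simp
  qed
  have f: "?f \<in> O[F](err)" by (rule landau_o.big_trans[OF R_lam[OF j(1)] err_bigo(2)])
  show "(\<lambda>t. ?a t + ?b t + ?c t + ?d t + ?e t + ?f t) \<in> O[F](err)"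
    by (intro sum_in_bigo a b c d e f)
qed

lemma main_error:
  assumes j: "j \<in> {1..k}" "j \<noteq> i"
  shows "(\<lambda>t. x j t - main_term j t) \<in> O[F](\<lambda>t. err t / s t)"
proof (rule bigo_ev_eq)
  let ?D = "\<lambda>t. lam t - s t * \<theta> j" and ?G = "\<lambda>t. s t * (\<theta> i - \<theta> j)"
  have ne: "\<theta> i - \<theta> j \<noteq> 0" using \<theta>_simple[OF j] by simp
  have D0: "(\<lambda>t. 1 / ?G t) \<in> O[F](\<lambda>t. 1 / s t)"
    using ne by (simp add: divide_inverse)
  \<comment> \<open>\<open>?a\<close> is the error of \<open>gap_Y\<close> divided by the true gap.
    \<open>?b\<close> accounts for replacing the true gap by s (\<theta>_i - \<theta>_j); the two
    differ by \<lambda> - s \<theta>_i = O(1), so their reciprocals differ by O(1/s^2).\<close>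
  let ?a = "\<lambda>t. (?D t * x j t - Y j t) * (1 / ?D t)"
  let ?b = "\<lambda>t. Y j t * ((- (lam t - s t * \<theta> i)) * (1 / ?D t * (1 / ?G t)))"
  have "?a \<in> O[F](\<lambda>t. err t / s t)"
    by (rule bigo_mult_to[OF gap_Y[OF j] inv_gap[OF j]]) simp
  moreover have "?b \<in> O[F](\<lambda>t. err t / s t)"
  proof (rule bigo_mult_const[OF Y_bigo[OF j(1)] bigo_mult_const[OF neg_lam_error]])
    have "(\<lambda>t. 1 / s t * (1 / s t)) \<in> O[F](\<lambda>t. err t / s t)"
      by (rule bigo_mult_to[OF err_bigo(2) landau_o.big_refl]) simp
    then show "(\<lambda>t. 1 / ?D t * (1 / ?G t)) \<in> O[F](\<lambda>t. err t / s t)"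
      by (rule landau_o.big_trans[OF landau_o.big.mult[OF inv_gap[OF j] D0]])
  qed
  ultimately show "(\<lambda>t. ?a t + ?b t) \<in> O[F](\<lambda>t. err t / s t)" by (rule sum_in_bigo)
  have "eventually (\<lambda>t. ?D t / s t \<noteq> 0) F"
    using tendsto_imp_eventually_ne[OF gap_tendsto, of "\<theta> j" 0] ne by auto
  then show "eventually (\<lambda>t. x j t - main_term j t = ?a t + ?b t) F"
    using s_pos lam_pos
  proof eventually_elim
    case (elim t)
    then have D: "?D t \<noteq> 0" "s t \<noteq> 0" "?G t \<noteq> 0" using ne by auto
    have \<theta>i: "\<theta> i \<noteq> 0" using \<theta>_pos[OF i] by simp
    have main: "main_term j t = Y j t * (1 / ?G t)"
      unfolding main_term_def Y_def using D ne \<theta>i elim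
      by (simp add: field_simps power2_eq_square power_int_minus)
    have inv: "1 / ?D t - 1 / ?G t = - (lam t - s t * \<theta> i) * (1 / ?D t * (1 / ?G t))"
      using D by (simp add: divide_simps) (simp add: algebra_simps)
    have split: "(d * c - y) * p + y * (p - r) = d * c * p - y * r" for d c y p r :: real
      by (simp add: algebra_simps)
    have "?D t * x j t * (1 / ?D t) = x j t" using D by simp
    then show ?case unfolding main inv[symmetric] split by simp
  qed
qed

text \<open>The product is \<open>err\<close> divided by sqrt \<epsilon>, that is sqrt \<epsilon> +
  (n^(-2/3)/\<epsilon>)^(3/2) + s^(-1/2). The three terms vanish by the upper bound on \<epsilon>,
  by its lower bound, and by s tending to infinity.\<close>

lemma err_tendsto: "((\<lambda>t. err t / s t * (n t * sqrt (\<epsilon> t))) \<longlongrightarrow> 0) F"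
proof (rule Lim_transform_eventually)
  let ?q = "\<lambda>t. n t powr (-2/3) / \<epsilon> t"
  have "((\<lambda>t. sqrt (\<epsilon> t) + ?q t powr (3/2) + sqrt (1 / s t)) \<longlongrightarrow> sqrt 0 + 0 powr (3/2) + sqrt 0) F"
    using pos
    by (intro tendsto_add tendsto_real_sqrt tendsto_powr2 eps_small eps_large s_large tendsto_const)
      (auto elim!: eventually_mono)
  then show "((\<lambda>t. sqrt (\<epsilon> t) + ?q t powr (3/2) + sqrt (1 / s t)) \<longlongrightarrow> 0) F" by simp
  show "eventually (\<lambda>t. sqrt (\<epsilon> t) + ?q t powr (3/2) + sqrt (1 / s t) = err t / s t * (n t * sqrt (\<epsilon> t))) F"
    using pos
  proof eventually_elim
    case (elim t)
    define a b where "a = sqrt (n t)" and "b = sqrt (\<epsilon> t)"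
    have ab: "a > 0" "b > 0" "n t = a\<^sup>2" "\<epsilon> t = b\<^sup>2" using elim by (auto simp: a_def b_def)
    have "?q t powr (3/2) = n t powr (-1) / \<epsilon> t powr (3/2)"
      using elim by (simp add: powr_divide powr_powr)
    also have "\<epsilon> t powr (3/2) = b ^ 3"
      unfolding ab(4) using ab(2) by (simp add: powr_powr flip: powr_numeral powr_realpow)
    finally have q: "?q t powr (3/2) = 1 / (a\<^sup>2 * b ^ 3)"
      using elim ab by (simp add: powr_minus_divide)
    have "s t = a\<^sup>2 * b\<^sup>2" using elim ab by simp
    moreover have "sqrt (a\<^sup>2 * b\<^sup>2) = a * b" using ab by (simp add: real_sqrt_mult)
    ultimately show ?case
      unfolding err_def q using ab
      by (simp add: real_sqrt_divide flip: a_def b_def) (simp add: field_simps power2_eq_square power3_eq_cube)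
  qed
qed

theorem coordinate_error:
  assumes j: "j \<in> {1..k}" "j \<noteq> i"
  shows "((\<lambda>t. (x j t - main_term j t) * (n t * sqrt (\<epsilon> t))) \<longlongrightarrow> 0) F"
proof (rule bigo_tendsto_zero)
  show "(\<lambda>t. (x j t - main_term j t) * (n t * sqrt (\<epsilon> t))) \<in> O[F](\<lambda>t. err t / s t * (n t * sqrt (\<epsilon> t)))"
    by (rule landau_o.big.mult[OF main_error[OF j] landau_o.big_refl])
qed (rule err_tendsto)

end

section \<open>Discretisation\<close>

text \<open>Position \<open>a\<close> samples the right endpoint of its cell. On a cell of length
  1/N a Lipschitz function varies by at most L/N, so each cell errs by at most L/N^2.\<close>

lemma riemann_sum_lipschitz:
  fixes h :: "real \<Rightarrow> real"
  assumes lip: "\<And>x y. x \<in> {0..1} \<Longrightarrow> y \<in> {0..1} \<Longrightarrow> \<bar>h x - h y\<bar> \<le> L * \<bar>x - y\<bar>" and "N > 0"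
  shows "\<bar>(\<Sum>a<N. h (grid N a)) / N - (\<integral>x. h x \<partial>lebesgue_on {0..1})\<bar> \<le> L / N"
proof -
  have L: "0 \<le> L" using lip[of 0 1] by simp
  have "L-lipschitz_on {0..1} h"
    using lip L by (intro lipschitz_onI) (auto simp: dist_real_def)
  then have cont: "continuous_on {0..1} h" by (rule lipschitz_on_continuous_on)
  have "(\<integral>x. h x \<partial>lebesgue_on {0..1}) = integral {0..1} h"
    using absolutely_integrable_continuous_real[OF cont]
    by (intro lebesgue_integral_eq_integral absolutely_integrable_imp_integrable) auto
  moreover have sub: "{real a / N..real b / N} \<subseteq> {0..1}" if "b \<le> N" for a b
  proof
    fix x assume x: "x \<in> {real a / N..real b / N}"
    have "0 \<le> real a / N" by simp
    moreover have "real b / N \<le> 1" using that \<open>N > 0\<close> by simp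
    moreover have "real a / N \<le> x" "x \<le> real b / N" using x by auto
    ultimately have "0 \<le> x" "x \<le> 1" by linarith+
    then show "x \<in> {0..1}" by simp
  qed
  have "integral {0..real m / N} h = (\<Sum>a<m. integral {real a / N..real (a + 1) / N} h)" if "m \<le> N" for m
    using that
  proof (induction m)
    case (Suc m)
    have "integral {0..real m / N} h + integral {real m / N..real (Suc m) / N} h = integral {0..real (Suc m) / N} h"
    proof (rule Henstock_Kurzweil_Integration.integral_combine)
      show "h integrable_on {0..real (Suc m) / N}"
        using sub[of "Suc m" 0] Suc.prems
        by (intro integrable_continuous_real continuous_on_subset[OF cont]) simp
    qed (use \<open>N > 0\<close> in \<open>auto simp: divide_right_mono\<close>)
    then show ?case using Suc by simp
  qed simp
  from this[of N] have "integral {0..1} h = (\<Sum>a<N. integral {real a / N..real (a + 1) / N} h)"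
    using \<open>N > 0\<close> by simp
  moreover have "\<bar>h (grid N a) / N - integral {real a / N..real (a + 1) / N} h\<bar> \<le> L / N / N" if a: "a < N" for a
  proof -
    define u w where "u = real a / N" and "w = real (a + 1) / N"
    have J: "{u..w} \<subseteq> {0..1}" using sub[of "a + 1" a] a by (simp add: u_def w_def)
    have len: "w - u = 1 / N" unfolding u_def w_def by (simp add: diff_divide_distrib[symmetric])
    have "u \<le> w" unfolding u_def w_def by (simp add: divide_right_mono)
    have gJ: "grid N a = w" by (simp add: grid_def w_def)
    have wJ: "w \<in> {u..w}" using \<open>u \<le> w\<close> by simp
    have int: "h integrable_on {u..w}"
      using continuous_on_subset[OF cont J] by (rule integrable_continuous_real)
    have "integral {u..w} (\<lambda>x. h w - h x) = integral {u..w} (\<lambda>_. h w) - integral {u..w} h"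
      using int by (intro Henstock_Kurzweil_Integration.integral_diff) auto
    also have "integral {u..w} (\<lambda>_. h w) = h w / N"
      using \<open>u \<le> w\<close> len by simp
    finally have "h w / N - integral {u..w} h = integral {u..w} (\<lambda>x. h w - h x)" by simp
    also have "norm \<dots> \<le> L / N * (w - u)"
    proof (rule integral_bound)
      show "continuous_on {u..w} (\<lambda>x. h w - h x)"
        using continuous_on_subset[OF cont J] by (intro continuous_intros)
      fix x assume x: "x \<in> {u..w}"
      have "\<bar>h w - h x\<bar> \<le> L * \<bar>w - x\<bar>" using subsetD[OF J x] subsetD[OF J wJ] by (intro lip) auto
      also have "\<dots> \<le> L * (1 / N)"
        using x len L by (intro mult_left_mono) auto
      finally show "norm (h w - h x) \<le> L / N" by simp
    qed (rule \<open>u \<le> w\<close>)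
    also have "\<dots> = L / N / N" unfolding len by simp
    finally show ?thesis unfolding gJ by (simp add: u_def w_def)
  qed
  ultimately have "\<bar>(\<Sum>a<N. h (grid N a)) / N - (\<integral>x. h x \<partial>lebesgue_on {0..1})\<bar> \<le> (\<Sum>a<N. L / N / N)"
    unfolding sum_divide_distrib
    by (simp only: sum_subtractf[symmetric]) (rule order_trans[OF sum_abs sum_mono], auto)
  then show ?thesis using \<open>N > 0\<close> by simp
qed

definition gridfun :: "(real \<Rightarrow> real) \<Rightarrow> nat \<Rightarrow> nat \<Rightarrow> real" where
  "gridfun g N a = real N powr (-1/2) * g (grid N a)"

lemma grid_vec_index: "a < N \<Longrightarrow> grid_vec g N $ a = gridfun g N a"
  by (simp add: grid_vec_def gridfun_def)

lemma grid_in: "a < N \<Longrightarrow> grid N a \<in> {0..1}"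
  by (simp add: grid_def)

lemma gridfun_eq: "N > 0 \<Longrightarrow> gridfun g N a = g (grid N a) / sqrt N"
  by (simp add: gridfun_def powr_minus_divide powr_half_sqrt)

lemma abs_gridfun_le:
  assumes "\<And>x. x \<in> {0..1} \<Longrightarrow> \<bar>g x\<bar> \<le> U" "a < N"
  shows "\<bar>gridfun g N a\<bar> \<le> U / sqrt N"
  using assms grid_in[OF assms(2)] by (auto simp: gridfun_eq abs_divide intro!: divide_right_mono)

lemma lipschitz_family_bounds:
  fixes r :: "nat \<Rightarrow> real \<Rightarrow> real"
  assumes "\<And>j. j \<in> {1..k} \<Longrightarrow> \<exists>L. L-lipschitz_on {0..1} (r j)"
  obtains U L :: real where "0 \<le> U" "0 \<le> L" "\<And>j x. j \<in> {1..k} \<Longrightarrow> x \<in> {0..1} \<Longrightarrow> \<bar>r j x\<bar> \<le> U"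
    "\<And>j x y. j \<in> {1..k} \<Longrightarrow> x \<in> {0..1} \<Longrightarrow> y \<in> {0..1} \<Longrightarrow> \<bar>r j x - r j y\<bar> \<le> L * \<bar>x - y\<bar>"
proof -
  obtain Lf :: "nat \<Rightarrow> real" where Lf: "\<And>j. j \<in> {1..k} \<Longrightarrow> (Lf j)-lipschitz_on {0..1} (r j)" using assms by metis
  have nn: "0 \<le> Lf j" if "j \<in> {1..k}" for j using lipschitz_on_nonneg[OF Lf[OF that]] .
  define L where "L = (\<Sum>j=1..k. Lf j)"
  define U where "U = (\<Sum>j=1..k. \<bar>r j 0\<bar>) + L"
  have Lj: "Lf j \<le> L" if "j \<in> {1..k}" for j
    unfolding L_def using that nn by (intro member_le_sum) auto
  have lip: "\<bar>r j x - r j y\<bar> \<le> L * \<bar>x - y\<bar>" if "j \<in> {1..k}" "x \<in> {0..1}" "y \<in> {0..1}" for j x y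
  proof -
    have "\<bar>r j x - r j y\<bar> \<le> Lf j * \<bar>x - y\<bar>"
      using lipschitz_onD[OF Lf[OF that(1)] that(2,3)] by (simp add: dist_real_def)
    also have "\<dots> \<le> L * \<bar>x - y\<bar>" using Lj[OF that(1)] by (rule mult_right_mono) simp
    finally show ?thesis .
  qed
  have L0: "0 \<le> L" unfolding L_def using nn by (intro sum_nonneg) auto
  have bnd: "\<bar>r j x\<bar> \<le> U" if "j \<in> {1..k}" "x \<in> {0..1}" for j x
  proof -
    have "\<bar>r j 0\<bar> \<le> (\<Sum>j=1..k. \<bar>r j 0\<bar>)" using that by (intro member_le_sum[of j _ "\<lambda>j. \<bar>r j 0\<bar>"]) auto
    moreover have "\<bar>r j x - r j 0\<bar> \<le> L * \<bar>x - 0\<bar>" using that by (intro lip) auto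
    moreover have "L * \<bar>x - 0\<bar> \<le> L * 1" using that L0 by (intro mult_left_mono) auto
    ultimately show ?thesis unfolding U_def by linarith
  qed
  have "0 \<le> U" unfolding U_def using L0 by (simp add: sum_nonneg)
  then show ?thesis using that L0 lip bnd by blast
qed

lemma gridfun_nearly_orthonormal:
  assumes orth: "orthonormal_L2 {1..k} r"
    and bnd: "\<And>j x. j \<in> {1..k} \<Longrightarrow> x \<in> {0..1} \<Longrightarrow> \<bar>r j x\<bar> \<le> U"
    and lip: "\<And>j x y. j \<in> {1..k} \<Longrightarrow> x \<in> {0..1} \<Longrightarrow> y \<in> {0..1} \<Longrightarrow> \<bar>r j x - r j y\<bar> \<le> L * \<bar>x - y\<bar>"
    and N: "N > 0"
  shows "nearly_orthonormal N k (\<lambda>j. gridfun (r j) N) (2 * U * L / N)"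
  unfolding nearly_orthonormal_def
proof (intro ballI)
  fix a b assume ab: "a \<in> {1..k}" "b \<in> {1..k}"
  \<comment> \<open>The Gram entry is a Riemann sum of the product of two functions, whose Lipschitz
    constant is 2 U L by the product rule.\<close>
  have prod_lip: "\<bar>r a x * r b x - r a y * r b y\<bar> \<le> (2 * U * L) * \<bar>x - y\<bar>" if "x \<in> {0..1}" "y \<in> {0..1}" for x y
  proof -
    have "\<bar>r a x * r b x - r a y * r b y\<bar> = \<bar>r a x * (r b x - r b y) + (r a x - r a y) * r b y\<bar>"
      by (simp add: algebra_simps)
    also have "\<dots> \<le> \<bar>r a x\<bar> * \<bar>r b x - r b y\<bar> + \<bar>r a x - r a y\<bar> * \<bar>r b y\<bar>"
      by (metis abs_mult abs_triangle_ineq)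
    also have "\<dots> \<le> U * (L * \<bar>x - y\<bar>) + (L * \<bar>x - y\<bar>) * U"
      using ab that by (intro add_mono mult_mono' bnd lip) auto
    finally show ?thesis by (simp add: algebra_simps)
  qed
  have "ip N (gridfun (r a) N) (gridfun (r b) N) = (\<Sum>m<N. r a (grid N m) * r b (grid N m)) / N"
    unfolding ip_def using N by (simp add: gridfun_eq sum_divide_distrib)
  moreover have "(\<integral>x. r a x * r b x \<partial>lebesgue_on {0..1}) = of_bool (a = b)"
    using orth ab unfolding orthonormal_L2_def by simp
  ultimately show "\<bar>ip N (gridfun (r a) N) (gridfun (r b) N) - of_bool (a = b)\<bar> \<le> 2 * U * L / N"
    using riemann_sum_lipschitz[OF prod_lip N] by simp
qed

section \<open>The eigenvector equation\<close>

lemma ip_scale_left: "ip N (\<lambda>a. c * u a) w = c * ip N u w"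
  by (simp add: ip_def sum_distrib_left mult.assoc)

lemma ip_scale_right: "ip N u (\<lambda>a. c * w a) = c * ip N u w"
  by (simp add: ip_commute[of N u] ip_scale_left)

lemma ip_add_right: "ip N u (\<lambda>a. w a + w' a) = ip N u w + ip N u w'"
  by (simp add: ip_def sum.distrib distrib_left)

text \<open>One outcome at one size: an exact equation of low rank plus noise, with neither
  randomness nor orthonormality of the \<open>e l\<close>. \<open>B\<close> plays the role of
  W.\<close>

locale eigen_equation =
  fixes N k :: nat and B :: "nat \<Rightarrow> nat \<Rightarrow> real" and e :: "nat \<Rightarrow> nat \<Rightarrow> real"
    and \<theta> :: "nat \<Rightarrow> real" and s lam :: real and v :: "nat \<Rightarrow> real"
  assumes sym: "symfun N B"
    and eq: "\<And>a. a < N \<Longrightarrow> lam * v a = s * (\<Sum>l=1..k. \<theta> l * ip N (e l) v * e l a) + mv N B v a"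
    and unit: "ip N v v = 1"
begin

definition q :: "nat \<Rightarrow> nat \<Rightarrow> nat \<Rightarrow> real" where
  "q m j l = ip N (e j) ((mv N B ^^ m) (e l))"

definition c :: "nat \<Rightarrow> real" where
  "c l = ip N (e l) v"

lemma ip_eigen: "lam * ip N u v = s * (\<Sum>l=1..k. \<theta> l * c l * ip N u (e l)) + ip N u (mv N B v)"
proof -
  have "lam * ip N u v = ip N u (\<lambda>a. lam * v a)" by (simp add: ip_scale_right)
  also have "\<dots> = ip N u (\<lambda>a. s * (\<Sum>l=1..k. \<theta> l * c l * e l a) + mv N B v a)"
    using eq by (intro ip_cong) (auto simp: c_def)
  also have "\<dots> = s * (\<Sum>l=1..k. \<theta> l * c l * ip N u (e l)) + ip N u (mv N B v)"
    by (simp add: ip_add_right ip_scale_right ip_sum_right)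
  finally show ?thesis .
qed

lemma ip_power_eigen:
  "lam * ip N (e j) ((mv N B ^^ m) v) =
    s * (\<Sum>l=1..k. \<theta> l * c l * q m j l) + ip N (e j) ((mv N B ^^ (m + 1)) v)"
proof -
  have *: "ip N (e j) ((mv N B ^^ m) w) = ip N ((mv N B ^^ m) (e j)) w" for w
    using ip_mv_power[OF sym, of "e j" m 0 w] by simp
  have "lam * ip N (e j) ((mv N B ^^ m) v) =
      s * (\<Sum>l=1..k. \<theta> l * c l * q m j l) + ip N ((mv N B ^^ m) (e j)) (mv N B v)"
    unfolding * q_def by (rule ip_eigen)
  also have "ip N ((mv N B ^^ m) (e j)) (mv N B v) = ip N (e j) ((mv N B ^^ (m + 1)) v)"
    using ip_mv_power[OF sym, of "e j" m 1 v] by simp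
  finally show ?thesis .
qed

lemma expansion:
  "lam ^ 4 * c j = s * (\<Sum>l=1..k. \<theta> l * c l * (lam ^ 3 * q 0 j l + lam\<^sup>2 * q 1 j l + lam * q 2 j l + q 3 j l))
    + ip N (e j) ((mv N B ^^ 4) v)"
proof -
  have sums: "(\<Sum>l=1..k. \<theta> l * c l * (lam ^ 3 * q 0 j l + lam\<^sup>2 * q 1 j l + lam * q 2 j l + q 3 j l)) =
    lam ^ 3 * (\<Sum>l=1..k. \<theta> l * c l * q 0 j l) + lam\<^sup>2 * (\<Sum>l=1..k. \<theta> l * c l * q 1 j l)
      + lam * (\<Sum>l=1..k. \<theta> l * c l * q 2 j l) + (\<Sum>l=1..k. \<theta> l * c l * q 3 j l)"
    by (simp add: sum_distrib_left sum.distrib algebra_simps)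
  have [simp]: "0 + 1 = (1::nat)" "1 + 1 = (2::nat)" "2 + 1 = (3::nat)" "3 + 1 = (4::nat)" by simp_all
  note step = ip_power_eigen[of j 0] ip_power_eigen[of j 1] ip_power_eigen[of j 2] ip_power_eigen[of j 3]
  have "lam ^ 4 * c j = lam ^ 3 * (lam * ip N (e j) ((mv N B ^^ 0) v))"
    by (simp add: c_def power4_eq_xxxx power3_eq_cube)
  also have "\<dots> = lam ^ 3 * (s * (\<Sum>l=1..k. \<theta> l * c l * q 0 j l)) + lam\<^sup>2 * (lam * ip N (e j) ((mv N B ^^ 1) v))"
    unfolding step(1) by (simp add: algebra_simps power2_eq_square power3_eq_cube)
  also have "lam * ip N (e j) ((mv N B ^^ 1) v) = s * (\<Sum>l=1..k. \<theta> l * c l * q 1 j l) + ip N (e j) ((mv N B ^^ 2) v)"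
    using step(2) by (simp add: numeral_2_eq_2)
  also have "lam\<^sup>2 * \<dots> = lam\<^sup>2 * (s * (\<Sum>l=1..k. \<theta> l * c l * q 1 j l)) + lam * (lam * ip N (e j) ((mv N B ^^ 2) v))"
    by (simp add: distrib_left power2_eq_square)
  also have "lam * ip N (e j) ((mv N B ^^ 2) v) = s * (\<Sum>l=1..k. \<theta> l * c l * q 2 j l) + ip N (e j) ((mv N B ^^ 3) v)"
    using step(3) by simp
  also have "lam * \<dots> = lam * (s * (\<Sum>l=1..k. \<theta> l * c l * q 2 j l)) + lam * ip N (e j) ((mv N B ^^ 3) v)"
    by (simp add: distrib_left)
  also have "lam * ip N (e j) ((mv N B ^^ 3) v) = s * (\<Sum>l=1..k. \<theta> l * c l * q 3 j l) + ip N (e j) ((mv N B ^^ 4) v)"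
    using step(4) by simp
  finally show ?thesis unfolding sums by (simp add: algebra_simps)
qed

lemma remainder_le: "(ip N (e j) ((mv N B ^^ 4) v))\<^sup>2 \<le> q 8 j j"
proof -
  have "ip N (e j) ((mv N B ^^ 4) v) = ip N ((mv N B ^^ 4) (e j)) v"
    using ip_mv_power[OF sym, of "e j" 4 0 v] by simp
  moreover have "q 8 j j = ip N ((mv N B ^^ 4) (e j)) ((mv N B ^^ 4) (e j))"
    unfolding q_def using ip_mv_power[OF sym, of "e j" 4 4 "e j"] by simp
  ultimately show ?thesis using ip_cauchy_schwarz[of N "(mv N B ^^ 4) (e j)" v] unit by simp
qed

lemma energy:
  "lam * (lam - s * (\<Sum>l=1..k. \<theta> l * (c l)\<^sup>2)) =
    s * (\<Sum>l=1..k. \<theta> l * c l * (lam * c l - s * (\<Sum>m=1..k. \<theta> m * c m * q 0 l m)))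
      + ip N (mv N B v) (mv N B v)"
proof -
  have Wv: "ip N (mv N B v) (e l) = lam * c l - s * (\<Sum>m=1..k. \<theta> m * c m * q 0 l m)" for l
    using ip_power_eigen[of l 0] by (simp add: c_def ip_commute[of N "mv N B v"])
  have "lam = s * (\<Sum>l=1..k. \<theta> l * (c l)\<^sup>2) + ip N v (mv N B v)"
    using ip_eigen[of v] unit by (simp add: c_def ip_commute[of N v "e _"] power2_eq_square mult.assoc)
  then have "lam * (lam - s * (\<Sum>l=1..k. \<theta> l * (c l)\<^sup>2)) = lam * ip N (mv N B v) v"
    by (simp add: ip_commute[of N "mv N B v" v])
  also have "\<dots> = s * (\<Sum>l=1..k. \<theta> l * c l * ip N (mv N B v) (e l)) + ip N (mv N B v) (mv N B v)"
    by (rule ip_eigen)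
  finally show ?thesis unfolding Wv .
qed

lemma coordinate_le: "(c l)\<^sup>2 \<le> q 0 l l"
  using ip_cauchy_schwarz[of N "e l" v] unit by (simp add: c_def q_def)

text \<open>Applying W to the equation gives \<lambda> W v = s (sum of \<theta>_l c_l W e_l) + W^2
  v. The last term is at most half of the left side in norm and is absorbed; what remains involves
  only |W e_l|^2 = e_l' W^2 e_l, of the better order s.\<close>

lemma norm_Wv_le:
  assumes \<eta>: "ip N (mv N B (mv N B v)) (mv N B (mv N B v)) \<le> \<eta>\<^sup>2 * ip N (mv N B v) (mv N B v)"
    and small: "4 * \<eta>\<^sup>2 \<le> lam\<^sup>2"
  shows "lam\<^sup>2 * ip N (mv N B v) (mv N B v) \<le> 4 * s\<^sup>2 * real k * (\<Sum>l=1..k. (\<theta> l * c l)\<^sup>2 * q 2 l l)"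
proof -
  define p where "p = (\<lambda>a. \<Sum>l=1..k. (\<theta> l * c l) * mv N B (e l) a)"
  define w where "w = mv N B (mv N B v)"
  define z where "z = ip N (mv N B v) (mv N B v)"
  have lamWv: "lam * mv N B v a = s * p a + w a" if "a < N" for a
  proof -
    have "lam * mv N B v a = mv N B (\<lambda>a. lam * v a) a"
      by (simp add: mv_def sum_distrib_left mult_ac)
    also have "mv N B (\<lambda>a. lam * v a) = mv N B (\<lambda>a. s * (\<Sum>l=1..k. (\<theta> l * c l) * e l a) + mv N B v a)"
      using eq by (intro mv_cong) (auto simp: c_def)
    also have "\<dots> = (\<lambda>a. s * mv N B (\<lambda>a. \<Sum>l=1..k. (\<theta> l * c l) * e l a) a + w a)"
      unfolding mv_def w_def by (simp add: sum_distrib_left sum.distrib algebra_simps)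
    finally show ?thesis unfolding mv_sum p_def .
  qed
  have "lam\<^sup>2 * z = ip N (\<lambda>a. lam * mv N B v a) (\<lambda>a. lam * mv N B v a)"
    unfolding z_def by (simp add: ip_scale_left ip_scale_right power2_eq_square)
  also have "\<dots> = (\<Sum>a<N. (s * p a + w a)\<^sup>2)"
    unfolding ip_def using lamWv by (simp add: power2_eq_square)
  also have "\<dots> \<le> (\<Sum>a<N. 2 * s\<^sup>2 * (p a)\<^sup>2 + 2 * (w a)\<^sup>2)"
  proof (intro sum_mono)
    fix a
    have "0 \<le> (s * p a - w a)\<^sup>2" by simp
    then show "(s * p a + w a)\<^sup>2 \<le> 2 * s\<^sup>2 * (p a)\<^sup>2 + 2 * (w a)\<^sup>2"
      by (simp add: power2_eq_square algebra_simps)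
  qed
  also have "\<dots> = 2 * s\<^sup>2 * (\<Sum>a<N. (p a)\<^sup>2) + 2 * ip N w w"
    by (simp add: ip_def sum.distrib sum_distrib_left power2_eq_square)
  finally have 1: "lam\<^sup>2 * z \<le> 2 * s\<^sup>2 * (\<Sum>a<N. (p a)\<^sup>2) + 2 * ip N w w" .
  \<comment> \<open>The condition 4 \<eta>^2 \<le> \<lambda>^2 bounds this term by half of the left
    side; moving it over turns the constant 2 into 4.\<close>
  have "2 * ip N w w \<le> 2 * (\<eta>\<^sup>2 * z)" using \<eta> by (simp add: w_def z_def)
  also have "\<dots> \<le> lam\<^sup>2 * z / 2"
    using mult_right_mono[OF small, of z] by (simp add: z_def)
  finally have 2: "lam\<^sup>2 * z \<le> 4 * s\<^sup>2 * (\<Sum>a<N. (p a)\<^sup>2)" using 1 by simp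
  have q2: "(\<Sum>a<N. (mv N B (e l) a)\<^sup>2) = q 2 l l" for l
    using ip_mv_power[OF sym, of "e l" 1 1 "e l"]
    by (simp add: q_def ip_def power2_eq_square numeral_2_eq_2)
  have "(\<Sum>a<N. (p a)\<^sup>2) \<le> (\<Sum>a<N. real k * (\<Sum>l=1..k. (\<theta> l * c l)\<^sup>2 * (mv N B (e l) a)\<^sup>2))"
  proof (intro sum_mono)
    fix a
    have "(p a)\<^sup>2 \<le> (\<Sum>l=1..k. 1\<^sup>2) * (\<Sum>l=1..k. (\<theta> l * c l * mv N B (e l) a)\<^sup>2)"
      unfolding p_def using Cauchy_Schwarz_ineq_sum[of "\<lambda>_. 1" "\<lambda>l. \<theta> l * c l * mv N B (e l) a" "{1..k}"] by simp
    then show "(p a)\<^sup>2 \<le> real k * (\<Sum>l=1..k. (\<theta> l * c l)\<^sup>2 * (mv N B (e l) a)\<^sup>2)"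
      by (simp add: power_mult_distrib)
  qed
  also have "\<dots> = real k * (\<Sum>l=1..k. (\<theta> l * c l)\<^sup>2 * (\<Sum>a<N. (mv N B (e l) a)\<^sup>2))"
    unfolding sum_distrib_left by (subst sum.swap) (rule refl)
  finally have "(\<Sum>a<N. (p a)\<^sup>2) \<le> real k * (\<Sum>l=1..k. (\<theta> l * c l)\<^sup>2 * q 2 l l)"
    unfolding q2 .
  then have "4 * s\<^sup>2 * (\<Sum>a<N. (p a)\<^sup>2) \<le> 4 * s\<^sup>2 * (real k * (\<Sum>l=1..k. (\<theta> l * c l)\<^sup>2 * q 2 l l))"
    by (intro mult_left_mono) auto
  with 2 show ?thesis by (simp add: z_def mult.assoc)
qed

end

section \<open>Moments of a Bernoulli entry\<close>

lemma (in prob_space) bernoulli_variable: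
  assumes X [measurable]: "X \<in> borel_measurable M"
    and distr: "distr M borel X = distr (measure_pmf (bernoulli_pmf p)) borel of_bool"
    and p: "0 \<le> p" "p \<le> 1"
  shows "AE \<omega> in M. X \<omega> = 0 \<or> X \<omega> = 1" "expectation X = p"
    "expectation (\<lambda>\<omega>. (X \<omega> - p)\<^sup>2) = p * (1 - p)"
proof -
  have integral: "expectation (\<lambda>\<omega>. f (X \<omega>)) = f 1 * p + f 0 * (1 - p)"
    if [measurable]: "f \<in> borel_measurable borel" for f :: "real \<Rightarrow> real"
  proof -
    have "expectation (\<lambda>\<omega>. f (X \<omega>)) = integral\<^sup>L (distr M borel X) f"
      by (simp add: integral_distr)
    also have "\<dots> = measure_pmf.expectation (bernoulli_pmf p) (\<lambda>b. f (of_bool b))"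
      unfolding distr by (subst integral_distr) auto
    also have "\<dots> = f 1 * p + f 0 * (1 - p)" using p by simp
    finally show ?thesis .
  qed
  show "expectation X = p" using integral[of "\<lambda>x. x"] by simp
  show "expectation (\<lambda>\<omega>. (X \<omega> - p)\<^sup>2) = p * (1 - p)"
    using integral[of "\<lambda>x. (x - p)\<^sup>2"] by (simp add: power2_eq_square algebra_simps)
  have "AE x in distr M borel X. x = 0 \<or> x = 1"
    unfolding distr by (subst AE_distr_iff) auto
  then show "AE \<omega> in M. X \<omega> = 0 \<or> X \<omega> = 1"
    by (subst (asm) AE_distr_iff) auto
qed

section \<open>Events of high probability\<close>

lemma (in prob_space) markov_union_bound:
  fixes Z :: "'i \<Rightarrow> 'a \<Rightarrow> real"
  assumes "finite I" and K: "0 < K"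
    and int: "\<And>i. i \<in> I \<Longrightarrow> integrable M (Z i)"
    and nonneg: "\<And>i \<omega>. i \<in> I \<Longrightarrow> 0 \<le> Z i \<omega>"
    and c: "\<And>i. i \<in> I \<Longrightarrow> 0 < c i"
    and le: "\<And>i. i \<in> I \<Longrightarrow> expectation (Z i) \<le> C * c i"
  shows "prob {\<omega> \<in> space M. \<exists>i\<in>I. K * c i < Z i \<omega>} \<le> real (card I) * (C / K)"
proof -
  have meas: "{\<omega> \<in> space M. K * c i \<le> Z i \<omega>} \<in> events" if "i \<in> I" for i
    using borel_measurable_integrable[OF int[OF that]] by measurable
  have "prob {\<omega> \<in> space M. \<exists>i\<in>I. K * c i < Z i \<omega>} \<le> prob (\<Union>i\<in>I. {\<omega> \<in> space M. K * c i \<le> Z i \<omega>})"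
    using meas \<open>finite I\<close> by (intro finite_measure_mono) (auto intro: less_imp_le)
  also have "\<dots> \<le> (\<Sum>i\<in>I. prob {\<omega> \<in> space M. K * c i \<le> Z i \<omega>})"
    using meas \<open>finite I\<close> by (intro finite_measure_subadditive_finite) auto
  also have "\<dots> \<le> (\<Sum>i\<in>I. C / K)"
  proof (intro sum_mono)
    fix i assume i: "i \<in> I"
    have "prob {\<omega> \<in> space M. K * c i \<le> Z i \<omega>} \<le> expectation (Z i) / (K * c i)"
      using i K c[OF i] nonneg int by (intro integral_Markov_inequality_measure[where A = "{}"]) auto
    also have "\<dots> \<le> C * c i / (K * c i)"
      using le[OF i] K c[OF i] by (intro divide_right_mono) auto
    also have "\<dots> = C / K" using c[OF i] by simp
    finally show "prob {\<omega> \<in> space M. K * c i \<le> Z i \<omega>} \<le> C / K" .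
  qed
  finally show ?thesis by simp
qed

lemma ip_power_even_nonneg: "symfun N B \<Longrightarrow> 0 \<le> ip N u ((mv N B ^^ (n + n)) u)"
  by (simp add: ip_mv_power)

lemma symfun_sym_entries: "symfun N (sym_entries y)"
  by (simp add: symfun_def min.commute max.commute)

context random_symmetric
begin

abbreviation noise :: "'a \<Rightarrow> nat \<Rightarrow> nat \<Rightarrow> real" where
  "noise \<omega> \<equiv> sym_entries (\<lambda>e. Y e \<omega>)"

text \<open>A one-step walk uses its only edge once, so each summand has mean zero. The general walk
  bound would give O(1) here, far above the fluctuation of order sqrt \<epsilon>.\<close>

lemma expectation_quad_1: "expectation (quad 1 u w) = 0"
  unfolding expectation_quad
proof (intro sum.neutral ballI)
  fix xs assume xs: "xs \<in> words N (1 + 1)"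
  then have len: "length (walk_edges xs) = 1" by (simp add: words_def)
  then have "walk_edges xs \<noteq> []" by (metis list.size(3) zero_neq_one)
  then have "card (set (walk_edges xs)) \<noteq> 0" by simp
  then have "\<not> 2 * card (set (walk_edges xs)) \<le> length (walk_edges xs)" unfolding len by linarith
  then have "moment (walk_edges xs) = 0"
    using moment_bound[OF walk_edges_in[OF xs]] by simp
  then show "u (hd xs) * w (last xs) * moment (walk_edges xs) = 0" by simp
qed

lemma trace_power_noise:
  "trace_power N (noise \<omega>) n = (\<Sum>a<N. quad n (\<lambda>b. of_bool (b = a)) (\<lambda>b. of_bool (b = a)) \<omega>)"
  by (simp add: trace_power_def quad_def)

lemma integrable_trace: "integrable M (\<lambda>\<omega>. trace_power N (noise \<omega>) n)"
  unfolding trace_power_noise by (intro Bochner_Integration.integrable_sum integrable_quad)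

text \<open>The complete random input of the proof. The trace controls the operator norm of W, the
  squared deviations control the forms in W, W^2 and W^3, and the forms in W^8 control the
  remainders. Each is allowed \<open>K\<close> times the order of its expectation.\<close>

definition good :: "nat \<Rightarrow> (nat \<Rightarrow> nat \<Rightarrow> real) \<Rightarrow> real \<Rightarrow> 'a set" where
  "good k e K = {\<omega> \<in> space M.
    trace_power N (noise \<omega>) 6 \<le> K * (real N * (real N * p) ^ 3) \<and>
    (\<forall>n\<in>{1..3}. \<forall>j\<in>{1..k}. \<forall>l\<in>{1..k}.
      (quad n (e j) (e l) \<omega> - expectation (quad n (e j) (e l)))\<^sup>2 \<le> K * ((real N * p) ^ n / real N)) \<and>
    (\<forall>j\<in>{1..k}. quad 8 (e j) (e j) \<omega> \<le> K * (real N * p) ^ 4)}"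

text \<open>Markov's inequality and a union over 3 k^2 + k + 1 events. \<open>C\<close> collects the
  walk-count constants: (n+1)^(2n+3) is at most 4^9 for n \<le> 3, while 5^10 belongs to W^8 and 4^8
  to the trace of W^6.\<close>

lemma prob_not_good_le:
  assumes e: "\<And>j a. j \<in> {1..k} \<Longrightarrow> a < N \<Longrightarrow> \<bar>e j a\<bar> \<le> U / sqrt N" and K: "0 < K"
  defines "C \<equiv> 2 * U ^ 4 * 4 ^ 9 + U\<^sup>2 * 5 ^ 10 + 4 ^ 8"
  shows "good k e K \<in> events" and "prob (space M - good k e K) \<le> (3 * (real k)\<^sup>2 + real k + 1) * (C / K)"
proof -
  have N: "N > 0" using Np by (cases N) auto
  have C: "2 * U ^ 4 * 4 ^ 9 \<le> C" "U\<^sup>2 * 5 ^ 10 \<le> C" "4 ^ 8 \<le> C" unfolding C_def by auto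
  have quad_meas [measurable]: "quad n u w \<in> borel_measurable M" for n u w
    by (rule borel_measurable_integrable[OF integrable_quad])
  have trace_meas [measurable]: "(\<lambda>\<omega>. trace_power N (noise \<omega>) 6) \<in> borel_measurable M"
    by (rule borel_measurable_integrable[OF integrable_trace])
  show "good k e K \<in> events" unfolding good_def by measurable
  let ?I = "{1..3::nat} \<times> {1..k} \<times> {1..k}"
  let ?Z = "\<lambda>(n, j, l) \<omega>. (quad n (e j) (e l) \<omega> - expectation (quad n (e j) (e l)))\<^sup>2"
  let ?c = "\<lambda>(n, j, l). (real N * p) ^ n / real N"
  let ?E1 = "{\<omega> \<in> space M. \<exists>t\<in>?I. K * ?c t < ?Z t \<omega>}"
  let ?E2 = "{\<omega> \<in> space M. \<exists>j\<in>{1..k}. K * (real N * p) ^ 4 < quad 8 (e j) (e j) \<omega>}"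
  let ?E3 = "{\<omega> \<in> space M. \<exists>j\<in>{()}. K * (real N * (real N * p) ^ 3) < trace_power N (noise \<omega>) 6}"
  have "prob ?E1 \<le> real (card ?I) * (C / K)"
  proof (rule markov_union_bound)
    fix t assume "t \<in> ?I"
    then obtain n j l where t: "t = (n, j, l)" and njl: "n \<in> {1..3}" "j \<in> {1..k}" "l \<in> {1..k}" by auto
    have "integrable M (\<lambda>\<omega>. (quad n (e j) (e l) \<omega> - expectation (quad n (e j) (e l)))\<^sup>2)"
      unfolding power2_diff by (intro Bochner_Integration.integrable_diff Bochner_Integration.integrable_add
          integrable_quad_squared integrable_const integrable_mult_left integrable_mult_right integrable_quad)
    then show "integrable M (?Z t)" unfolding t by simp
    show "0 < ?c t" unfolding t using Np N by (auto intro!: divide_pos_pos zero_less_power)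
    have "variance (quad n (e j) (e l)) \<le> 2 * U ^ 4 * real ((n + 1) ^ (2 * n + 3)) * (real N * p) ^ n / real N"
      using e njl by (intro variance_quad_le) auto
    also have "\<dots> \<le> 2 * U ^ 4 * 4 ^ 9 * (real N * p) ^ n / real N"
    proof (intro divide_right_mono mult_right_mono mult_left_mono)
      have "(n + 1) ^ (2 * n + 3) \<le> 4 ^ (2 * n + 3)" using njl by (intro power_mono) auto
      also have "(4::nat) ^ (2 * n + 3) \<le> 4 ^ 9" using njl by (intro power_increasing) auto
      finally have "real ((n + 1) ^ (2 * n + 3)) \<le> real (4 ^ 9)" by (simp only: of_nat_le_iff)
      then show "real ((n + 1) ^ (2 * n + 3)) \<le> 4 ^ 9" by simp
    qed (use Np in auto)
    also have "\<dots> \<le> C * (real N * p) ^ n / real N"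
      using C(1) Np by (intro divide_right_mono mult_right_mono) auto
    finally show "expectation (?Z t) \<le> C * ?c t" unfolding t by simp
  qed (use K in auto)
  also have "real (card ?I) = 3 * (real k)\<^sup>2" by (simp add: card_cartesian_product power2_eq_square)
  finally have 1: "prob ?E1 \<le> 3 * (real k)\<^sup>2 * (C / K)" .
  have "prob ?E2 \<le> real (card {1..k}) * (C / K)"
  proof (rule markov_union_bound)
    fix j assume j: "j \<in> {1..k}"
    show "0 \<le> quad 8 (e j) (e j) \<omega>" for \<omega>
      unfolding quad_def using ip_power_even_nonneg[OF symfun_sym_entries[of N "\<lambda>e. Y e \<omega>"], of "e j" 4] by simp
    have "expectation (quad 8 (e j) (e j)) \<le> U\<^sup>2 * real ((8 div 2 + 1) ^ (8 + 2)) * (real N * p) ^ (8 div 2)"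
      using abs_expectation_quad_le[of "e j" U "e j" 8] e[OF j] by (simp add: abs_le_iff)
    also have "\<dots> = U\<^sup>2 * 5 ^ 10 * (real N * p) ^ 4" by simp
    also have "\<dots> \<le> C * (real N * p) ^ 4" using C(2) Np by (intro mult_right_mono) auto
    finally show "expectation (quad 8 (e j) (e j)) \<le> C * (real N * p) ^ 4" .
  qed (use K Np N integrable_quad in auto)
  then have 2: "prob ?E2 \<le> real k * (C / K)" by (simp only: card_atLeastAtMost diff_Suc_1)
  have "prob ?E3 \<le> real (card {()}) * (C / K)"
  proof (rule markov_union_bound)
    show "0 \<le> trace_power N (noise \<omega>) 6" for \<omega>
      unfolding trace_power_def using ip_power_even_nonneg[OF symfun_sym_entries[of N "\<lambda>e. Y e \<omega>"], of _ 3]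
      by (intro sum_nonneg) simp
    have "expectation (\<lambda>\<omega>. trace_power N (noise \<omega>) 6) =
        (\<Sum>a<N. expectation (quad 6 (\<lambda>b. of_bool (b = a)) (\<lambda>b. of_bool (b = a))))"
      unfolding trace_power_noise by (intro Bochner_Integration.integral_sum integrable_quad)
    also have "\<dots> \<le> real ((6 div 2 + 1) ^ (6 + 2)) * real N * (real N * p) ^ (6 div 2)"
      by (rule expectation_trace_le)
    also have "\<dots> = 4 ^ 8 * (real N * (real N * p) ^ 3)" by simp
    also have "\<dots> \<le> C * (real N * (real N * p) ^ 3)" using C(3) Np by (intro mult_right_mono) auto
    finally show "expectation (\<lambda>\<omega>. trace_power N (noise \<omega>) 6) \<le> C * (real N * (real N * p) ^ 3)" .
  qed (use K Np N integrable_trace in auto)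
  then have 3: "prob ?E3 \<le> 1 * (C / K)" by simp
  have meas: "?E1 \<in> events" "?E2 \<in> events" "?E3 \<in> events"
    unfolding case_prod_unfold by measurable
  have "prob (space M - good k e K) \<le> prob (?E1 \<union> (?E2 \<union> ?E3))"
    using meas by (intro finite_measure_mono) (auto simp: good_def not_le)
  also have "\<dots> \<le> prob ?E1 + (prob ?E2 + prob ?E3)"
    using meas by (intro order_trans[OF measure_Un_le] add_left_mono measure_Un_le) auto
  also have "\<dots> \<le> (3 * (real k)\<^sup>2 + real k + 1) * (C / K)" using 1 2 3 by (simp add: algebra_simps)
  finally show "prob (space M - good k e K) \<le> (3 * (real k)\<^sup>2 + real k + 1) * (C / K)" .
qed

end

section \<open>The random matrix at one fixed size\<close>

lemma grid_vec_scalar_prod: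
  fixes x :: "real vec"
  assumes "x \<in> carrier_vec N" "\<And>a. a < N \<Longrightarrow> x $ a = u a"
  shows "grid_vec g N \<bullet> x = ip N (gridfun g N) u"
  using assms by (auto simp: scalar_prod_def ip_def grid_vec_index lessThan_atLeast0 intro!: sum.cong)

locale bernoulli_network = prob_space M for M :: "'a measure" +
  fixes N :: nat and A :: "'a \<Rightarrow> real mat" and P :: "nat \<Rightarrow> nat \<Rightarrow> real" and p :: real
  assumes bernoulli: "bernoulli_symmetric M N P A"
    and P_sym: "\<And>a b. P a b = P b a"
    and P_bounds: "\<And>a b. a < N \<Longrightarrow> b < N \<Longrightarrow> 0 \<le> P a b \<and> P a b \<le> p"
    and p_le_1: "p \<le> 1" and Np: "1 \<le> real N * p"
begin

abbreviation "I \<equiv> {(a, b). a \<le> b \<and> b < N}"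

lemma A_carrier: "\<omega> \<in> space M \<Longrightarrow> A \<omega> \<in> carrier_mat N N"
  and A_transpose: "\<omega> \<in> space M \<Longrightarrow> transpose_mat (A \<omega>) = A \<omega>"
  and A_indep: "indep_vars (\<lambda>_. borel) (\<lambda>ab \<omega>. A \<omega> $$ ab) I"
  and A_distr: "\<And>a b. a \<le> b \<Longrightarrow> b < N \<Longrightarrow> distr M borel (\<lambda>\<omega>. A \<omega> $$ (a, b)) =
    distr (measure_pmf (bernoulli_pmf (P a b))) borel of_bool"
  using bernoulli unfolding bernoulli_symmetric_def by auto

lemma A_sym: "\<omega> \<in> space M \<Longrightarrow> a < N \<Longrightarrow> b < N \<Longrightarrow> A \<omega> $$ (a, b) = A \<omega> $$ (b, a)"
  using A_carrier A_transpose by (metis carrier_matD index_transpose_mat(1))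

lemma A_measurable: "a \<le> b \<Longrightarrow> b < N \<Longrightarrow> (\<lambda>\<omega>. A \<omega> $$ (a, b)) \<in> borel_measurable M"
  using A_indep unfolding indep_vars_def by auto

lemma entry:
  assumes "a \<le> b" "b < N"
  shows "AE \<omega> in M. A \<omega> $$ (a, b) = 0 \<or> A \<omega> $$ (a, b) = 1"
    and "expectation (\<lambda>\<omega>. A \<omega> $$ (a, b)) = P a b"
    and "expectation (\<lambda>\<omega>. (A \<omega> $$ (a, b) - P a b)\<^sup>2) = P a b * (1 - P a b)"
proof -
  have "0 \<le> P a b" "P a b \<le> 1" using P_bounds[of a b] p_le_1 assms by auto
  note * = bernoulli_variable[OF A_measurable[OF assms] A_distr[OF assms] this]
  show "AE \<omega> in M. A \<omega> $$ (a, b) = 0 \<or> A \<omega> $$ (a, b) = 1"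
    "expectation (\<lambda>\<omega>. A \<omega> $$ (a, b)) = P a b"
    "expectation (\<lambda>\<omega>. (A \<omega> $$ (a, b) - P a b)\<^sup>2) = P a b * (1 - P a b)"
    by (fact *)+
qed

definition Y :: "nat \<times> nat \<Rightarrow> 'a \<Rightarrow> real" where
  "Y e \<omega> = A \<omega> $$ e - P (fst e) (snd e)"

sublocale random_symmetric M Y N p
proof
  show "indep_vars (\<lambda>_. borel) Y I"
    unfolding Y_def by (rule indep_vars_compose2[OF A_indep, where Y = "\<lambda>e y. y - P (fst e) (snd e)"]) auto
  fix e assume "e \<in> I"
  then obtain a b where e: "e = (a, b)" "a \<le> b" "b < N" by auto
  have P: "0 \<le> P a b" "P a b \<le> p" using P_bounds[of a b] e by auto
  have int: "integrable M (\<lambda>\<omega>. A \<omega> $$ (a, b))"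
    using entry(1)[OF e(2,3)] A_measurable[OF e(2,3)]
    by (intro integrable_const_bound[where B = 1]) auto
  show "AE \<omega> in M. \<bar>Y e \<omega>\<bar> \<le> 1"
    using entry(1)[OF e(2,3)] P p_le_1 by (auto elim!: eventually_mono simp: Y_def e)
  show "expectation (Y e) = 0"
    using entry(2)[OF e(2,3)] int unfolding Y_def[abs_def] e by (simp add: prob_space)
  have "expectation (\<lambda>\<omega>. (Y e \<omega>)\<^sup>2) = P a b * (1 - P a b)"
    using entry(3)[OF e(2,3)] by (simp add: Y_def e)
  also have "\<dots> \<le> P a b * 1" using P by (intro mult_left_mono) auto
  finally show "expectation (\<lambda>\<omega>. (Y e \<omega>)\<^sup>2) \<le> p" using P by simp
next
  show "0 \<le> p" using Np mult_nonneg_nonpos[of "real N" p] by (cases "0 \<le> p") auto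
qed (fact p_le_1 Np)+

lemma expectation_entry:
  assumes "a < N" "b < N"
  shows "mat_expectation M N A $$ (a, b) = P a b"
proof -
  have "expectation (\<lambda>\<omega>. A \<omega> $$ (a, b)) = P a b"
  proof (cases "a \<le> b")
    case True
    then show ?thesis using entry(2) assms by simp
  next
    case False
    have "expectation (\<lambda>\<omega>. A \<omega> $$ (a, b)) = expectation (\<lambda>\<omega>. A \<omega> $$ (b, a))"
      using A_sym assms by (intro Bochner_Integration.integral_cong) auto
    then show ?thesis using entry(2)[of b a] False assms P_sym by simp
  qed
  then show ?thesis using assms by (simp add: mat_expectation_def)
qed

lemma A_entry: "\<omega> \<in> space M \<Longrightarrow> a < N \<Longrightarrow> b < N \<Longrightarrow> A \<omega> $$ (a, b) = P a b + noise \<omega> a b"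
  using A_sym[of \<omega> a b] P_sym[of a b] by (auto simp: Y_def min_def max_def)

lemma centred_carrier: "\<omega> \<in> space M \<Longrightarrow> centred M N A \<omega> \<in> carrier_mat N N"
  using A_carrier unfolding centred_def mat_expectation_def by auto

lemma centred_entry:
  "\<omega> \<in> space M \<Longrightarrow> a < N \<Longrightarrow> b < N \<Longrightarrow> centred M N A \<omega> $$ (a, b) = noise \<omega> a b"
  using A_carrier A_entry expectation_entry unfolding centred_def
  by (simp add: mat_expectation_def)

lemma centred_mult_vec:
  fixes x :: "real vec"
  assumes "\<omega> \<in> space M" "x \<in> carrier_vec N" "\<And>a. a < N \<Longrightarrow> x $ a = u a" "a < N"
  shows "(centred M N A \<omega> *\<^sub>v x) $ a = mv N (noise \<omega>) u a"
  using assms centred_carrier[OF assms(1)] centred_entry[OF assms(1)]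
  by (simp add: scalar_prod_def mv_def lessThan_atLeast0)

lemma centred_quad_1:
  assumes "\<omega> \<in> space M"
  shows "grid_vec g N \<bullet> (centred M N A \<omega> *\<^sub>v grid_vec h N) = quad 1 (gridfun g N) (gridfun h N) \<omega>"
proof -
  have h: "grid_vec h N \<in> carrier_vec N" by (simp add: grid_vec_def)
  have "(centred M N A \<omega> *\<^sub>v grid_vec h N) $ a = mv N (noise \<omega>) (gridfun h N) a" if "a < N" for a
    using centred_mult_vec[OF assms h _ that, of "gridfun h N"] grid_vec_index by simp
  then show ?thesis
    using grid_vec_scalar_prod[OF mult_mat_vec_carrier[OF centred_carrier[OF assms] h]]
    by (simp add: quad_def)
qed

lemma centred_quad_2:
  assumes "\<omega> \<in> space M"
  shows "grid_vec g N \<bullet> ((centred M N A \<omega> ^\<^sub>m 2) *\<^sub>v grid_vec h N) = quad 2 (gridfun g N) (gridfun h N) \<omega>"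
proof -
  let ?W = "centred M N A \<omega>"
  have W: "?W \<in> carrier_mat N N" by (rule centred_carrier[OF assms])
  have h: "grid_vec h N \<in> carrier_vec N" by (simp add: grid_vec_def)
  have "?W ^\<^sub>m 2 = ?W * ?W" using W by (simp add: numeral_2_eq_2)
  then have eq: "(?W ^\<^sub>m 2) *\<^sub>v grid_vec h N = ?W *\<^sub>v (?W *\<^sub>v grid_vec h N)"
    using W h by (simp add: assoc_mult_mat_vec)
  have 1: "(?W *\<^sub>v grid_vec h N) $ a = mv N (noise \<omega>) (gridfun h N) a" if "a < N" for a
    using centred_mult_vec[OF assms h _ that, of "gridfun h N"] grid_vec_index by simp
  have "(?W *\<^sub>v (?W *\<^sub>v grid_vec h N)) $ a = mv N (noise \<omega>) (mv N (noise \<omega>) (gridfun h N)) a" if "a < N" for a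
    using 1 W h by (intro centred_mult_vec[OF assms _ _ that]) auto
  then show ?thesis
    using grid_vec_scalar_prod[OF mult_mat_vec_carrier[OF W mult_mat_vec_carrier[OF W h]]]
    unfolding eq by (simp add: quad_def numeral_2_eq_2)
qed

end

section \<open>The random graph model\<close>

lemma bigo_bound:
  fixes f g :: "'b \<Rightarrow> real"
  assumes "eventually (\<lambda>t. \<bar>f t\<bar> \<le> c * g t) F" "eventually (\<lambda>t. 0 \<le> g t) F"
  shows "f \<in> O[F](g)"
  using assms by (intro bigoI[of _ c]) (auto elim: eventually_elim2)

locale sbm =
  fixes k i :: nat
    and \<theta> :: "nat \<Rightarrow> real"
    and r :: "nat \<Rightarrow> real \<Rightarrow> real"
    and \<epsilon> :: "nat \<Rightarrow> real"
    and M :: "nat \<Rightarrow> 'a measure"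
    and A :: "nat \<Rightarrow> 'a \<Rightarrow> real mat"
    and v :: "nat \<Rightarrow> 'a \<Rightarrow> real vec"
    and U L :: real
  assumes theta_mono: "\<And>a b. 1 \<le> a \<Longrightarrow> a \<le> b \<Longrightarrow> b \<le> k \<Longrightarrow> \<theta> b \<le> \<theta> a"
    and theta_pos: "\<theta> k > 0"
    and orthonormal: "orthonormal_L2 {1..k} r"
    and f_nonneg: "\<And>x y. x \<in> {0..1} \<Longrightarrow> y \<in> {0..1} \<Longrightarrow> conn_kernel k \<theta> r x y \<ge> 0"
    and eps_bounds: "\<And>N. N \<ge> 1 \<Longrightarrow>
          0 < \<epsilon> N \<and> \<epsilon> N \<le> inverse (SUP (x, y)\<in>{0..1}\<times>{0..1}. conn_kernel k \<theta> r x y)"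
    and prob: "\<And>N. N \<ge> 1 \<Longrightarrow> prob_space (M N)"
    and A: "\<And>N. N \<ge> 1 \<Longrightarrow>
          bernoulli_symmetric (M N) N (\<lambda>a b. \<epsilon> N * conn_kernel k \<theta> r (grid N a) (grid N b)) (A N)"
    and i: "i \<in> simple_indices k \<theta>"
    and eps_lower: "(\<lambda>N. real N powr (-2/3)) \<lless> \<epsilon>"
    and eps_upper: "\<epsilon> \<lless> (\<lambda>_. 1)"
    and v: "\<And>N. N \<ge> i \<Longrightarrow> AE \<omega> in M N.
          eigenvector (A N \<omega>) (v N \<omega>) (eigval i (A N \<omega>)) \<and>
          euclid_norm (v N \<omega>) = 1 \<and> grid_vec (r i) N \<bullet> v N \<omega> \<ge> 0"
    and U: "0 \<le> U" and L: "0 \<le> L"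
    and r_bound: "\<And>j x. j \<in> {1..k} \<Longrightarrow> x \<in> {0..1} \<Longrightarrow> \<bar>r j x\<bar> \<le> U"
    and r_lipschitz: "\<And>j x y. j \<in> {1..k} \<Longrightarrow> x \<in> {0..1} \<Longrightarrow> y \<in> {0..1} \<Longrightarrow> \<bar>r j x - r j y\<bar> \<le> L * \<bar>x - y\<bar>"
begin

abbreviation f :: "real \<Rightarrow> real \<Rightarrow> real" where "f \<equiv> conn_kernel k \<theta> r"

definition F :: real where "F = (SUP (x, y)\<in>{0..1}\<times>{0..1}. f x y)"

lemma theta_gt_0: "l \<in> {1..k} \<Longrightarrow> 0 < \<theta> l"
  using theta_mono[of l k] theta_pos by auto

lemma i_range: "i \<in> {1..k}"
  using i by (simp add: simple_indices_def)

lemma theta_simple: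
  assumes "l \<in> {1..k}" "l \<noteq> i"
  shows "\<theta> l \<noteq> \<theta> i"
proof (cases "l < i")
  case True
  have "theta_ext k \<theta> (i - 1) > theta_ext k \<theta> i" using i by (simp add: simple_indices_def)
  then have "\<theta> i < \<theta> (i - 1)" using True assms i_range by (simp add: theta_ext_def split: if_splits)
  moreover have "\<theta> (i - 1) \<le> \<theta> l" using True assms i_range by (intro theta_mono) auto
  ultimately show ?thesis by simp
next
  case False
  then have "i < l" using assms by simp
  have "theta_ext k \<theta> i > theta_ext k \<theta> (i + 1)" using i by (simp add: simple_indices_def)
  then have "\<theta> (i + 1) < \<theta> i" using \<open>i < l\<close> assms i_range by (simp add: theta_ext_def split: if_splits)
  moreover have "\<theta> l \<le> \<theta> (i + 1)" using \<open>i < l\<close> assms i_range by (intro theta_mono) auto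
  ultimately show ?thesis by simp
qed

lemma f_le_F:
  assumes "x \<in> {0..1}" "y \<in> {0..1}"
  shows "f x y \<le> F"
proof -
  \<comment> \<open>A supremum of reals dominates its set only when the set is bounded above, so a
    crude bound for the kernel by U^2 times the sum of the \<theta>_l has to come first.\<close>
  have "bdd_above ((\<lambda>(x, y). f x y) ` ({0..1} \<times> {0..1}))"
  proof (rule bdd_aboveI2)
    fix z :: "real \<times> real" assume z: "z \<in> {0..1} \<times> {0..1}"
    have "f (fst z) (snd z) \<le> (\<Sum>l=1..k. \<theta> l * (U * U))"
      unfolding conn_kernel_def
    proof (intro sum_mono)
      fix l assume l: "l \<in> {1..k}"
      have "r l (fst z) * r l (snd z) \<le> \<bar>r l (fst z)\<bar> * \<bar>r l (snd z)\<bar>" by (metis abs_ge_self abs_mult)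
      also have "\<dots> \<le> U * U" using z l by (intro mult_mono' r_bound) auto
      finally show "\<theta> l * r l (fst z) * r l (snd z) \<le> \<theta> l * (U * U)"
        using theta_gt_0[OF l] by (simp add: mult.assoc)
    qed
    then show "(case z of (x, y) \<Rightarrow> f x y) \<le> (\<Sum>l=1..k. \<theta> l * (U * U))" by (simp add: case_prod_unfold)
  qed
  from cSUP_upper[OF _ this, of "(x, y)"] assms show ?thesis by (simp add: F_def)
qed

lemma F_pos: "0 < F"
proof -
  have "0 < inverse F" using eps_bounds[of 1] unfolding F_def by linarith
  then show ?thesis by simp
qed

lemma eps_pos: "N \<ge> 1 \<Longrightarrow> 0 < \<epsilon> N"
  using eps_bounds by simp

definition s :: "nat \<Rightarrow> real" where "s N = real N * \<epsilon> N"

lemma eps_tendsto: "\<epsilon> \<longlonglongrightarrow> 0"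
  using eps_upper by (simp add: much_less_def)

lemma eps_ratio_tendsto: "(\<lambda>N. real N powr (-2/3) / \<epsilon> N) \<longlonglongrightarrow> 0"
  using eps_lower by (simp add: much_less_def)

text \<open>For N \<ge> 1 the quantity 1/(N \<epsilon>) is at most N^(-2/3)/\<epsilon>, so the lower
  bound on \<epsilon> already forces s to infinity.\<close>

lemma inv_s_tendsto: "(\<lambda>N. 1 / s N) \<longlonglongrightarrow> 0"
proof (rule tendsto_sandwich[OF _ _ tendsto_const eps_ratio_tendsto])
  show "\<forall>\<^sub>F N in sequentially. 0 \<le> 1 / s N"
    using eventually_ge_at_top[of 1]
  proof eventually_elim
    case (elim N)
    then show ?case using eps_pos[OF elim] by (simp add: s_def)
  qed
  show "\<forall>\<^sub>F N in sequentially. 1 / s N \<le> real N powr (-2/3) / \<epsilon> N"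
    using eventually_ge_at_top[of 1]
  proof eventually_elim
    case (elim N)
    have "1 / s N = real N powr (-1) / \<epsilon> N" using elim by (simp add: s_def powr_minus_divide)
    also have "\<dots> \<le> real N powr (-2/3) / \<epsilon> N"
      using elim eps_pos[OF elim] by (intro divide_right_mono powr_mono) auto
    finally show ?case .
  qed
qed

lemma large:
  "\<forall>\<^sub>F N in sequentially. N \<ge> 1 \<and> N \<ge> i \<and> 1 \<le> real N * (\<epsilon> N * F) \<and> \<epsilon> N \<le> 1 \<and> 1 \<le> s N"
proof -
  have "\<forall>\<^sub>F N in sequentially. 1 / s N < min F 1"
    using F_pos by (intro order_tendstoD(2)[OF inv_s_tendsto]) auto
  moreover have "\<forall>\<^sub>F N in sequentially. \<epsilon> N < 1" by (rule order_tendstoD(2)[OF eps_tendsto]) simp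
  ultimately show ?thesis
    using eventually_ge_at_top[of 1] eventually_ge_at_top[of i]
  proof eventually_elim
    case (elim N)
    then have "0 < s N" using eps_pos by (simp add: s_def)
    then have "1 \<le> F * s N" "1 \<le> s N" using elim by (auto simp: field_simps)
    then show ?case using elim by (simp add: s_def mult_ac)
  qed
qed

definition e :: "nat \<Rightarrow> nat \<Rightarrow> nat \<Rightarrow> real" where
  "e N j = gridfun (r j) N"

abbreviation P :: "nat \<Rightarrow> nat \<Rightarrow> nat \<Rightarrow> real" where
  "P N a b \<equiv> \<epsilon> N * f (grid N a) (grid N b)"

definition noise :: "nat \<Rightarrow> 'a \<Rightarrow> nat \<Rightarrow> nat \<Rightarrow> real" where
  "noise N \<omega> = sym_entries (\<lambda>ab. A N \<omega> $$ ab - P N (fst ab) (snd ab))"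

definition q :: "nat \<Rightarrow> nat \<Rightarrow> nat \<Rightarrow> nat \<Rightarrow> 'a \<Rightarrow> real" where
  "q N m j l \<omega> = ip N (e N j) ((mv N (noise N \<omega>) ^^ m) (e N l))"

definition good :: "real \<Rightarrow> nat \<Rightarrow> 'a set" where
  "good K N = {\<omega> \<in> space (M N).
    trace_power N (noise N \<omega>) 6 \<le> K * (real N * (F * s N) ^ 3) \<and>
    (\<forall>m\<in>{1..3}. \<forall>j\<in>{1..k}. \<forall>l\<in>{1..k}.
      (q N m j l \<omega> - (\<integral>\<omega>'. q N m j l \<omega>' \<partial>M N))\<^sup>2 \<le> K * ((F * s N) ^ m / real N)) \<and>
    (\<forall>j\<in>{1..k}. q N 8 j j \<omega> \<le> K * (F * s N) ^ 4)}"

text \<open>Free of both \<open>N\<close> and \<open>K\<close>, so that one choice of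
  \<open>K\<close> makes the exceptional probability small for all large N at once.\<close>

definition prob_const :: real where
  "prob_const = (3 * (real k)\<^sup>2 + real k + 1) * (2 * U ^ 4 * 4 ^ 9 + U\<^sup>2 * 5 ^ 10 + 4 ^ 8)"

lemma symfun_noise: "symfun N (noise N \<omega>)"
  unfolding noise_def by (rule symfun_sym_entries)

lemma network:
  assumes "N \<ge> 1" "1 \<le> real N * (\<epsilon> N * F)"
  shows "bernoulli_network (M N) N (A N) (P N) (\<epsilon> N * F)"
proof (intro bernoulli_network.intro bernoulli_network_axioms.intro)
  show "prob_space (M N)" "bernoulli_symmetric (M N) N (P N) (A N)"
    using prob[OF assms(1)] A[OF assms(1)] by auto
  show "P N a b = P N b a" for a b unfolding conn_kernel_def by (simp add: mult_ac)
  show "0 \<le> P N a b \<and> P N a b \<le> \<epsilon> N * F" if "a < N" "b < N" for a b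
    using eps_pos[OF assms(1)] f_nonneg f_le_F grid_in that by auto
  have "\<epsilon> N * F \<le> inverse F * F"
    using eps_bounds[OF assms(1)] F_pos by (intro mult_right_mono) (auto simp: F_def)
  then show "\<epsilon> N * F \<le> 1" using F_pos by simp
qed (fact assms(2))

lemma e_bound: "j \<in> {1..k} \<Longrightarrow> a < N \<Longrightarrow> \<bar>e N j a\<bar> \<le> U / sqrt N"
  unfolding e_def by (rule abs_gridfun_le) (auto intro: r_bound)

text \<open>The fixed-size results are valid only when N \<epsilon> F \<ge> 1, which holds for large
  N. They are exported with this condition as a premise, since asymptotic arguments cannot stay
  inside a fixed size.\<close>

lemma network_facts:
  assumes N: "N \<ge> 1" "1 \<le> real N * (\<epsilon> N * F)"
  shows expectation_q1: "(\<integral>\<omega>. q N 1 j l \<omega> \<partial>M N) = 0"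
    and expectation_q_le: "j \<in> {1..k} \<Longrightarrow> l \<in> {1..k} \<Longrightarrow> \<bar>\<integral>\<omega>. q N m j l \<omega> \<partial>M N\<bar> \<le>
      U\<^sup>2 * real ((m div 2 + 1) ^ (m + 2)) * (F * s N) ^ (m div 2)"
    and good_event: "0 < K \<Longrightarrow> good K N \<in> sets (M N)"
    and prob_good: "0 < K \<Longrightarrow> measure (M N) (space (M N) - good K N) \<le> prob_const / K"
    and A_carrier: "\<omega> \<in> space (M N) \<Longrightarrow> A N \<omega> \<in> carrier_mat N N"
    and A_transpose: "\<omega> \<in> space (M N) \<Longrightarrow> transpose_mat (A N \<omega>) = A N \<omega>"
    and A_entry: "\<omega> \<in> space (M N) \<Longrightarrow> a < N \<Longrightarrow> b < N \<Longrightarrow> A N \<omega> $$ (a, b) = P N a b + noise N \<omega> a b"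
    and centred_1: "\<omega> \<in> space (M N) \<Longrightarrow>
      grid_vec (r j) N \<bullet> (centred (M N) N (A N) \<omega> *\<^sub>v grid_vec (r l) N) = q N 1 j l \<omega>"
    and centred_2: "\<omega> \<in> space (M N) \<Longrightarrow>
      grid_vec (r j) N \<bullet> ((centred (M N) N (A N) \<omega> ^\<^sub>m 2) *\<^sub>v grid_vec (r l) N) = q N 2 j l \<omega>"
proof -
  interpret B: bernoulli_network "M N" N "A N" "P N" "\<epsilon> N * F" by (rule network[OF N])
  have noise: "noise N \<omega> = B.noise \<omega>" for \<omega>
    unfolding noise_def B.Y_def ..
  have q: "q N m j l = B.quad m (e N j) (e N l)" for m j l
    unfolding q_def B.quad_def noise by (rule refl)
  have Np: "real N * (\<epsilon> N * F) = F * s N" by (simp add: s_def)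
  have good: "good K N = B.good k (e N) K" for K
    unfolding good_def B.good_def q noise Np ..
  show "(\<integral>\<omega>. q N 1 j l \<omega> \<partial>M N) = 0" unfolding q by (rule B.expectation_quad_1)
  show "\<bar>\<integral>\<omega>. q N m j l \<omega> \<partial>M N\<bar> \<le> U\<^sup>2 * real ((m div 2 + 1) ^ (m + 2)) * (F * s N) ^ (m div 2)"
    if "j \<in> {1..k}" "l \<in> {1..k}"
    using B.abs_expectation_quad_le[of "e N j" U "e N l" m] e_bound that unfolding q Np by auto
  show "good K N \<in> sets (M N)" if "0 < K"
    unfolding good using B.prob_not_good_le(1)[of k "e N" U K] e_bound that by auto
  show "measure (M N) (space (M N) - good K N) \<le> prob_const / K" if "0 < K"
    unfolding good prob_const_def using B.prob_not_good_le(2)[of k "e N" U K] e_bound that by auto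
  show "A N \<omega> \<in> carrier_mat N N" "transpose_mat (A N \<omega>) = A N \<omega>" if "\<omega> \<in> space (M N)"
    using B.A_carrier B.A_transpose that by auto
  show "A N \<omega> $$ (a, b) = P N a b + noise N \<omega> a b" if "\<omega> \<in> space (M N)" "a < N" "b < N"
    using B.A_entry[OF that] unfolding noise .
  show "grid_vec (r j) N \<bullet> (centred (M N) N (A N) \<omega> *\<^sub>v grid_vec (r l) N) = q N 1 j l \<omega>"
    if "\<omega> \<in> space (M N)" using B.centred_quad_1[OF that] unfolding q e_def .
  show "grid_vec (r j) N \<bullet> ((centred (M N) N (A N) \<omega> ^\<^sub>m 2) *\<^sub>v grid_vec (r l) N) = q N 2 j l \<omega>"
    if "\<omega> \<in> space (M N)" using B.centred_quad_2[OF that] unfolding q e_def .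
qed

definition \<gamma> :: "nat \<Rightarrow> real" where "\<gamma> N = 2 * U * L / real N"

lemma nearly_orthonormal_e: "N \<ge> 1 \<Longrightarrow> nearly_orthonormal N k (e N) (\<gamma> N)"
  unfolding e_def \<gamma>_def using orthonormal r_bound r_lipschitz
  by (intro gridfun_nearly_orthonormal) auto

lemma \<gamma>_nonneg: "0 \<le> \<gamma> N"
  using U L by (simp add: \<gamma>_def)

lemma P_sum:
  assumes "N \<ge> 1" "a < N" "b < N"
  shows "P N a b = s N * (\<Sum>l=1..k. \<theta> l * e N l a * e N l b)"
proof -
  have "sqrt (real N) * sqrt (real N) = real N" by simp
  then have "e N l a * e N l b = r l (grid N a) * r l (grid N b) / real N" for l
    using assms by (simp add: e_def gridfun_eq)
  then have "\<theta> l * e N l a * e N l b = \<theta> l * r l (grid N a) * r l (grid N b) / real N" for l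
    by (simp add: mult.assoc)
  then show ?thesis
    using assms unfolding conn_kernel_def s_def by (simp add: sum_divide_distrib[symmetric])
qed

lemma mv_A:
  assumes N: "N \<ge> 1" "1 \<le> real N * (\<epsilon> N * F)" and \<omega>: "\<omega> \<in> space (M N)" and a: "a < N"
  shows "mv N (matfun (A N \<omega>)) x a = s N * (\<Sum>l=1..k. \<theta> l * ip N (e N l) x * e N l a) + mv N (noise N \<omega>) x a"
proof -
  have "mv N (matfun (A N \<omega>)) x a = (\<Sum>b<N. (s N * (\<Sum>l=1..k. \<theta> l * e N l a * e N l b)) * x b) + mv N (noise N \<omega>) x a"
    unfolding mv_def matfun_def sum.distrib[symmetric]
    using A_entry[OF N \<omega> a] P_sum[OF N(1) a] by (intro sum.cong) (auto simp: distrib_right)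
  also have "(\<Sum>b<N. (s N * (\<Sum>l=1..k. \<theta> l * e N l a * e N l b)) * x b) =
      s N * (\<Sum>l=1..k. \<theta> l * ip N (e N l) x * e N l a)"
    unfolding ip_def sum_distrib_left sum_distrib_right by (subst sum.swap) (simp add: mult_ac)
  finally show ?thesis .
qed

lemma quad_A:
  assumes N: "N \<ge> 1" "1 \<le> real N * (\<epsilon> N * F)" and \<omega>: "\<omega> \<in> space (M N)"
  shows "ip N x (mv N (matfun (A N \<omega>)) x) = s N * (\<Sum>l=1..k. \<theta> l * (ip N (e N l) x)\<^sup>2) + ip N x (mv N (noise N \<omega>) x)"
proof -
  have "ip N x (mv N (matfun (A N \<omega>)) x) =
    ip N x (\<lambda>a. s N * (\<Sum>l=1..k. (\<theta> l * ip N (e N l) x) * e N l a) + mv N (noise N \<omega>) x a)"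
    using mv_A[OF N \<omega>] by (intro ip_cong) auto
  then show ?thesis
    by (simp add: ip_add_right ip_scale_right ip_sum_right ip_commute[of N x "e N _"] power2_eq_square mult.assoc)
qed

text \<open>The sixth root of the bound that \<open>good\<close> puts on the trace of W^6; on that
  event it bounds the operator norm of W.\<close>

definition \<eta> :: "real \<Rightarrow> nat \<Rightarrow> real" where
  "\<eta> K N = root 6 (K * (real N * (F * s N) ^ 3))"

definition lam :: "nat \<Rightarrow> 'a \<Rightarrow> real" where "lam N \<omega> = eigval i (A N \<omega>)"

definition eigen_condition :: "nat \<Rightarrow> 'a \<Rightarrow> bool" where
  "eigen_condition N \<omega> \<longleftrightarrow> eigenvector (A N \<omega>) (v N \<omega>) (eigval i (A N \<omega>)) \<and>
          euclid_norm (v N \<omega>) = 1 \<and> grid_vec (r i) N \<bullet> v N \<omega> \<ge> 0"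

lemma \<eta>_bounds:
  assumes N: "N \<ge> 1" "1 \<le> real N * (\<epsilon> N * F)" and K: "0 < K" and \<omega>: "\<omega> \<in> good K N"
  shows "0 \<le> \<eta> K N"
    "ip N (mv N (noise N \<omega>) x) (mv N (noise N \<omega>) x) \<le> (\<eta> K N)\<^sup>2 * ip N x x"
    "\<bar>ip N x (mv N (noise N \<omega>) x)\<bar> \<le> \<eta> K N * ip N x x"
proof -
  have nn: "0 \<le> K * (real N * (F * s N) ^ 3)"
    using K F_pos eps_pos[OF N(1)] by (simp add: s_def)
  then show \<eta>0: "0 \<le> \<eta> K N" unfolding \<eta>_def by simp
  have "(\<eta> K N) ^ 6 = K * (real N * (F * s N) ^ 3)" unfolding \<eta>_def using nn by simp
  then have "trace_power N (noise N \<omega>) 6 \<le> (\<eta> K N) ^ 6" using \<omega> by (simp add: good_def)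
  from norm_mv_le[OF symfun_noise \<eta>0 this]
  show "ip N (mv N (noise N \<omega>) x) (mv N (noise N \<omega>) x) \<le> (\<eta> K N)\<^sup>2 * ip N x x"
    "\<bar>ip N x (mv N (noise N \<omega>) x)\<bar> \<le> \<eta> K N * ip N x x" by auto
qed

lemma lam_bounds:
  assumes N: "N \<ge> 1" "1 \<le> real N * (\<epsilon> N * F)" "i \<le> N" "k * \<gamma> N < 1" and K: "0 < K" and \<omega>: "\<omega> \<in> good K N"
  shows "\<bar>lam N \<omega> - s N * \<theta> i\<bar> \<le> s N * \<theta> i * (k * \<gamma> N) + \<eta> K N"
proof -
  have sp: "\<omega> \<in> space (M N)" using \<omega> by (simp add: good_def)
  have s0: "0 \<le> s N" using eps_pos[OF N(1)] by (simp add: s_def)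
  have quad: "\<bar>ip N x (mv N (matfun (A N \<omega>)) x) - s N * (\<Sum>l=1..k. \<theta> l * (ip N (e N l) x)\<^sup>2)\<bar> \<le> \<eta> K N * ip N x x" for x
    unfolding quad_A[OF N(1,2) sp] using \<eta>_bounds(3)[OF N(1,2) K \<omega>] by simp
  have "1 \<le> i" "i \<le> k" using i_range by auto
  note * = eigval_near[OF A_carrier[OF N(1,2) sp] A_transpose[OF N(1,2) sp] nearly_orthonormal_e[OF N(1)]
    \<gamma>_nonneg N(4) theta_mono theta_pos s0 quad \<open>1 \<le> i\<close> \<open>i \<le> k\<close> N(3)]
  have "s N * \<theta> i * (1 - k * \<gamma> N) - \<eta> K N \<le> lam N \<omega>" "lam N \<omega> \<le> s N * \<theta> i * (1 + k * \<gamma> N) + \<eta> K N"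
    unfolding lam_def using * by auto
  then show ?thesis unfolding abs_le_iff by (simp add: algebra_simps)
qed

lemma eigen_equation:
  assumes N: "N \<ge> 1" "1 \<le> real N * (\<epsilon> N * F)" and \<omega>: "\<omega> \<in> space (M N)" and ev: "eigen_condition N \<omega>"
  shows "eigen_equation N k (noise N \<omega>) (e N) \<theta> (s N) (lam N \<omega>) (\<lambda>a. v N \<omega> $ a)"
    and "grid_vec (r j) N \<bullet> v N \<omega> = ip N (e N j) (\<lambda>a. v N \<omega> $ a)"
proof -
  have vN: "v N \<omega> \<in> carrier_vec N"
    using ev A_carrier[OF N \<omega>] by (auto simp: eigen_condition_def eigenvector_def)
  have Av: "A N \<omega> *\<^sub>v v N \<omega> = lam N \<omega> \<cdot>\<^sub>v v N \<omega>"
    using ev by (simp add: eigen_condition_def eigenvector_def lam_def)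
  show "grid_vec (r j) N \<bullet> v N \<omega> = ip N (e N j) (\<lambda>a. v N \<omega> $ a)"
    unfolding e_def by (rule grid_vec_scalar_prod[OF vN]) simp
  show "eigen_equation N k (noise N \<omega>) (e N) \<theta> (s N) (lam N \<omega>) (\<lambda>a. v N \<omega> $ a)"
  proof
    show "symfun N (noise N \<omega>)" by (rule symfun_noise)
    show "ip N (\<lambda>a. v N \<omega> $ a) (\<lambda>a. v N \<omega> $ a) = 1"
      using ev vN by (simp add: eigen_condition_def euclid_norm_def scalar_prod_def ip_def lessThan_atLeast0)
    fix a assume a: "a < N"
    have "lam N \<omega> * v N \<omega> $ a = (A N \<omega> *\<^sub>v v N \<omega>) $ a" unfolding Av using vN a by simp
    also have "\<dots> = mv N (matfun (A N \<omega>)) (\<lambda>a. v N \<omega> $ a) a"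
      using vN a A_carrier[OF N \<omega>] by (simp add: scalar_prod_def mv_def matfun_def lessThan_atLeast0)
    also have "\<dots> = s N * (\<Sum>l=1..k. \<theta> l * ip N (e N l) (\<lambda>a. v N \<omega> $ a) * e N l a) + mv N (noise N \<omega>) (\<lambda>a. v N \<omega> $ a) a"
      by (rule mv_A[OF N \<omega> a])
    finally show "lam N \<omega> * v N \<omega> $ a = \<dots>" .
  qed
qed

section \<open>Asymptotics uniform over the good outcomes\<close>

text \<open>Asymptotic statements along this filter are uniform over the good outcomes of the \<open>N\<close>-th
  space, so that Landau symbols can replace explicit constants.\<close>

definition FK :: "real \<Rightarrow> (nat \<times> 'a) filter" where
  "FK K = inf (filtercomap fst sequentially)
    (principal {t. snd t \<in> good K (fst t) \<and> eigen_condition (fst t) (snd t)})"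

lemma eventually_FK:
  "eventually Q (FK K) \<longleftrightarrow>
    (\<forall>\<^sub>F N in sequentially. \<forall>\<omega>. \<omega> \<in> good K N \<longrightarrow> eigen_condition N \<omega> \<longrightarrow> Q (N, \<omega>))"
  unfolding FK_def eventually_inf_principal eventually_filtercomap
  by (auto elim!: eventually_mono)

lemma tendsto_FK:
  assumes "(h \<longlongrightarrow> c) sequentially"
  shows "((\<lambda>t. h (fst t)) \<longlongrightarrow> c) (FK K)"
proof (rule filterlim_compose[OF assms])
  show "filterlim fst sequentially (FK K)"
    unfolding FK_def by (rule filterlim_mono[OF filterlim_filtercomap order_refl inf_le1])
qed

lemma base_FK:
  "eventually (\<lambda>t. fst t \<ge> 1 \<and> fst t \<ge> i \<and> 1 \<le> real (fst t) * (\<epsilon> (fst t) * F) \<and> \<epsilon> (fst t) \<le> 1 \<and>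
      1 \<le> s (fst t) \<and> 0 < \<epsilon> (fst t) \<and> snd t \<in> good K (fst t) \<and> snd t \<in> space (M (fst t)) \<and>
      eigen_condition (fst t) (snd t)) (FK K)"
  unfolding eventually_FK using large
  by (auto elim!: eventually_mono simp: good_def eps_pos)

lemma nonneg_FK:
  "eventually (\<lambda>t. 0 \<le> s (fst t)) (FK K)"
  "eventually (\<lambda>t. 0 \<le> sqrt (\<epsilon> (fst t))) (FK K)"
  "eventually (\<lambda>t. 0 \<le> s (fst t) / sqrt (real (fst t))) (FK K)"
  using base_FK[of K] by (auto elim!: eventually_mono)

text \<open>(\<eta>/s)^6 is a constant times N s^3 / s^6 = N / s^3, and N / s^3 is exactly
  (N^(-2/3)/\<epsilon>)^3.\<close>

lemma eta_ratio_tendsto: "(\<lambda>N. \<eta> K N / s N) \<longlonglongrightarrow> 0"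
proof (rule Lim_transform_eventually)
  have "(\<lambda>N. root 6 (K * F ^ 3 * (real N powr (-2/3) / \<epsilon> N) ^ 3)) \<longlonglongrightarrow> root 6 (K * F ^ 3 * 0 ^ 3)"
    by (intro tendsto_intros eps_ratio_tendsto)
  then show "(\<lambda>N. root 6 (K * F ^ 3 * (real N powr (-2/3) / \<epsilon> N) ^ 3)) \<longlonglongrightarrow> 0" by simp
  show "\<forall>\<^sub>F N in sequentially. root 6 (K * F ^ 3 * (real N powr (-2/3) / \<epsilon> N) ^ 3) = \<eta> K N / s N"
    using eventually_ge_at_top[of 1]
  proof eventually_elim
    case (elim N)
    have s: "0 < s N" "0 < \<epsilon> N" using eps_pos[OF elim] elim by (auto simp: s_def)
    have "(real N powr (-2/3)) ^ 3 = real N powr (-2)"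
      using elim by (simp add: powr_powr flip: powr_numeral powr_realpow)
    also have "\<dots> = 1 / (real N)\<^sup>2" using elim by (simp add: powr_minus_divide powr_numeral)
    finally have "(real N powr (-2/3) / \<epsilon> N) ^ 3 = real N / (s N) ^ 3"
      using elim s by (simp add: power_divide s_def power_mult_distrib field_simps power2_eq_square power3_eq_cube)
    then have "K * F ^ 3 * (real N powr (-2/3) / \<epsilon> N) ^ 3 = (K * (real N * (F * s N) ^ 3)) / (s N) ^ 6"
      using s by (simp add: power_mult_distrib field_simps eval_nat_numeral)
    also have "root 6 \<dots> = \<eta> K N / s N"
      unfolding \<eta>_def real_root_divide using s by (simp add: real_root_power_cancel)
    finally show ?case .
  qed
qed

lemma gamma_tendsto: "(\<lambda>N. \<gamma> N) \<longlonglongrightarrow> 0"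
  unfolding \<gamma>_def by (rule lim_const_over_n)

lemma gamma_small: "\<forall>\<^sub>F N in sequentially. k * \<gamma> N < 1 \<and> \<gamma> N \<le> 1"
proof -
  have "(\<lambda>N. k * \<gamma> N) \<longlonglongrightarrow> real k * 0" by (intro tendsto_intros gamma_tendsto)
  then have "\<forall>\<^sub>F N in sequentially. k * \<gamma> N < 1" by (rule order_tendstoD) simp
  moreover have "\<forall>\<^sub>F N in sequentially. \<gamma> N < 1" by (rule order_tendstoD(2)[OF gamma_tendsto]) simp
  ultimately show ?thesis by eventually_elim simp
qed

lemma gamma_small_FK: "eventually (\<lambda>t. k * \<gamma> (fst t) < 1 \<and> \<gamma> (fst t) \<le> 1) (FK K)"
  unfolding eventually_FK using gamma_small by (auto elim!: eventually_mono)

lemma lam_tendsto: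
  assumes K: "0 < K"
  shows "((\<lambda>t. lam (fst t) (snd t) / s (fst t)) \<longlongrightarrow> \<theta> i) (FK K)"
proof -
  have "((\<lambda>t. lam (fst t) (snd t) / s (fst t) - \<theta> i) \<longlongrightarrow> 0) (FK K)"
  proof (rule Lim_null_comparison)
    have "(\<lambda>N. \<theta> i * (k * \<gamma> N) + \<eta> K N / s N) \<longlonglongrightarrow> \<theta> i * (real k * 0) + 0"
      by (intro tendsto_intros gamma_tendsto eta_ratio_tendsto)
    from tendsto_FK[OF this]
    show "((\<lambda>t. \<theta> i * (k * \<gamma> (fst t)) + \<eta> K (fst t) / s (fst t)) \<longlongrightarrow> 0) (FK K)" by simp
    show "eventually (\<lambda>t. norm (lam (fst t) (snd t) / s (fst t) - \<theta> i) \<le>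
        \<theta> i * (k * \<gamma> (fst t)) + \<eta> K (fst t) / s (fst t)) (FK K)"
      using base_FK gamma_small_FK
    proof eventually_elim
      case (elim t)
      then have s: "s (fst t) > 0" by simp
      have "norm (lam (fst t) (snd t) / s (fst t) - \<theta> i) = \<bar>lam (fst t) (snd t) - s (fst t) * \<theta> i\<bar> / s (fst t)"
      proof -
        have "lam (fst t) (snd t) / s (fst t) - \<theta> i = (lam (fst t) (snd t) - s (fst t) * \<theta> i) / s (fst t)"
          using s by (simp add: field_simps)
        then show ?thesis using s by (simp add: abs_divide)
      qed
      also have "\<dots> \<le> (s (fst t) * \<theta> i * (k * \<gamma> (fst t)) + \<eta> K (fst t)) / s (fst t)"
        using elim K s by (intro divide_right_mono lam_bounds) auto
      also have "\<dots> = \<theta> i * (k * \<gamma> (fst t)) + \<eta> K (fst t) / s (fst t)"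
        using s by (simp add: add_divide_distrib)
      finally show ?case .
    qed
  qed
  then show ?thesis using LIM_zero_iff by blast
qed

definition vf :: "nat \<times> 'a \<Rightarrow> nat \<Rightarrow> real" where "vf t = (\<lambda>a. v (fst t) (snd t) $ a)"

definition x :: "nat \<Rightarrow> nat \<times> 'a \<Rightarrow> real" where "x j t = ip (fst t) (e (fst t) j) (vf t)"

definition qt :: "nat \<Rightarrow> nat \<Rightarrow> nat \<Rightarrow> nat \<times> 'a \<Rightarrow> real" where "qt m j l t = q (fst t) m j l (snd t)"

definition Eq :: "nat \<Rightarrow> nat \<Rightarrow> nat \<Rightarrow> nat \<Rightarrow> real" where "Eq m j l N = (\<integral>\<omega>. q N m j l \<omega> \<partial>M N)"

definition Rt :: "nat \<Rightarrow> nat \<times> 'a \<Rightarrow> real" where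
  "Rt j t = ip (fst t) (e (fst t) j) ((mv (fst t) (noise (fst t) (snd t)) ^^ 4) (vf t))"

definition zt :: "nat \<times> 'a \<Rightarrow> real" where
  "zt t = ip (fst t) (mv (fst t) (noise (fst t) (snd t)) (vf t)) (mv (fst t) (noise (fst t) (snd t)) (vf t))"

lemma eigen_FK:
  "eventually (\<lambda>t. eigen_equation (fst t) k (noise (fst t) (snd t)) (e (fst t)) \<theta> (s (fst t)) (lam (fst t) (snd t)) (vf t)) (FK K)"
  using base_FK unfolding vf_def by eventually_elim (rule eigen_equation(1), blast+)

lemma c_eq: "eigen_equation N k B (e N) \<theta> s' l' (vf t) \<Longrightarrow> fst t = N \<Longrightarrow> eigen_equation.c N (e N) (vf t) j = x j t"
  by (simp add: eigen_equation.c_def x_def)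

lemma q_eq: "eigen_equation (fst t) k (noise (fst t) (snd t)) (e (fst t)) \<theta> s' l' v' \<Longrightarrow>
    eigen_equation.q (fst t) (noise (fst t) (snd t)) (e (fst t)) m j l = qt m j l t"
  by (simp add: eigen_equation.q_def qt_def q_def)

lemma q0_bound:
  assumes "j \<in> {1..k}" "l \<in> {1..k}"
  shows "eventually (\<lambda>t. \<bar>qt 0 j l t - of_bool (j = l)\<bar> \<le> 2 * U * L * (1 / real (fst t))) (FK K)"
  using base_FK
proof eventually_elim
  case (elim t)
  then have "nearly_orthonormal (fst t) k (e (fst t)) (\<gamma> (fst t))" by (intro nearly_orthonormal_e) auto
  then show ?case using assms by (auto simp: nearly_orthonormal_def qt_def q_def \<gamma>_def)
qed

lemma q_dev:
  assumes "j \<in> {1..k}" "l \<in> {1..k}" "m \<in> {1..3}" and K: "0 < K"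
  shows "eventually (\<lambda>t. \<bar>qt m j l t - Eq m j l (fst t)\<bar> \<le> sqrt (K * F ^ m) * (sqrt (s (fst t) ^ m) / sqrt (real (fst t)))) (FK K)"
  using base_FK
proof eventually_elim
  case (elim t)
  then have "(qt m j l t - Eq m j l (fst t))\<^sup>2 \<le> K * ((F * s (fst t)) ^ m / real (fst t))"
    using assms unfolding qt_def Eq_def good_def by blast
  then have "\<bar>qt m j l t - Eq m j l (fst t)\<bar> \<le> sqrt (K * ((F * s (fst t)) ^ m / real (fst t)))"
    using real_le_rsqrt[of "\<bar>qt m j l t - Eq m j l (fst t)\<bar>"] by simp
  also have "\<dots> = sqrt (K * F ^ m) * (sqrt (s (fst t) ^ m) / sqrt (real (fst t)))"
    by (simp add: real_sqrt_mult real_sqrt_divide power_mult_distrib)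
  finally show ?case .
qed

text \<open>The condition \<open>m div 2 = 1\<close> covers m = 2 and m = 3 together: an odd power
  gains nothing over the even power below it, so both means have order s.\<close>

lemma Eq_bound:
  assumes "j \<in> {1..k}" "l \<in> {1..k}" "m div 2 = 1"
  shows "(\<lambda>t. Eq m j l (fst t)) \<in> O[FK K](\<lambda>t. s (fst t))"
proof (rule bigo_bound)
  show "eventually (\<lambda>t. \<bar>Eq m j l (fst t)\<bar> \<le> (U\<^sup>2 * real ((m div 2 + 1) ^ (m + 2)) * F) * s (fst t)) (FK K)"
    using base_FK
  proof eventually_elim
    case (elim t)
    then have "\<bar>Eq m j l (fst t)\<bar> \<le> U\<^sup>2 * real ((m div 2 + 1) ^ (m + 2)) * (F * s (fst t)) ^ (m div 2)"
      using assms unfolding Eq_def by (intro expectation_q_le) auto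
    then show ?case using assms(3) by (simp add: mult.assoc)
  qed
qed (rule nonneg_FK)

text \<open>The mean vanishes, and the deviation has order sqrt (s/N) = sqrt \<epsilon>.\<close>

lemma q1_bigo:
  assumes "j \<in> {1..k}" "l \<in> {1..k}" "0 < K"
  shows "qt 1 j l \<in> O[FK K](\<lambda>t. sqrt (\<epsilon> (fst t)))"
proof (rule bigo_bound)
  have "1 \<in> {1..3::nat}" by simp
  from q_dev[OF assms(1,2) this assms(3)]
  show "eventually (\<lambda>t. \<bar>qt 1 j l t\<bar> \<le> sqrt (K * F ^ 1) * sqrt (\<epsilon> (fst t))) (FK K)"
    using base_FK
  proof eventually_elim
    case (elim t)
    have "Eq 1 j l (fst t) = 0" unfolding Eq_def using elim(2) by (intro expectation_q1) auto
    moreover have "sqrt (s (fst t) ^ 1) / sqrt (real (fst t)) = sqrt (\<epsilon> (fst t))"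
      using elim(2) by (simp add: s_def real_sqrt_mult)
    ultimately show ?case using elim(1) by simp
  qed
qed (rule nonneg_FK)

lemma q2_dev_bigo:
  assumes "j \<in> {1..k}" "l \<in> {1..k}" "0 < K"
  shows "(\<lambda>t. qt 2 j l t - Eq 2 j l (fst t)) \<in> O[FK K](\<lambda>t. s (fst t) / sqrt (real (fst t)))"
proof (rule bigo_bound)
  have "2 \<in> {1..3::nat}" by simp
  from q_dev[OF assms(1,2) this assms(3)]
  show "eventually (\<lambda>t. \<bar>qt 2 j l t - Eq 2 j l (fst t)\<bar> \<le> sqrt (K * F ^ 2) * (s (fst t) / sqrt (real (fst t)))) (FK K)"
    using base_FK by eventually_elim simp
qed (rule nonneg_FK)

lemma q2_bigo:
  assumes "j \<in> {1..k}" "l \<in> {1..k}" "0 < K"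
  shows "qt 2 j l \<in> O[FK K](\<lambda>t. s (fst t))"
proof -
  have "(\<lambda>t. s (fst t) / sqrt (real (fst t))) \<in> O[FK K](\<lambda>t. s (fst t))"
  proof (rule bigo_bound)
    show "eventually (\<lambda>t. \<bar>s (fst t) / sqrt (real (fst t))\<bar> \<le> 1 * s (fst t)) (FK K)"
      using base_FK
    proof eventually_elim
      case (elim t)
      then have "1 \<le> sqrt (real (fst t))" "0 \<le> s (fst t)" by auto
      then have "s (fst t) / sqrt (real (fst t)) \<le> s (fst t) / 1" by (intro divide_left_mono) auto
      then show ?case using \<open>0 \<le> s (fst t)\<close> by simp
    qed
  qed (rule nonneg_FK)
  then have "(\<lambda>t. qt 2 j l t - Eq 2 j l (fst t)) \<in> O[FK K](\<lambda>t. s (fst t))"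
    by (rule landau_o.big_trans[OF q2_dev_bigo[OF assms]])
  then have "(\<lambda>t. (qt 2 j l t - Eq 2 j l (fst t)) + Eq 2 j l (fst t)) \<in> O[FK K](\<lambda>t. s (fst t))"
    by (rule sum_in_bigo) (rule Eq_bound, use assms in auto)
  then show ?thesis by simp
qed

lemma q3_bigo:
  assumes "j \<in> {1..k}" "l \<in> {1..k}" "0 < K"
  shows "qt 3 j l \<in> O[FK K](\<lambda>t. s (fst t))"
proof -
  have "(\<lambda>t. qt 3 j l t - Eq 3 j l (fst t)) \<in> O[FK K](\<lambda>t. s (fst t))"
  proof (rule bigo_bound)
    have "3 \<in> {1..3::nat}" by simp
    from q_dev[OF assms(1,2) this assms(3)]
    show "eventually (\<lambda>t. \<bar>qt 3 j l t - Eq 3 j l (fst t)\<bar> \<le> sqrt (K * F ^ 3) * s (fst t)) (FK K)"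
      using base_FK
    proof eventually_elim
      case (elim t)
      \<comment> \<open>The fluctuation of the cubic form is s sqrt \<epsilon>, which stays below
        the order s of its mean because \<epsilon> \<le> 1.\<close>
      have "sqrt (s (fst t) ^ 3) / sqrt (real (fst t)) = sqrt ((s (fst t))\<^sup>2 * \<epsilon> (fst t))"
        using elim(2) by (simp add: s_def power3_eq_cube power2_eq_square flip: real_sqrt_divide)
      also have "\<dots> \<le> sqrt ((s (fst t))\<^sup>2 * 1)" using elim(2) by (intro real_sqrt_le_mono mult_left_mono) auto
      also have "\<dots> = s (fst t)" using elim(2) by simp
      finally have "sqrt (K * F ^ 3) * (sqrt (s (fst t) ^ 3) / sqrt (real (fst t))) \<le> sqrt (K * F ^ 3) * s (fst t)"
        using assms(3) F_pos by (intro mult_left_mono) auto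
      then show ?case using elim(1) by linarith
    qed
  qed (rule nonneg_FK)
  then have "(\<lambda>t. (qt 3 j l t - Eq 3 j l (fst t)) + Eq 3 j l (fst t)) \<in> O[FK K](\<lambda>t. s (fst t))"
    by (rule sum_in_bigo) (rule Eq_bound, use assms in auto)
  then show ?thesis by simp
qed

lemma x_bigo:
  assumes "j \<in> {1..k}" shows "x j \<in> O[FK K](\<lambda>_. 1)"
proof (rule bigo_bound)
  show "eventually (\<lambda>t. \<bar>x j t\<bar> \<le> 2 * 1) (FK K)"
    using base_FK eigen_FK gamma_small_FK q0_bound[OF assms assms]
  proof eventually_elim
    case (elim t)
    have "(x j t)\<^sup>2 \<le> qt 0 j j t"
      using eigen_equation.coordinate_le[OF elim(2), of j] unfolding c_eq[OF elim(2) refl] q_eq[OF elim(2)] .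
    also have "\<dots> \<le> 1 + \<gamma> (fst t)" using elim(4) by (simp add: \<gamma>_def)
    also have "\<dots> \<le> 2\<^sup>2" using elim(3) by simp
    finally have "\<bar>x j t\<bar> \<le> \<bar>2\<bar>" by (simp only: abs_le_square_iff)
    then show ?case by simp
  qed
qed auto

lemma R_bigo:
  assumes "j \<in> {1..k}" "0 < K" shows "Rt j \<in> O[FK K](\<lambda>t. (s (fst t))\<^sup>2)"
proof (rule bigo_bound)
  show "eventually (\<lambda>t. \<bar>Rt j t\<bar> \<le> (sqrt K * F\<^sup>2) * (s (fst t))\<^sup>2) (FK K)"
    using base_FK eigen_FK
  proof eventually_elim
    case (elim t)
    have "(Rt j t)\<^sup>2 \<le> qt 8 j j t"
      using eigen_equation.remainder_le[OF elim(2), of j] unfolding q_eq[OF elim(2)] Rt_def .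
    also have "\<dots> \<le> K * (F * s (fst t)) ^ 4" using elim(1) assms(1) by (simp add: good_def qt_def)
    also have "\<dots> = ((sqrt K * F\<^sup>2) * (s (fst t))\<^sup>2)\<^sup>2"
      using assms(2) by (simp add: power_mult_distrib flip: power_mult)
    finally have "\<bar>Rt j t\<bar> \<le> \<bar>(sqrt K * F\<^sup>2) * (s (fst t))\<^sup>2\<bar>" by (simp only: abs_le_square_iff)
    then show ?case using assms(2) by (simp add: abs_mult)
  qed
qed auto

lemma z_bigo:
  assumes K: "0 < K"
  shows "zt \<in> O[FK K](\<lambda>t. s (fst t))"
proof -
  let ?h = "\<lambda>t. 4 * (s (fst t))\<^sup>2 * real k * (\<Sum>l=1..k. (\<theta> l * x l t)\<^sup>2 * qt 2 l l t)"
  have "(\<lambda>t. \<Sum>l=1..k. (\<theta> l * x l t)\<^sup>2 * qt 2 l l t) \<in> O[FK K](\<lambda>t. s (fst t))"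
  proof (rule big_sum_in_bigo)
    fix l assume l: "l \<in> {1..k}"
    have "(\<lambda>t. \<theta> l * x l t) \<in> O[FK K](\<lambda>_. 1)" using x_bigo[OF l] by simp
    then have "(\<lambda>t. (\<theta> l * x l t)\<^sup>2) \<in> O[FK K](\<lambda>_. 1\<^sup>2)" by (rule landau_o.big_power)
    then have "(\<lambda>t. (\<theta> l * x l t)\<^sup>2) \<in> O[FK K](\<lambda>_. 1)" by simp
    then show "(\<lambda>t. (\<theta> l * x l t)\<^sup>2 * qt 2 l l t) \<in> O[FK K](\<lambda>t. s (fst t))"
      by (rule bigo_mult_const[OF _ q2_bigo[OF l l K]])
  qed
  then have "(\<lambda>t. real k * 4 * (\<Sum>l=1..k. (\<theta> l * x l t)\<^sup>2 * qt 2 l l t)) \<in> O[FK K](\<lambda>t. s (fst t))"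
    by (rule bigo_mult_const[of "\<lambda>_. real k * 4", rotated]) simp
  then have h: "(\<lambda>t. real k * 4 * (\<Sum>l=1..k. (\<theta> l * x l t)\<^sup>2 * qt 2 l l t) * (4 / (\<theta> i)\<^sup>2)) \<in> O[FK K](\<lambda>t. s (fst t))"
    by (rule bigo_mult_to[where ?g2.0 = "\<lambda>_. 1"]) simp_all
  have th: "0 < \<theta> i" using theta_gt_0[OF i_range] .
  \<comment> \<open>The thresholds 1/2 and 1/4 are chosen so that 2 \<eta> \<le> \<lambda> follows,
    which is the absorption condition of \<open>norm_Wv_le\<close>. The lower bound on \<lambda>
    also yields the factor 4/\<theta>_i^2.\<close>
  have "eventually (\<lambda>t. \<theta> i / 2 < lam (fst t) (snd t) / s (fst t)) (FK K)"
    using th by (intro order_tendstoD(1)[OF lam_tendsto[OF K]]) auto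
  moreover have "eventually (\<lambda>t. \<eta> K (fst t) / s (fst t) < \<theta> i / 4) (FK K)"
    using th by (intro order_tendstoD(2)[OF tendsto_FK[OF eta_ratio_tendsto]]) auto
  ultimately have "eventually (\<lambda>t. \<bar>zt t\<bar> \<le> 1 * \<bar>real k * 4 * (\<Sum>l=1..k. (\<theta> l * x l t)\<^sup>2 * qt 2 l l t) * (4 / (\<theta> i)\<^sup>2)\<bar>) (FK K)"
    using base_FK eigen_FK
  proof eventually_elim
    case (elim t)
    let ?N = "fst t" and ?\<omega> = "snd t"
    let ?S = "\<Sum>l=1..k. (\<theta> l * x l t)\<^sup>2 * qt 2 l l t"
    have s: "0 < s ?N" using elim(3) by simp
    have lam: "\<theta> i / 2 * s ?N < lam ?N ?\<omega>" using elim(1) s by (simp add: pos_less_divide_eq)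
    have "\<eta> K ?N < \<theta> i / 4 * s ?N" using elim(2) s by (simp add: pos_divide_less_eq)
    then have "2 * \<eta> K ?N \<le> lam ?N ?\<omega>" using lam by simp
    moreover have eta: "0 \<le> \<eta> K ?N" using elim(3) \<eta>_bounds(1)[OF _ _ K] by blast
    ultimately have "(2 * \<eta> K ?N)\<^sup>2 \<le> (lam ?N ?\<omega>)\<^sup>2" by (intro power_mono) auto
    then have small: "4 * (\<eta> K ?N)\<^sup>2 \<le> (lam ?N ?\<omega>)\<^sup>2" by (simp add: power_mult_distrib)
    have N: "?N \<ge> 1" "1 \<le> real ?N * (\<epsilon> ?N * F)" and good: "?\<omega> \<in> good K ?N" using elim(3) by blast+
    have "(lam ?N ?\<omega>)\<^sup>2 * zt t \<le> 4 * (s ?N)\<^sup>2 * real k * ?S"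
      using eigen_equation.norm_Wv_le[OF elim(4) \<eta>_bounds(2)[OF N K good] small]
      unfolding c_eq[OF elim(4) refl] q_eq[OF elim(4)] zt_def .
    moreover have z0: "0 \<le> zt t" by (simp add: zt_def)
    moreover have "(\<theta> i / 2 * s ?N)\<^sup>2 \<le> (lam ?N ?\<omega>)\<^sup>2" using lam th s by (intro power_mono) auto
    ultimately have "(\<theta> i / 2 * s ?N)\<^sup>2 * zt t \<le> 4 * (s ?N)\<^sup>2 * real k * ?S"
      using mult_right_mono[of "(\<theta> i / 2 * s ?N)\<^sup>2" "(lam ?N ?\<omega>)\<^sup>2" "zt t"] by linarith
    then have "(s ?N)\<^sup>2 * ((\<theta> i)\<^sup>2 / 4 * zt t) \<le> (s ?N)\<^sup>2 * (real k * 4 * ?S)"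
      by (simp add: power_mult_distrib power_divide mult_ac)
    then have "(\<theta> i)\<^sup>2 / 4 * zt t \<le> real k * 4 * ?S" using s by (simp add: mult_le_cancel_left_pos)
    then have "zt t \<le> real k * 4 * ?S * (4 / (\<theta> i)\<^sup>2)" using th by (simp add: field_simps)
    then show ?case unfolding mult_1_left abs_of_nonneg[OF z0] by (rule order_trans[OF _ abs_ge_self])
  qed
  then have "zt \<in> O[FK K](\<lambda>t. real k * 4 * (\<Sum>l=1..k. (\<theta> l * x l t)\<^sup>2 * qt 2 l l t) * (4 / (\<theta> i)\<^sup>2))"
    by (intro bigoI[of _ 1]) simp
  then show ?thesis by (rule landau_o.big_trans[OF _ h])
qed

lemma expansion_FK:
  assumes K: "0 < K"
  shows "eigen_expansion (FK K) k i \<theta> (\<lambda>t. real (fst t)) (\<lambda>t. \<epsilon> (fst t)) (\<lambda>t. s (fst t))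
    (\<lambda>t. lam (fst t) (snd t)) zt x Rt (\<lambda>j t. Eq 2 j i (fst t)) (qt 0) (qt 1) (qt 2) (qt 3)"
proof (rule eigen_expansion.intro)
  show "i \<in> {1..k}" by (rule i_range)
  show "0 < \<theta> l" if "l \<in> {1..k}" for l by (rule theta_gt_0[OF that])
  show "\<theta> l \<noteq> \<theta> i" if "l \<in> {1..k}" "l \<noteq> i" for l by (rule theta_simple[OF that])
  show "eventually (\<lambda>t. 0 < real (fst t) \<and> 0 < \<epsilon> (fst t) \<and> \<epsilon> (fst t) \<le> 1 \<and> s (fst t) = real (fst t) * \<epsilon> (fst t)) (FK K)"
    using base_FK by eventually_elim (auto simp: s_def)
  show "((\<lambda>t. 1 / s (fst t)) \<longlongrightarrow> 0) (FK K)" by (rule tendsto_FK[OF inv_s_tendsto])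
  show "((\<lambda>t. \<epsilon> (fst t)) \<longlongrightarrow> 0) (FK K)" by (rule tendsto_FK[OF eps_tendsto])
  show "((\<lambda>t. real (fst t) powr (-2/3) / \<epsilon> (fst t)) \<longlongrightarrow> 0) (FK K)"
    by (rule tendsto_FK[OF eps_ratio_tendsto])
  show "((\<lambda>t. lam (fst t) (snd t) / s (fst t)) \<longlongrightarrow> \<theta> i) (FK K)" by (rule lam_tendsto[OF K])
  show "x l \<in> O[FK K](\<lambda>_. 1)" if "l \<in> {1..k}" for l by (rule x_bigo[OF that])
  show "eventually (\<lambda>t. 0 \<le> x i t) (FK K)"
    using base_FK
  proof eventually_elim
    case (elim t)
    then have N: "fst t \<ge> 1" "1 \<le> real (fst t) * (\<epsilon> (fst t) * F)" "snd t \<in> space (M (fst t))"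
      and ev: "eigen_condition (fst t) (snd t)" by blast+
    have "0 \<le> grid_vec (r i) (fst t) \<bullet> v (fst t) (snd t)" using ev unfolding eigen_condition_def by blast
    then show ?case unfolding eigen_equation(2)[OF N ev] x_def vf_def .
  qed
  show "(\<lambda>t. qt 0 j l t - of_bool (j = l)) \<in> O[FK K](\<lambda>t. 1 / real (fst t))"
    if "j \<in> {1..k}" "l \<in> {1..k}" for j l
  proof (rule bigo_bound)
    show "eventually (\<lambda>t. \<bar>qt 0 j l t - of_bool (j = l)\<bar> \<le> 2 * U * L * (1 / real (fst t))) (FK K)"
      by (rule q0_bound[OF that])
  qed simp
  show "eventually (\<lambda>t. lam (fst t) (snd t) ^ 4 * x j t = s (fst t) * (\<Sum>l=1..k. \<theta> l * x l t *
      (lam (fst t) (snd t) ^ 3 * qt 0 j l t + (lam (fst t) (snd t))\<^sup>2 * qt 1 j l t + lam (fst t) (snd t) * qt 2 j l t + qt 3 j l t))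
      + Rt j t) (FK K)" for j
    using eigen_FK
  proof eventually_elim
    case (elim t)
    show ?case
      using eigen_equation.expansion[OF elim, of j] unfolding c_eq[OF elim refl] q_eq[OF elim] Rt_def .
  qed
  show "eventually (\<lambda>t. lam (fst t) (snd t) * (lam (fst t) (snd t) - s (fst t) * (\<Sum>l=1..k. \<theta> l * (x l t)\<^sup>2)) =
      s (fst t) * (\<Sum>l=1..k. \<theta> l * x l t * (lam (fst t) (snd t) * x l t - s (fst t) * (\<Sum>m=1..k. \<theta> m * x m t * qt 0 l m t)))
      + zt t) (FK K)"
    using eigen_FK
  proof eventually_elim
    case (elim t)
    show ?case
      using eigen_equation.energy[OF elim] unfolding c_eq[OF elim refl] q_eq[OF elim] zt_def .
  qed
  show "qt 1 j l \<in> O[FK K](\<lambda>t. sqrt (\<epsilon> (fst t)))" if "j \<in> {1..k}" "l \<in> {1..k}" for j l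
    by (rule q1_bigo[OF that K])
  show "qt 2 j l \<in> O[FK K](\<lambda>t. s (fst t))" if "j \<in> {1..k}" "l \<in> {1..k}" for j l
    by (rule q2_bigo[OF that K])
  show "qt 3 j l \<in> O[FK K](\<lambda>t. s (fst t))" if "j \<in> {1..k}" "l \<in> {1..k}" for j l
    by (rule q3_bigo[OF that K])
  show "(\<lambda>t. qt 2 j i t - Eq 2 j i (fst t)) \<in> O[FK K](\<lambda>t. s (fst t) / sqrt (real (fst t)))" if "j \<in> {1..k}" for j
    by (rule q2_dev_bigo[OF that i_range K])
  show "(\<lambda>t. Eq 2 j i (fst t)) \<in> O[FK K](\<lambda>t. s (fst t))" if "j \<in> {1..k}" for j
    using that i_range by (intro Eq_bound) auto
  show "Rt j \<in> O[FK K](\<lambda>t. (s (fst t))\<^sup>2)" if "j \<in> {1..k}" for j by (rule R_bigo[OF that K])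
  show "zt \<in> O[FK K](\<lambda>t. s (fst t))" by (rule z_bigo[OF K])
qed

text \<open>The expansion produces e_j' W^n e_i, while the claim is stated with e_i' W^n e_j;
  symmetry of W reconciles them.\<close>

lemma q_commute: "q N m j l \<omega> = q N m l j \<omega>"
  unfolding q_def using ip_mv_power[OF symfun_noise, of N "e N j" m 0 \<omega> "e N l"]
  by (simp add: ip_commute)

text \<open>On the good event the normalised error is eventually below \<delta> for all outcomes
  simultaneously. The outcomes with a larger error therefore lie, up to a null set, in the
  complement of the good event.\<close>

theorem coordinate_small_o_p:
  assumes j: "j \<in> {1..k}" "j \<noteq> i"
  shows "small_o_p M
      (\<lambda>N \<omega>. grid_vec (r j) N \<bullet> v N \<omega> -
         1 / (\<theta> i - \<theta> j) *
         (\<theta> i * (1 / eigval i (A N \<omega>)) * (grid_vec (r i) N \<bullet> (centred (M N) N (A N) \<omega> *\<^sub>v grid_vec (r j) N)) +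
          (real N * \<epsilon> N) powi (-2) * (1 / \<theta> i) *
          (\<integral>\<omega>'. grid_vec (r i) N \<bullet> ((centred (M N) N (A N) \<omega>' ^\<^sub>m 2) *\<^sub>v grid_vec (r j) N) \<partial>M N)))
      (\<lambda>N \<omega>. 1 / (real N * sqrt (\<epsilon> N)))"
    (is "small_o_p M ?Y ?Z")
  unfolding small_o_p_def
proof (intro allI impI)
  fix \<delta> :: real assume \<delta>: "\<delta> > 0"
  let ?bad = "\<lambda>N. {\<omega> \<in> space (M N). \<delta> * \<bar>?Z N \<omega>\<bar> < \<bar>?Y N \<omega>\<bar>}"
  show "(\<lambda>N. measure (M N) (?bad N)) \<longlonglongrightarrow> 0"
  proof (rule tendstoI)
    fix \<tau> :: real assume \<tau>: "0 < \<tau>"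
    \<comment> \<open>The summand 1 keeps \<open>K\<close> positive and makes
      \<open>prob_const / K\<close> strictly smaller than \<tau>.\<close>
    define K where "K = prob_const / \<tau> + 1"
    have "0 \<le> prob_const" using U unfolding prob_const_def by simp
    then have K: "0 < K" "prob_const < \<tau> * K" using \<tau> by (auto simp: K_def field_simps add_pos_nonneg)
    interpret X: eigen_expansion "FK K" k i \<theta> "\<lambda>t. real (fst t)" "\<lambda>t. \<epsilon> (fst t)" "\<lambda>t. s (fst t)"
      "\<lambda>t. lam (fst t) (snd t)" zt x Rt "\<lambda>j t. Eq 2 j i (fst t)" "qt 0" "qt 1" "qt 2" "qt 3"
      by (rule expansion_FK[OF K(1)])
    have "eventually (\<lambda>t. \<bar>(x j t - X.main_term j t) * (real (fst t) * sqrt (\<epsilon> (fst t)))\<bar> < \<delta>) (FK K)"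
      using tendstoD[OF X.coordinate_error[OF j] \<delta>] by (simp add: dist_real_def)
    then have "\<forall>\<^sub>F N in sequentially. \<forall>\<omega>. \<omega> \<in> good K N \<longrightarrow> eigen_condition N \<omega> \<longrightarrow>
        \<bar>(x j (N, \<omega>) - X.main_term j (N, \<omega>)) * (real N * sqrt (\<epsilon> N))\<bar> < \<delta>"
      unfolding eventually_FK by simp
    then show "\<forall>\<^sub>F N in sequentially. dist (measure (M N) (?bad N)) 0 < \<tau>"
      using large
    proof eventually_elim
      case (elim N)
      then have N: "N \<ge> 1" "1 \<le> real N * (\<epsilon> N * F)" "N \<ge> i" by auto
      interpret prob_space "M N" by (rule prob[OF N(1)])
      have Y: "?Y N \<omega> = x j (N, \<omega>) - X.main_term j (N, \<omega>)"
        if \<omega>: "\<omega> \<in> space (M N)" and ev: "eigen_condition N \<omega>" for \<omega>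
      proof -
        have "grid_vec (r j) N \<bullet> v N \<omega> = x j (N, \<omega>)"
          using eigen_equation(2)[OF N(1,2) \<omega> ev] by (simp add: x_def vf_def)
        moreover have "grid_vec (r i) N \<bullet> (centred (M N) N (A N) \<omega> *\<^sub>v grid_vec (r j) N) = qt 1 j i (N, \<omega>)"
          using centred_1[OF N(1,2) \<omega>, of i j] q_commute by (simp add: qt_def)
        moreover have "(\<integral>\<omega>'. grid_vec (r i) N \<bullet> ((centred (M N) N (A N) \<omega>' ^\<^sub>m 2) *\<^sub>v grid_vec (r j) N) \<partial>M N) = Eq 2 j i N"
          unfolding Eq_def using centred_2[OF N(1,2), of _ i j] q_commute
          by (intro Bochner_Integration.integral_cong) auto
        ultimately show ?thesis unfolding X.main_term_def by (simp add: s_def lam_def)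
      qed
      have "measure (M N) (?bad N) \<le> measure (M N) (space (M N) - good K N)"
      \<comment> \<open>The inclusion is needed only almost everywhere, because the eigenvector
        conditions are assumed almost surely.\<close>
      proof (rule finite_measure_mono_AE)
        show "space (M N) - good K N \<in> sets (M N)" using good_event[OF N(1,2) K(1)] by auto
        have "AE \<omega> in M N. eigen_condition N \<omega>" using v[OF N(3)] by (simp add: eigen_condition_def)
        then show "AE \<omega> in M N. \<omega> \<in> ?bad N \<longrightarrow> \<omega> \<in> space (M N) - good K N"
        proof eventually_elim
          case H: (elim \<omega>)
          show ?case
          proof
            assume bad: "\<omega> \<in> ?bad N"
            then have \<omega>: "\<omega> \<in> space (M N)" by simp
            have "\<omega> \<notin> good K N"
            proof
              assume "\<omega> \<in> good K N"
              then have lt: "\<bar>?Y N \<omega> * (real N * sqrt (\<epsilon> N))\<bar> < \<delta>"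
                using elim(1) H unfolding Y[OF \<omega> H] by blast
              have pos: "0 < real N * sqrt (\<epsilon> N)" using N(1) eps_pos[OF N(1)] by simp
              have "\<delta> * \<bar>?Z N \<omega>\<bar> < \<bar>?Y N \<omega>\<bar>" using bad by blast
              then have "\<delta> * (1 / (real N * sqrt (\<epsilon> N))) < \<bar>?Y N \<omega>\<bar>"
                using pos by (simp only: abs_of_pos zero_less_divide_1_iff)
              then have "\<delta> < \<bar>?Y N \<omega>\<bar> * (real N * sqrt (\<epsilon> N))"
                using pos by (simp only: times_divide_eq_right mult_1_right pos_divide_less_eq)
              then show False using lt pos
                unfolding abs_mult[of "?Y N \<omega>" "real N * sqrt (\<epsilon> N)"] abs_of_pos[OF pos] by linarith
            qed
            then show "\<omega> \<in> space (M N) - good K N" using \<omega> by simp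
          qed
        qed
      qed
      also have "\<dots> \<le> prob_const / K" by (rule prob_good[OF N(1,2) K(1)])
      also have "\<dots> < \<tau>" using K by (simp add: field_simps)
      finally show ?case by (simp add: dist_real_def)
    qed
  qed
qed

end

theorem theorem2p6:
  fixes k i :: nat
    and \<theta> :: "nat \<Rightarrow> real"
    and r :: "nat \<Rightarrow> real \<Rightarrow> real"
    and \<epsilon> :: "nat \<Rightarrow> real"
    and M :: "nat \<Rightarrow> 'a measure"
    and A :: "nat \<Rightarrow> 'a \<Rightarrow> real mat"
    and v :: "nat \<Rightarrow> 'a \<Rightarrow> real vec"
  defines "f \<equiv> conn_kernel k \<theta> r"
    and "W \<equiv> \<lambda>N. centred (M N) N (A N)"
    and "e \<equiv> \<lambda>j N. grid_vec (r j) N"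
  assumes theta_mono: "\<And>a b. 1 \<le> a \<Longrightarrow> a \<le> b \<Longrightarrow> b \<le> k \<Longrightarrow> \<theta> b \<le> \<theta> a"
    and theta_pos: "\<theta> k > 0"
    and orthonormal: "orthonormal_L2 {1..k} r"
    and f_nonneg: "\<And>x y. x \<in> {0..1} \<Longrightarrow> y \<in> {0..1} \<Longrightarrow> f x y \<ge> 0"
    and eps_bounds: "\<And>N. N \<ge> 1 \<Longrightarrow>
          0 < \<epsilon> N \<and> \<epsilon> N \<le> inverse (SUP (x, y)\<in>{0..1}\<times>{0..1}. f x y)"
    and prob: "\<And>N. N \<ge> 1 \<Longrightarrow> prob_space (M N)"
    and A: "\<And>N. N \<ge> 1 \<Longrightarrow>
          bernoulli_symmetric (M N) N (\<lambda>a b. \<epsilon> N * f (grid N a) (grid N b)) (A N)"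
    and k: "k \<ge> 2"
    and i: "i \<in> simple_indices k \<theta>"
    and Lipschitz: "\<And>j. j \<in> {1..k} \<Longrightarrow> \<exists>L. L-lipschitz_on {0..1} (r j)"
    and eps_lower: "(\<lambda>N. real N powr (-2/3)) \<lless> \<epsilon>"
    and eps_upper: "\<epsilon> \<lless> (\<lambda>_. 1)"
    and v_carrier: "\<And>N \<omega>. N \<ge> i \<Longrightarrow> \<omega> \<in> space (M N) \<Longrightarrow> v N \<omega> \<in> carrier_vec N"
    and v_measurable: "\<And>N m. N \<ge> i \<Longrightarrow> m < N \<Longrightarrow> (\<lambda>\<omega>. v N \<omega> $ m) \<in> borel_measurable (M N)"
    and v: "\<And>N. N \<ge> i \<Longrightarrow> AE \<omega> in M N.
          eigenvector (A N \<omega>) (v N \<omega>) (eigval i (A N \<omega>)) \<and>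
          euclid_norm (v N \<omega>) = 1 \<and> e i N \<bullet> v N \<omega> \<ge> 0"
  shows "\<forall>j \<in> {1..k} - {i}.
    small_o_p M
      (\<lambda>N \<omega>. e j N \<bullet> v N \<omega> -
         1 / (\<theta> i - \<theta> j) *
         (\<theta> i * (1 / eigval i (A N \<omega>)) * (e i N \<bullet> (W N \<omega> *\<^sub>v e j N)) +
          (real N * \<epsilon> N) powi (-2) * (1 / \<theta> i) *
          (\<integral>\<omega>'. e i N \<bullet> ((W N \<omega>' ^\<^sub>m 2) *\<^sub>v e j N) \<partial>M N)))
      (\<lambda>N \<omega>. 1 / (real N * sqrt (\<epsilon> N)))"
proof -
  obtain U L :: real where UL: "0 \<le> U" "0 \<le> L"
    "\<And>j x. j \<in> {1..k} \<Longrightarrow> x \<in> {0..1} \<Longrightarrow> \<bar>r j x\<bar> \<le> U"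
    "\<And>j x y. j \<in> {1..k} \<Longrightarrow> x \<in> {0..1} \<Longrightarrow> y \<in> {0..1} \<Longrightarrow> \<bar>r j x - r j y\<bar> \<le> L * \<bar>x - y\<bar>"
    using lipschitz_family_bounds[of k r, OF Lipschitz] by blast
  interpret S: sbm k i \<theta> r \<epsilon> M A v U L
    by (rule sbm.intro[OF theta_mono theta_pos orthonormal f_nonneg[unfolded f_def] eps_bounds[unfolded f_def]
          prob A[unfolded f_def] i eps_lower eps_upper v[unfolded e_def] UL])
  show ?thesis unfolding e_def W_def using S.coordinate_small_o_p by blast
qed

end
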